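(* Let $\omega=(\omega_1,\omega_2)\in\mathbb{R}^2\setminus\{0\}$ and let $H_\omega=\Delta+D$ be the lattice Schrödinger operator on $\ell^2(\mathbb{Z}^2)$ given by $$(H_\omega u)(n)=\sum_{m\in\mathbb{Z}^2,\ |n-m|=1}u(m)+(\omega\cdot n)\,u(n).$$ Then: (I) (Axis-parallel direction) If $\omega_1=0$ or $\omega_2=0$, then the spectrum $\sigma(H_\omega)$ is purely absolutely continuous. (II) (Non-axis-parallel rational direction) If there exists $\ell\in\mathbb{Z}^2\setminus\{0\}$ such that $\omega\cdot\ell=0$, but $\omega_1\neq0$ and $\omega_2\neq0$, then $\sigma(H_\omega)$ is purely essential. (III) (Irrational direction) If $\omega\cdot\ell\neq0$ for every $\ell\in\mathbb{Z}^2\setminus\{0\}$, then $\sigma(H_\omega)$ is purely point. Moreover, for every $a>0$ there exist a complete orthonormal basis $\{\psi_n\}_{n\in\mathbb{Z}^2}$ of $\ell^2(\mathbb{Z}^2)$ consisting of eigenvectors of $H_\omega$ and a constant $C_{\omega,a}>0$ depending only on $\omega$ and $a$ such that, for all $n,m\in\mathbb{Z}^2$, $$|\psi_n(m)|\le C_{\omega,a}\,e^{-a|m-n|}.$$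
   Context: For $n=(n_1,n_2)\in\mathbb{Z}^2$, $|n|=|n_1|+|n_2|$ and $\omega\cdot n=\omega_1n_1+\omega_2n_2$. $D$ is multiplication by $\omega\cdot n$ and $\Delta$ is the nearest-neighbour hopping operator $(\Delta u)(n)=\sum_{|m-n|=1}u(m)$ (no diagonal term). $H_\omega$ is viewed as the (generally unbounded) self-adjoint operator with domain $\{u\in\ell^2(\mathbb{Z}^2): Du\in\ell^2(\mathbb{Z}^2)\}$. "Purely absolutely continuous" means that all spectral measures of $H_\omega$ are absolutely continuous with respect to Lebesgue measure; "purely essential" means that $\sigma(H_\omega)$ equals the essential spectrum of $H_\omega$; "purely point" means that $\ell^2(\mathbb{Z}^2)$ has an orthonormal basis of eigenvectors of $H_\omega$. *)

theory Defs
  imports "HOL-Analysis.Analysis"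
begin

section \<open>The Hilbert space \<open>\<ell>\<^sup>2\<close> over an index set\<close>

definition ell2 :: "('i \<Rightarrow> complex) set" where
  "ell2 = {u. (\<lambda>n. (cmod (u n))\<^sup>2) summable_on UNIV}"

definition ip :: "('i \<Rightarrow> complex) \<Rightarrow> ('i \<Rightarrow> complex) \<Rightarrow> complex" where
  "ip u v = (\<Sum>\<^sub>\<infinity>n. cnj (u n) * v n)"

definition l2norm :: "('i \<Rightarrow> complex) \<Rightarrow> real" where
  "l2norm u = sqrt (\<Sum>\<^sub>\<infinity>n. (cmod (u n))\<^sup>2)"

definition orthonormal_basis :: "('i \<Rightarrow> complex) set \<Rightarrow> bool" where
  "orthonormal_basis B \<longleftrightarrow>
     B \<subseteq> ell2 \<and>
     (\<forall>u\<in>B. \<forall>v\<in>B. ip u v = (if u = v then 1 else 0)) \<and>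
     (\<forall>u\<in>ell2. \<forall>\<epsilon>>0. \<exists>F c. finite F \<and> F \<subseteq> B \<and>
        l2norm (\<lambda>n. u n - (\<Sum>b\<in>F. c b * b n)) < \<epsilon>)"

section \<open>Unbounded operators on \<open>\<ell>\<^sup>2\<close>\<close>

text \<open>An operator is given by its domain \<open>\<D> \<subseteq> ell2\<close> and its action \<open>T\<close>; only the values of
  \<open>T\<close> on \<open>\<D>\<close> matter.\<close>

definition resolvent_set ::
    "('i \<Rightarrow> complex) set \<Rightarrow> (('i \<Rightarrow> complex) \<Rightarrow> ('i \<Rightarrow> complex)) \<Rightarrow> complex set" where
  "resolvent_set \<D> T =
     {z. bij_betw (\<lambda>u n. T u n - z * u n) \<D> ell2 \<and>
         (\<exists>C. \<forall>u\<in>\<D>. l2norm u \<le> C * l2norm (\<lambda>n. T u n - z * u n))}"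

definition spectrum ::
    "('i \<Rightarrow> complex) set \<Rightarrow> (('i \<Rightarrow> complex) \<Rightarrow> ('i \<Rightarrow> complex)) \<Rightarrow> complex set" where
  "spectrum \<D> T = - resolvent_set \<D> T"

definition eigenspace ::
    "('i \<Rightarrow> complex) set \<Rightarrow> (('i \<Rightarrow> complex) \<Rightarrow> ('i \<Rightarrow> complex)) \<Rightarrow> complex
      \<Rightarrow> ('i \<Rightarrow> complex) set" where
  "eigenspace \<D> T z = {u \<in> \<D>. \<forall>n. T u n = z * u n}"

definition eigenvector ::
    "('i \<Rightarrow> complex) set \<Rightarrow> (('i \<Rightarrow> complex) \<Rightarrow> ('i \<Rightarrow> complex)) \<Rightarrow> ('i \<Rightarrow> complex) \<Rightarrow> bool" where
  "eigenvector \<D> T u \<longleftrightarrow> u \<noteq> (\<lambda>n. 0) \<and> (\<exists>z. u \<in> eigenspace \<D> T z)"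

definition finite_dimensional :: "('i \<Rightarrow> complex) set \<Rightarrow> bool" where
  "finite_dimensional V \<longleftrightarrow>
     (\<exists>F. finite F \<and> (\<forall>u\<in>V. \<exists>c. u = (\<lambda>n. \<Sum>b\<in>F. c b * b n)))"

text \<open>For a self-adjoint operator the essential spectrum is the complement in the spectrum of the
  discrete spectrum, i.e. of the isolated points of the spectrum which are eigenvalues of finite
  multiplicity.\<close>

definition discrete_spectrum ::
    "('i \<Rightarrow> complex) set \<Rightarrow> (('i \<Rightarrow> complex) \<Rightarrow> ('i \<Rightarrow> complex)) \<Rightarrow> complex set" where
  "discrete_spectrum \<D> T =
     {z \<in> spectrum \<D> T. \<not> z islimpt spectrum \<D> T \<and>
        eigenspace \<D> T z \<noteq> {\<lambda>n. 0} \<and> finite_dimensional (eigenspace \<D> T z)}"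

definition essential_spectrum ::
    "('i \<Rightarrow> complex) set \<Rightarrow> (('i \<Rightarrow> complex) \<Rightarrow> ('i \<Rightarrow> complex)) \<Rightarrow> complex set" where
  "essential_spectrum \<D> T = spectrum \<D> T - discrete_spectrum \<D> T"

section \<open>Spectral measures\<close>

text \<open>Projection-valued Borel measures on the real line; countable additivity is in the strong
  operator topology.\<close>

definition projection_valued_measure ::
    "(real set \<Rightarrow> ('i \<Rightarrow> complex) \<Rightarrow> ('i \<Rightarrow> complex)) \<Rightarrow> bool" where
  "projection_valued_measure E \<longleftrightarrow>
     (\<forall>A\<in>sets borel.
        (\<forall>u\<in>ell2. E A u \<in> ell2 \<and> E A (E A u) = E A u) \<and>
        (\<forall>u\<in>ell2. \<forall>v\<in>ell2. \<forall>a b.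
           E A (\<lambda>n. a * u n + b * v n) = (\<lambda>n. a * E A u n + b * E A v n)) \<and>
        (\<forall>u\<in>ell2. \<forall>v\<in>ell2. ip (E A u) v = ip u (E A v))) \<and>
     (\<forall>u\<in>ell2. E UNIV u = u) \<and>
     (\<forall>A :: nat \<Rightarrow> real set. range A \<subseteq> sets borel \<longrightarrow> disjoint_family A \<longrightarrow>
        (\<forall>u\<in>ell2. (\<lambda>k. l2norm (\<lambda>n. E (\<Union>i. A i) u n - (\<Sum>i<k. E (A i) u n))) \<longlonglongrightarrow> 0))"

definition spectral_measure ::
    "(real set \<Rightarrow> ('i \<Rightarrow> complex) \<Rightarrow> ('i \<Rightarrow> complex)) \<Rightarrow> ('i \<Rightarrow> complex) \<Rightarrow> real measure" where
  "spectral_measure E u =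
     measure_of UNIV (sets borel) (\<lambda>A. ennreal (Re (ip u (E A u))))"

text \<open>\<open>T = \<integral> \<lambda> dE(\<lambda>)\<close>, including equality of domains. The action is compared through the
  quadratic forms, which determine it by polarization because the domain is dense.\<close>

definition spectral_resolution ::
    "('i \<Rightarrow> complex) set \<Rightarrow> (('i \<Rightarrow> complex) \<Rightarrow> ('i \<Rightarrow> complex))
      \<Rightarrow> (real set \<Rightarrow> ('i \<Rightarrow> complex) \<Rightarrow> ('i \<Rightarrow> complex)) \<Rightarrow> bool" where
  "spectral_resolution \<D> T E \<longleftrightarrow>
     projection_valued_measure E \<and>
     \<D> = {u \<in> ell2. integrable (spectral_measure E u) (\<lambda>x. x\<^sup>2)} \<and>
     (\<forall>u\<in>\<D>. T u \<in> ell2 \<and>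
        ip u (T u) = complex_of_real (\<integral>x. x \<partial>spectral_measure E u))"

section \<open>Spectral types\<close>

text \<open>A self-adjoint operator has exactly one spectral resolution, so the existential quantifier
  merely names it (and makes the condition non-vacuous).\<close>

definition purely_absolutely_continuous ::
    "('i \<Rightarrow> complex) set \<Rightarrow> (('i \<Rightarrow> complex) \<Rightarrow> ('i \<Rightarrow> complex)) \<Rightarrow> bool" where
  "purely_absolutely_continuous \<D> T \<longleftrightarrow>
     (\<exists>E. spectral_resolution \<D> T E \<and>
        (\<forall>u\<in>ell2. absolutely_continuous lborel (spectral_measure E u)))"

definition purely_essential ::
    "('i \<Rightarrow> complex) set \<Rightarrow> (('i \<Rightarrow> complex) \<Rightarrow> ('i \<Rightarrow> complex)) \<Rightarrow> bool" where
  "purely_essential \<D> T \<longleftrightarrow> spectrum \<D> T = essential_spectrum \<D> T"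

definition purely_point ::
    "('i \<Rightarrow> complex) set \<Rightarrow> (('i \<Rightarrow> complex) \<Rightarrow> ('i \<Rightarrow> complex)) \<Rightarrow> bool" where
  "purely_point \<D> T \<longleftrightarrow>
     (\<exists>B. orthonormal_basis B \<and> (\<forall>u\<in>B. eigenvector \<D> T u))"

section \<open>The lattice operator\<close>

type_synonym lattice = "int \<times> int"

definition l1norm :: "lattice \<Rightarrow> int" where
  "l1norm n = \<bar>fst n\<bar> + \<bar>snd n\<bar>"

definition dot :: "real \<times> real \<Rightarrow> lattice \<Rightarrow> real" where
  "dot \<omega> n = fst \<omega> * of_int (fst n) + snd \<omega> * of_int (snd n)"

definition hopping :: "(lattice \<Rightarrow> complex) \<Rightarrow> (lattice \<Rightarrow> complex)" where
  "hopping u = (\<lambda>n. \<Sum>m | l1norm (n - m) = 1. u m)"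

definition potential :: "real \<times> real \<Rightarrow> (lattice \<Rightarrow> complex) \<Rightarrow> (lattice \<Rightarrow> complex)" where
  "potential \<omega> u = (\<lambda>n. complex_of_real (dot \<omega> n) * u n)"

definition H_op :: "real \<times> real \<Rightarrow> (lattice \<Rightarrow> complex) \<Rightarrow> (lattice \<Rightarrow> complex)" where
  "H_op \<omega> u = (\<lambda>n. hopping u n + potential \<omega> u n)"

definition H_dom :: "real \<times> real \<Rightarrow> (lattice \<Rightarrow> complex) set" where
  "H_dom \<omega> = {u \<in> ell2. potential \<omega> u \<in> ell2}"

text \<open>The sum in \<^const>\<open>hopping\<close> is over a finite set (a sum over an infinite set would be \<open>0\<close>).\<close>

lemma neighbours:
  "{m. l1norm (n - m) = 1} =
     {n + (1, 0), n - (1, 0), n + (0, 1), n - (0, 1)}"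
proof (rule set_eqI)
  fix m :: lattice
  obtain n1 n2 where n: "n = (n1, n2)" by (cases n)
  obtain m1 m2 where m: "m = (m1, m2)" by (cases m)
  show "m \<in> {m. l1norm (n - m) = 1} \<longleftrightarrow>
          m \<in> {n + (1, 0), n - (1, 0), n + (0, 1), n - (0, 1)}"
    unfolding n m l1norm_def by (simp add: abs_if) presburger
qed

end

theory Submission
  imports Defs "HOL-Library.Function_Algebras"
begin

text \<open>The proof rests on the explicit diagonalisation of the one-dimensional Stark operator. If \<open>b\<close> is a
sequence on \<open>\<int>\<close> with \<open>y (b(m - 1) + b(m + 1)) = m b(m)\<close> and \<open>y = -1/w\<close>, then its translate by \<open>j\<close> is
an eigenvector of \<open>v(k) \<mapsto> v(k + 1) + v(k - 1) + w k v(k)\<close> for the eigenvalue \<open>w j\<close>. Bessel functions of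
integer order are such sequences. They decay faster than every exponential, and the translates, being
eigenvectors of a symmetric operator for distinct eigenvalues, are orthogonal. Since the matrix
\<open>b(k - j)\<close> is Toeplitz, orthonormal columns come together with orthonormal rows, so the translates
even form an orthonormal basis (lemmas \<open>bessel_orthonormal\<close> and \<open>bessel_orthonormal_transpose\<close>).

If both components of \<open>\<omega>\<close> are non-zero, the products \<open>\<psi>_n(m) = b_1(m_1 - n_1) b_2(m_2 - n_2)\<close>, the
Wannier-Stark states, form an orthonormal basis with \<open>H \<psi>_n = (\<omega> \<cdot> n) \<psi>_n\<close>, which settles the irrational
direction. In a non-axis-parallel rational direction every eigenvalue is some \<open>\<omega> \<cdot> n\<close> by completeness of
the basis, and \<open>\<psi>_{n + k l}\<close>, \<open>k \<in> \<nat>\<close>, are infinitely many orthonormal eigenvectors for it; hence there is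
no discrete spectrum.

If \<open>\<omega>_2 = 0\<close>, the same functions still form an orthonormal basis (the formula for the second parameter
reads \<open>-1/0 = 0\<close>), and in this basis \<open>H\<close> becomes the strip operator
\<open>v(j, n) \<mapsto> \<omega>_1 j v(j, n) + v(j, n + 1) + v(j, n - 1)\<close>. On the \<open>j\<close>-th line this is \<open>\<omega>_1 j\<close> plus the
one-dimensional hopping operator, which the Fourier transform turns into multiplication by \<open>2 cos t\<close>. So
functions \<open>f\<close> of the strip operator are given by the kernels
\<open>K_f((j, n), (i, m)) = \<delta>_{ij} (1/2\<pi>) \<integral> f(\<omega>_1 j + 2 cos t) e^{i (n - m) t} dt\<close> over \<open>[-\<pi>, \<pi>]\<close>, and the
spectral projections are \<open>E(A) = K_{1_A}\<close>. The one non-trivial point is the product law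
\<open>K_f K_g = K_{fg}\<close>. It is immediate for \<open>f = 1\<close>, passes from \<open>f\<close> to \<open>x f(x)\<close> because \<open>2 cos t\<close> shifts Fourier
coefficients, and survives bounded pointwise limits; the theorem of Weierstrass and a Dynkin argument then
give all bounded Borel functions (lemma \<open>functional_law_bborel\<close>). Throughout, kernels take the place
of multiplication operators on \<open>L\<^sup>2\<close> of the circle.

That \<open>E\<close> is the spectral resolution of the operator, including the domain, follows by cutting off the
identity function at \<open>\<plusminus>N\<close> (lemma \<open>spectral_resolution_pvm\<close>). Its spectral measures are absolutely continuous because
\<open>t \<mapsto> c + 2 cos t\<close> pulls Lebesgue null sets back to null sets. The case \<open>\<omega>_1 = 0\<close> differs by exchanging
the coordinates of the label.\<close>

section \<open>The Hilbert space \<open>\<ell>\<^sup>2\<close>\<close>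

lemma ell2_iff_bounded_sums:
  "u \<in> ell2 \<longleftrightarrow> (\<exists>C. \<forall>F. finite F \<longrightarrow> (\<Sum>n\<in>F. (cmod (u n))\<^sup>2) \<le> C)"
proof
  assume "u \<in> ell2"
  then have s: "(\<lambda>n. (cmod (u n))\<^sup>2) summable_on UNIV" by (simp add: ell2_def)
  show "\<exists>C. \<forall>F. finite F \<longrightarrow> (\<Sum>n\<in>F. (cmod (u n))\<^sup>2) \<le> C"
    using finite_sum_le_infsum[OF s] by (metis subset_UNIV zero_le_power2)
next
  assume "\<exists>C. \<forall>F. finite F \<longrightarrow> (\<Sum>n\<in>F. (cmod (u n))\<^sup>2) \<le> C"
  then obtain C where C: "\<And>F. finite F \<Longrightarrow> (\<Sum>n\<in>F. (cmod (u n))\<^sup>2) \<le> C" by blast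
  show "u \<in> ell2" unfolding ell2_def mem_Collect_eq
    by (rule nonneg_bdd_above_summable_on) (auto intro!: bdd_aboveI[where M = C] C)
qed

lemma l2norm_nonneg [simp]: "0 \<le> l2norm u"
  by (simp add: l2norm_def infsum_nonneg)

lemma l2norm_power2: "(l2norm u)\<^sup>2 = (\<Sum>\<^sub>\<infinity>n. (cmod (u n))\<^sup>2)"
  by (simp add: l2norm_def infsum_nonneg)

lemma has_sum_l2norm: "u \<in> ell2 \<Longrightarrow> ((\<lambda>n. (cmod (u n))\<^sup>2) has_sum (l2norm u)\<^sup>2) UNIV"
  by (simp add: l2norm_power2 ell2_def)

lemma sum_le_l2norm:
  assumes "u \<in> ell2" "finite F"
  shows "(\<Sum>n\<in>F. (cmod (u n))\<^sup>2) \<le> (l2norm u)\<^sup>2"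
  unfolding l2norm_power2
  by (rule finite_sum_le_infsum) (use assms in \<open>auto simp: ell2_def\<close>)

lemma ell2_bound:
  assumes "\<And>F. finite F \<Longrightarrow> (\<Sum>n\<in>F. (cmod (u n))\<^sup>2) \<le> C\<^sup>2" "0 \<le> C"
  shows "u \<in> ell2" "l2norm u \<le> C"
proof -
  show u: "u \<in> ell2" using assms ell2_iff_bounded_sums by blast
  have "(l2norm u)\<^sup>2 \<le> C\<^sup>2" unfolding l2norm_power2
    by (rule infsum_le_finite_sums) (use assms u in \<open>auto simp: ell2_def\<close>)
  then show "l2norm u \<le> C" using \<open>0 \<le> C\<close> by (rule power2_le_imp_le)
qed

lemma cmod_le_l2norm: "u \<in> ell2 \<Longrightarrow> cmod (u n) \<le> l2norm u"
  using sum_le_l2norm[of u "{n}"] by (auto intro: power2_le_imp_le)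

lemma l2norm_eq_0: "u \<in> ell2 \<Longrightarrow> l2norm u = 0 \<Longrightarrow> u = (\<lambda>n. 0)"
  using cmod_le_l2norm by (metis norm_le_zero_iff)

lemma ell2_scale:
  assumes "u \<in> ell2"
  shows "(\<lambda>n. a * u n) \<in> ell2"
  using assms summable_on_cmult_right[of "\<lambda>n. (cmod (u n))\<^sup>2" UNIV "(cmod a)\<^sup>2"]
  by (simp add: ell2_def norm_mult power_mult_distrib)

lemma l2norm_scale: "l2norm (\<lambda>n. a * u n) = cmod a * l2norm u"
  by (simp add: l2norm_def norm_mult power_mult_distrib infsum_cmult_right' real_sqrt_mult)

lemma ell2_zero [simp]: "(\<lambda>n. 0) \<in> ell2"
  by (simp add: ell2_def)

lemma l2norm_zero [simp]: "l2norm (\<lambda>n. 0) = 0"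
  by (simp add: l2norm_def)

lemma ell2_add:
  assumes "u \<in> ell2" "v \<in> ell2"
  shows "(\<lambda>n. u n + v n) \<in> ell2"
proof -
  have "(\<lambda>n. 2 * (cmod (u n))\<^sup>2 + 2 * (cmod (v n))\<^sup>2) summable_on UNIV"
    using assms by (auto simp: ell2_def intro!: summable_on_add summable_on_cmult_right)
  moreover have "(cmod (u n + v n))\<^sup>2 \<le> 2 * (cmod (u n))\<^sup>2 + 2 * (cmod (v n))\<^sup>2" for n
  proof -
    have "(cmod (u n + v n))\<^sup>2 \<le> (cmod (u n) + cmod (v n))\<^sup>2"
      by (intro power_mono norm_triangle_ineq) auto
    also have "\<dots> \<le> 2 * (cmod (u n))\<^sup>2 + 2 * (cmod (v n))\<^sup>2"
      using sum_squares_bound[of "cmod (u n)" "cmod (v n)"] by (simp add: power2_sum)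
    finally show ?thesis by simp
  qed
  ultimately show ?thesis unfolding ell2_def mem_Collect_eq
    by (rule summable_on_comparison_test) auto
qed

lemma ell2_diff:
  assumes "u \<in> ell2" "v \<in> ell2"
  shows "(\<lambda>n. u n - v n) \<in> ell2"
  using ell2_add[OF assms(1) ell2_scale[OF assms(2), of "-1"]] by simp

lemma ell2_sum:
  assumes "\<And>i. i \<in> I \<Longrightarrow> f i \<in> ell2"
  shows "(\<lambda>n. \<Sum>i\<in>I. f i n) \<in> ell2"
  using assms by (induction I rule: infinite_finite_induct) (auto intro: ell2_add)

lemma ell2_cnj: "(\<lambda>n. cnj (u n)) \<in> ell2 \<longleftrightarrow> u \<in> ell2"
  by (simp add: ell2_def)

lemma has_sum_ip:
  assumes "u \<in> ell2" "v \<in> ell2"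
  shows "((\<lambda>n. cnj (u n) * v n) has_sum ip u v) UNIV"
proof -
  have "(\<lambda>n. norm (cnj (u n) * v n)) summable_on UNIV"
  proof (rule summable_on_comparison_test)
    show "(\<lambda>n. (cmod (u n))\<^sup>2 + (cmod (v n))\<^sup>2) summable_on UNIV"
      using assms by (auto simp: ell2_def intro!: summable_on_add)
    fix n
    have "0 \<le> cmod (u n) * cmod (v n)" by simp
    then show "norm (cnj (u n) * v n) \<le> (cmod (u n))\<^sup>2 + (cmod (v n))\<^sup>2"
      using sum_squares_bound[of "cmod (u n)" "cmod (v n)"] unfolding norm_mult complex_mod_cnj by linarith
  qed simp
  then show ?thesis unfolding ip_def by (rule has_sum_infsum[OF abs_summable_summable])
qed

lemma ip_lincomb_right:
  assumes "u \<in> ell2" "v \<in> ell2" "w \<in> ell2"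
  shows "ip u (\<lambda>n. a * v n + b * w n) = a * ip u v + b * ip u w"
proof -
  have "((\<lambda>n. a * (cnj (u n) * v n) + b * (cnj (u n) * w n)) has_sum a * ip u v + b * ip u w) UNIV"
    using assms by (intro has_sum_add has_sum_cmult_right has_sum_ip)
  also have "(\<lambda>n. a * (cnj (u n) * v n) + b * (cnj (u n) * w n)) = (\<lambda>n. cnj (u n) * (a * v n + b * w n))"
    by (simp add: algebra_simps)
  finally show ?thesis by (subst ip_def) (rule infsumI)
qed

lemma cnj_ip: "cnj (ip u v) = ip v u"
  unfolding ip_def infsum_cnj[symmetric] complex_cnj_mult complex_cnj_cnj by (subst mult.commute) (rule refl)

lemma ip_lincomb_left:
  assumes "u \<in> ell2" "v \<in> ell2" "w \<in> ell2"
  shows "ip (\<lambda>n. a * v n + b * w n) u = cnj a * ip v u + cnj b * ip w u"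
proof -
  have "cnj (ip u (\<lambda>n. a * v n + b * w n)) = cnj (a * ip u v + b * ip u w)"
    using ip_lincomb_right[OF assms] by simp
  then show ?thesis by (simp add: cnj_ip)
qed

lemma ip_scale_right: "u \<in> ell2 \<Longrightarrow> v \<in> ell2 \<Longrightarrow> ip u (\<lambda>n. a * v n) = a * ip u v"
  using ip_lincomb_right[of u v v a 0] by simp

lemma ip_scale_left: "u \<in> ell2 \<Longrightarrow> v \<in> ell2 \<Longrightarrow> ip (\<lambda>n. a * v n) u = cnj a * ip v u"
  using ip_lincomb_left[of u v v a 0] by simp

lemma ip_diff_right:
  "u \<in> ell2 \<Longrightarrow> v \<in> ell2 \<Longrightarrow> w \<in> ell2 \<Longrightarrow> ip u (\<lambda>n. v n - w n) = ip u v - ip u w"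
  using ip_lincomb_right[of u v w 1 "-1"] by simp

lemma ip_diff_left:
  "u \<in> ell2 \<Longrightarrow> v \<in> ell2 \<Longrightarrow> w \<in> ell2 \<Longrightarrow> ip (\<lambda>n. v n - w n) u = ip v u - ip w u"
  using ip_lincomb_left[of u v w 1 "-1"] by simp

lemma ip_sum_right:
  assumes "u \<in> ell2" "\<And>i. i \<in> I \<Longrightarrow> f i \<in> ell2"
  shows "ip u (\<lambda>n. \<Sum>i\<in>I. c i * f i n) = (\<Sum>i\<in>I. c i * ip u (f i))"
  using assms(2)
proof (induction I rule: infinite_finite_induct)
  case (insert i I)
  have "ip u (\<lambda>n. c i * f i n + 1 * (\<Sum>i\<in>I. c i * f i n)) = c i * ip u (f i) + 1 * ip u (\<lambda>n. \<Sum>i\<in>I. c i * f i n)"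
    by (rule ip_lincomb_right) (use insert assms(1) in \<open>auto intro!: ell2_sum ell2_scale\<close>)
  then show ?case using insert by simp
qed (simp_all add: ip_def)

lemma ip_self: "ip u u = complex_of_real ((l2norm u)\<^sup>2)"
proof -
  have "cnj (u n) * u n = complex_of_real ((cmod (u n))\<^sup>2)" for n
    by (subst mult.commute) (simp add: complex_norm_square[symmetric])
  moreover have "(\<Sum>\<^sub>\<infinity>n. complex_of_real ((cmod (u n))\<^sup>2)) = complex_of_real (\<Sum>\<^sub>\<infinity>n. (cmod (u n))\<^sup>2)"
  proof (cases "(\<lambda>n. (cmod (u n))\<^sup>2) summable_on UNIV")
    case True
    then show ?thesis by (intro infsumI has_sum_of_real has_sum_infsum)
  next
    case False
    then have "\<not> (\<lambda>n. complex_of_real ((cmod (u n))\<^sup>2)) summable_on UNIV"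
      using summable_on_Re by fastforce
    with False show ?thesis by (simp only: infsum_not_exists of_real_0 not_False_eq_True)
  qed
  ultimately show ?thesis
    by (simp only: ip_def l2norm_power2)
qed

lemma cmod_ip_le_sum_squares:
  assumes "u \<in> ell2" "v \<in> ell2"
  shows "cmod (ip u v) \<le> ((l2norm u)\<^sup>2 + (l2norm v)\<^sup>2) / 2"
proof -
  have "((\<lambda>n. ((cmod (u n))\<^sup>2 + (cmod (v n))\<^sup>2) / 2) has_sum ((l2norm u)\<^sup>2 + (l2norm v)\<^sup>2) / 2) UNIV"
    using has_sum_divide_const[OF has_sum_add[OF has_sum_l2norm[OF assms(1)] has_sum_l2norm[OF assms(2)]], of 2] .
  with has_sum_ip[OF assms] show ?thesis
  proof (rule norm_infsum_le)
    fix n show "norm (cnj (u n) * v n) \<le> ((cmod (u n))\<^sup>2 + (cmod (v n))\<^sup>2) / 2"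
      using sum_squares_bound[of "cmod (u n)" "cmod (v n)"] by (simp add: norm_mult)
  qed
qed

text \<open>Normalising both vectors reduces the claim to the preceding additive inequality.\<close>

lemma ell2_Cauchy_Schwarz:
  assumes "u \<in> ell2" "v \<in> ell2"
  shows "cmod (ip u v) \<le> l2norm u * l2norm v"
proof (cases "l2norm u = 0 \<or> l2norm v = 0")
  case True
  then have "u = (\<lambda>n. 0) \<or> v = (\<lambda>n. 0)" using assms l2norm_eq_0 by blast
  then show ?thesis by (auto simp: ip_def)
next
  case False
  let ?a = "complex_of_real (1 / l2norm u)" and ?b = "complex_of_real (1 / l2norm v)"
  have "ip (\<lambda>n. ?a * u n) (\<lambda>n. ?b * v n) = cnj ?a * (?b * ip u v)"
    using ip_scale_left[of "\<lambda>n. ?b * v n" u ?a] ip_scale_right[of u v ?b] assms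
    by (simp only: ell2_scale)
  moreover have "cmod (ip (\<lambda>n. ?a * u n) (\<lambda>n. ?b * v n)) \<le> ((l2norm (\<lambda>n. ?a * u n))\<^sup>2 + (l2norm (\<lambda>n. ?b * v n))\<^sup>2) / 2"
    using assms by (intro cmod_ip_le_sum_squares ell2_scale)
  moreover have "l2norm (\<lambda>n. ?a * u n) = 1" "l2norm (\<lambda>n. ?b * v n) = 1"
    using False by (simp_all only: l2norm_scale) (auto simp: norm_divide norm_inverse)
  ultimately have "cmod (cnj ?a * (?b * ip u v)) \<le> 1" by (simp only:) simp
  moreover have "cmod (cnj ?a * (?b * ip u v)) = cmod (ip u v) / (l2norm u * l2norm v)"
    by (simp add: norm_mult norm_divide)
  ultimately have "cmod (ip u v) / (l2norm u * l2norm v) \<le> 1" by (simp only:)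
  moreover have "0 < l2norm u * l2norm v" using False
    by (simp add: less_le)
  ultimately show ?thesis by (simp add: divide_le_eq)
qed

definition trunc :: "'i set \<Rightarrow> ('i \<Rightarrow> complex) \<Rightarrow> ('i \<Rightarrow> complex)" where
  "trunc F u = (\<lambda>n. if n \<in> F then u n else 0)"

lemma trunc_ell2: "u \<in> ell2 \<Longrightarrow> trunc F u \<in> ell2"
  unfolding ell2_def mem_Collect_eq
  by (erule summable_on_comparison_test) (auto simp: trunc_def)

lemma trunc_finite_ell2: "finite F \<Longrightarrow> trunc F u \<in> ell2"
  unfolding ell2_def mem_Collect_eq
  using summable_on_cong_neutral[of F UNIV "\<lambda>n. (cmod (trunc F u n))\<^sup>2" "\<lambda>n. (cmod (trunc F u n))\<^sup>2"]
  by (auto simp: trunc_def)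

lemma l2norm_trunc_finite: "finite F \<Longrightarrow> (l2norm (trunc F u))\<^sup>2 = (\<Sum>n\<in>F. (cmod (u n))\<^sup>2)"
  unfolding l2norm_power2
  using infsum_cong_neutral[of F UNIV "\<lambda>n. (cmod (u n))\<^sup>2" "\<lambda>n. (cmod (trunc F u n))\<^sup>2"]
  by (simp add: trunc_def)

lemma trunc_tail_small:
  assumes "u \<in> ell2" "0 < \<epsilon>"
  obtains F where "finite F" "l2norm (\<lambda>n. u n - trunc F u n) < \<epsilon>"
proof -
  have "((\<lambda>F. \<Sum>n\<in>F. (cmod (u n))\<^sup>2) \<longlongrightarrow> (l2norm u)\<^sup>2) (finite_subsets_at_top UNIV)"
    using has_sum_l2norm[OF assms(1)] by (simp add: has_sum_def)
  then have "\<forall>\<^sub>F F in finite_subsets_at_top UNIV. dist (\<Sum>n\<in>F. (cmod (u n))\<^sup>2) ((l2norm u)\<^sup>2) < \<epsilon>\<^sup>2"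
    using assms(2) by (intro tendstoD) auto
  then obtain F where F: "finite F" "dist (\<Sum>n\<in>F. (cmod (u n))\<^sup>2) ((l2norm u)\<^sup>2) < \<epsilon>\<^sup>2"
    by (auto simp: eventually_finite_subsets_at_top)
  let ?v = "\<lambda>n. u n - trunc F u n"
  have v: "?v \<in> ell2" using assms trunc_ell2 ell2_diff by blast
  have "((\<lambda>n. (cmod (u n))\<^sup>2 - (cmod (trunc F u n))\<^sup>2) has_sum (l2norm u)\<^sup>2 - (\<Sum>n\<in>F. (cmod (u n))\<^sup>2)) UNIV"
    using has_sum_add[OF has_sum_l2norm[OF assms(1)]
        has_sum_uminusI[OF has_sum_l2norm[OF trunc_finite_ell2[OF F(1), of u]]]]
    by (simp add: l2norm_trunc_finite[OF F(1)])
  also have "(\<lambda>n. (cmod (u n))\<^sup>2 - (cmod (trunc F u n))\<^sup>2) = (\<lambda>n. (cmod (?v n))\<^sup>2)"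
    by (auto simp: trunc_def)
  finally have "(l2norm ?v)\<^sup>2 = (l2norm u)\<^sup>2 - (\<Sum>n\<in>F. (cmod (u n))\<^sup>2)"
    using has_sum_l2norm[OF v] by (rule has_sum_unique[rotated])
  also have "\<dots> < \<epsilon>\<^sup>2" using F(2) by (simp add: dist_real_def)
  finally show ?thesis using F(1) assms(2) that by (meson less_eq_real_def power2_less_imp_less)
qed

text \<open>Fatou's lemma for the counting measure. It recovers membership in \<^const>\<open>ell2\<close>, and with it
membership in operator domains, from bounded approximations.\<close>

lemma l2norm_le_of_pointwise_limit:
  assumes u: "\<And>k. u k \<in> ell2" and b: "\<And>k. l2norm (u k) \<le> C"
    and lim: "\<And>n. (\<lambda>k. u k n) \<longlonglongrightarrow> v n"
  shows "v \<in> ell2" "l2norm v \<le> C"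
proof -
  have C: "0 \<le> C" using l2norm_nonneg b order_trans by blast
  have *: "(\<Sum>n\<in>F. (cmod (v n))\<^sup>2) \<le> C\<^sup>2" if "finite F" for F
  proof (rule LIMSEQ_le_const2)
    show "(\<lambda>k. \<Sum>n\<in>F. (cmod (u k n))\<^sup>2) \<longlonglongrightarrow> (\<Sum>n\<in>F. (cmod (v n))\<^sup>2)"
      by (intro tendsto_sum tendsto_power tendsto_norm lim)
    have "(\<Sum>n\<in>F. (cmod (u k n))\<^sup>2) \<le> C\<^sup>2" for k
      using sum_le_l2norm[OF u that] power_mono[OF b l2norm_nonneg, of k 2] order_trans by blast
    then show "\<exists>N. \<forall>k\<ge>N. (\<Sum>n\<in>F. (cmod (u k n))\<^sup>2) \<le> C\<^sup>2" by blast
  qed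
  show "v \<in> ell2" "l2norm v \<le> C" using ell2_bound[OF * C] by auto
qed

lemma ip_add_right: "u \<in> ell2 \<Longrightarrow> v \<in> ell2 \<Longrightarrow> w \<in> ell2 \<Longrightarrow> ip u (\<lambda>n. v n + w n) = ip u v + ip u w"
  using ip_lincomb_right[of u v w 1 1] by simp

lemma ip_add_left: "u \<in> ell2 \<Longrightarrow> v \<in> ell2 \<Longrightarrow> w \<in> ell2 \<Longrightarrow> ip (\<lambda>n. v n + w n) u = ip v u + ip w u"
  using ip_lincomb_left[of u v w 1 1] by simp

section \<open>Operators given by bounded kernels\<close>

definition kop :: "('i \<Rightarrow> 'j \<Rightarrow> complex) \<Rightarrow> ('j \<Rightarrow> complex) \<Rightarrow> ('i \<Rightarrow> complex)" where
  "kop K u = (\<lambda>p. \<Sum>\<^sub>\<infinity>q. K p q * u q)"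

abbreviation sqsum :: "'i set \<Rightarrow> ('i \<Rightarrow> complex) \<Rightarrow> real" where
  "sqsum F u \<equiv> \<Sum>n\<in>F. (cmod (u n))\<^sup>2"

abbreviation kform :: "'i set \<Rightarrow> 'j set \<Rightarrow> ('i \<Rightarrow> complex) \<Rightarrow> ('i \<Rightarrow> 'j \<Rightarrow> complex) \<Rightarrow> ('j \<Rightarrow> complex) \<Rightarrow> complex" where
  "kform F G v K u \<equiv> \<Sum>p\<in>F. \<Sum>q\<in>G. cnj (v p) * K p q * u q"

text \<open>For \<open>C > 0\<close> this says that the operator norm is at most \<open>C\<close>, as one sees by scaling \<open>u\<close> and \<open>v\<close> against each
other. Compared with a bound by the product of the two norms, the additive form needs no square roots and
can be summed over the blocks of a block-diagonal kernel.\<close>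

definition kbound :: "real \<Rightarrow> ('i \<Rightarrow> 'j \<Rightarrow> complex) \<Rightarrow> bool" where
  "kbound C K \<longleftrightarrow> 0 \<le> C \<and> (\<forall>F G v u. finite F \<longrightarrow> finite G \<longrightarrow>
     cmod (kform F G v K u)
       \<le> C * (sqsum F v + sqsum G u) / 2)"

lemma kboundD:
  assumes "kbound C K" "finite F" "finite G"
  shows "cmod (kform F G v K u)
       \<le> C * (sqsum F v + sqsum G u) / 2"
  using assms by (simp only: kbound_def)

lemma kbound_nonneg: "kbound C K \<Longrightarrow> 0 \<le> C"
  by (simp only: kbound_def)

definition kadj :: "('i \<Rightarrow> 'j \<Rightarrow> complex) \<Rightarrow> ('j \<Rightarrow> 'i \<Rightarrow> complex)" where
  "kadj K = (\<lambda>q p. cnj (K p q))"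

lemma kadj_kadj [simp]: "kadj (kadj K) = K"
  by (simp add: kadj_def)

lemma kbound_kadj:
  assumes "kbound C K" shows "kbound C (kadj K)"
proof -
  have "cmod (\<Sum>q\<in>G. \<Sum>p\<in>F. cnj (u q) * kadj K q p * v p)
          \<le> C * (sqsum G u + sqsum F v) / 2"
    if "finite F" "finite G" for F G u v
  proof -
    have "(\<Sum>q\<in>G. \<Sum>p\<in>F. cnj (u q) * kadj K q p * v p) = cnj (kform F G v K u)"
      by (subst sum.swap) (simp add: kadj_def mult_ac)
    then have "cmod (\<Sum>q\<in>G. \<Sum>p\<in>F. cnj (u q) * kadj K q p * v p) = cmod (kform F G v K u)"
      by (simp only: complex_mod_cnj)
    also have "\<dots> \<le> C * (sqsum F v + sqsum G u) / 2"
      by (rule kboundD[OF assms that])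
    finally show ?thesis by (simp only: add.commute)
  qed
  then show ?thesis using assms by (simp add: kbound_def)
qed

text \<open>Testing the form on multiples of the image itself turns the additive bound into the operator bound.\<close>

lemma kbound_finite_image:
  assumes "kbound C K" "finite F" "finite G"
  shows "(\<Sum>p\<in>F. (cmod (\<Sum>q\<in>G. K p q * u q))\<^sup>2) \<le> C\<^sup>2 * sqsum G u"
proof -
  define w where "w p = (\<Sum>q\<in>G. K p q * u q)" for p
  define S where "S = sqsum F w"
  define U where "U = sqsum G u"
  have C: "0 \<le> C" using assms by (simp add: kbound_nonneg)
  have U: "0 \<le> U" and S: "0 \<le> S" by (simp_all add: U_def S_def sum_nonneg)
  have w': "(\<Sum>q\<in>G. c * K p q * u q) = c * w p" for c p
    by (simp add: w_def sum_distrib_left mult.assoc)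
  have main: "t * S \<le> C * (t\<^sup>2 * S + U) / 2" if "0 \<le> t" for t
  proof -
    let ?v = "\<lambda>p. complex_of_real t * w p"
    have "kform F G ?v K u = (\<Sum>p\<in>F. cnj (?v p) * w p)"
      by (simp only: w')
    also have "\<dots> = (\<Sum>p\<in>F. complex_of_real (t * (cmod (w p))\<^sup>2))"
      by (rule sum.cong) (simp_all add: complex_norm_square mult_ac del: of_real_power)
    also have "\<dots> = complex_of_real (t * S)" by (simp add: S_def sum_distrib_left)
    finally have "cmod (kform F G ?v K u) = t * S"
      using that S by (simp only: norm_of_real) simp
    moreover have "cmod (kform F G ?v K u)
        \<le> C * ((\<Sum>p\<in>F. (cmod (?v p))\<^sup>2) + U) / 2"
      unfolding U_def by (rule kboundD[OF assms])
    moreover have "(\<Sum>p\<in>F. (cmod (?v p))\<^sup>2) = t\<^sup>2 * S"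
      by (simp add: S_def norm_mult power_mult_distrib sum_distrib_left)
    ultimately show ?thesis by simp
  qed
  have "S \<le> C\<^sup>2 * U"
  proof (cases "C = 0")
    case True then show ?thesis using main[of 1] by simp
  next
    case False
    then have "0 < C" using C by simp
    \<comment> \<open>\<open>t = 1/C\<close> balances the two terms on the right of \<open>main\<close>.\<close>
    then show ?thesis using main[of "1 / C"] by (simp add: field_simps power2_eq_square)
  qed
  then show ?thesis by (simp add: S_def U_def w_def)
qed

lemma kbound_column: 
  assumes "kbound C K" shows "(\<lambda>p. K p q) \<in> ell2"
proof (rule ell2_bound(1))
  show "(\<Sum>p\<in>F. (cmod (K p q))\<^sup>2) \<le> C\<^sup>2" if "finite F" for F
    using kbound_finite_image[OF assms that, of "{q}" "\<lambda>_. 1"] by simp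
qed (use assms in \<open>simp add: kbound_nonneg\<close>)

lemma kbound_row:
  assumes "kbound C K" shows "K p \<in> ell2"
  using kbound_column[OF kbound_kadj[OF assms], of p] by (simp add: kadj_def ell2_cnj)

lemma has_sum_kop:
  assumes "K p \<in> ell2" "u \<in> ell2"
  shows "((\<lambda>q. K p q * u q) has_sum kop K u p) UNIV"
  using has_sum_ip[of "\<lambda>q. cnj (K p q)" u] assms by (simp add: ell2_cnj kop_def ip_def)

lemma kop_eq_ip: "kop K u p = ip (\<lambda>q. cnj (K p q)) u"
  by (simp add: kop_def ip_def)

lemma kop_bounded:
  assumes K: "kbound C K" and u: "u \<in> ell2"
  shows "kop K u \<in> ell2" "l2norm (kop K u) \<le> C * l2norm u"
proof -
  have C: "0 \<le> C" using assms by (simp add: kbound_nonneg)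
  have *: "(\<Sum>p\<in>F. (cmod (kop K u p))\<^sup>2) \<le> (C * l2norm u)\<^sup>2" if F: "finite F" for F
  proof (rule tendsto_upperbound)
    show "((\<lambda>G. \<Sum>p\<in>F. (cmod (\<Sum>q\<in>G. K p q * u q))\<^sup>2) \<longlongrightarrow> (\<Sum>p\<in>F. (cmod (kop K u p))\<^sup>2)) (finite_subsets_at_top UNIV)"
      using has_sum_kop[OF kbound_row[OF K] u]
      by (intro tendsto_sum tendsto_power tendsto_norm) (simp add: has_sum_def)
    have "(\<Sum>p\<in>F. (cmod (\<Sum>q\<in>G. K p q * u q))\<^sup>2) \<le> (C * l2norm u)\<^sup>2" if "finite G" for G
      using kbound_finite_image[OF K F that, of u] mult_left_mono[OF sum_le_l2norm[OF u that], of "C\<^sup>2"]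
      by (simp add: power_mult_distrib)
    then show "\<forall>\<^sub>F G in finite_subsets_at_top UNIV. (\<Sum>p\<in>F. (cmod (\<Sum>q\<in>G. K p q * u q))\<^sup>2) \<le> (C * l2norm u)\<^sup>2"
      by (auto intro: eventually_finite_subsets_at_top_weakI)
  qed simp
  show "kop K u \<in> ell2" "l2norm (kop K u) \<le> C * l2norm u"
    using ell2_bound[OF *] C by auto
qed

lemma kop_lincomb:
  assumes "kbound C K" "u \<in> ell2" "v \<in> ell2"
  shows "kop K (\<lambda>n. a * u n + b * v n) = (\<lambda>p. a * kop K u p + b * kop K v p)"
proof
  fix p
  show "kop K (\<lambda>n. a * u n + b * v n) p = a * kop K u p + b * kop K v p"
    unfolding kop_eq_ip
    by (rule ip_lincomb_right) (use assms kbound_row[OF assms(1)] in \<open>simp_all add: ell2_cnj\<close>)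
qed

lemma kop_diff:
  assumes "kbound C K" "u \<in> ell2" "v \<in> ell2"
  shows "kop K (\<lambda>n. u n - v n) = (\<lambda>p. kop K u p - kop K v p)"
  using kop_lincomb[OF assms, of 1 "-1"] by simp

lemma kop_trunc:
  assumes "finite F"
  shows "kop K (trunc F u) = (\<lambda>p. \<Sum>q\<in>F. u q * K p q)"
proof
  fix p
  have "((\<lambda>q. K p q * trunc F u q) has_sum (\<Sum>q\<in>F. K p q * trunc F u q)) UNIV"
    by (rule has_sum_finite_neutralI[OF assms]) (auto simp: trunc_def)
  then show "kop K (trunc F u) p = (\<Sum>q\<in>F. u q * K p q)"
    unfolding kop_def by (simp add: infsumI trunc_def mult.commute cong: sum.cong)
qed

text \<open>Both sides are bounded in \<open>u\<close> and agree on finitely supported \<open>u\<close>.\<close>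

lemma kop_adjoint:
  assumes K: "kbound C K" and v: "v \<in> ell2" and u: "u \<in> ell2"
  shows "ip v (kop K u) = ip (kop (kadj K) v) u"
proof -
  note K' = kbound_kadj[OF K]
  have C: "0 \<le> C" using K by (simp add: kbound_nonneg)
  define d where "d x = ip v (kop K x) - ip (kop (kadj K) v) x" for x
  have fin: "d (trunc F u) = 0" if F: "finite F" for F
  proof -
    have "ip v (kop K (trunc F u)) = (\<Sum>q\<in>F. u q * ip v (\<lambda>p. K p q))"
      unfolding kop_trunc[OF F] by (rule ip_sum_right[OF v]) (rule kbound_column[OF K])
    also have "\<dots> = (\<Sum>q\<in>F. cnj (kop (kadj K) v q) * u q)"
      by (intro sum.cong refl) (simp add: kop_eq_ip kadj_def cnj_ip)
    also have "\<dots> = ip (kop (kadj K) v) (trunc F u)"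
    proof -
      have "((\<lambda>q. cnj (kop (kadj K) v q) * trunc F u q) has_sum (\<Sum>q\<in>F. cnj (kop (kadj K) v q) * trunc F u q)) UNIV"
        by (rule has_sum_finite_neutralI[OF F]) (auto simp: trunc_def)
      then show ?thesis
        unfolding ip_def by (simp add: infsumI trunc_def cong: sum.cong)
    qed
    finally show ?thesis by (simp add: d_def)
  qed
  have bd: "cmod (d x) \<le> 2 * C * l2norm v * l2norm x" if x: "x \<in> ell2" for x
  proof -
    have "cmod (ip v (kop K x)) \<le> l2norm v * (C * l2norm x)"
      using ell2_Cauchy_Schwarz[OF v kop_bounded(1)[OF K x]] mult_left_mono[OF kop_bounded(2)[OF K x] l2norm_nonneg]
      by (rule order_trans)
    moreover have "cmod (ip (kop (kadj K) v) x) \<le> C * l2norm v * l2norm x"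
      using ell2_Cauchy_Schwarz[OF kop_bounded(1)[OF K' v] x] mult_right_mono[OF kop_bounded(2)[OF K' v] l2norm_nonneg]
      by (rule order_trans)
    ultimately show ?thesis unfolding d_def
      using norm_triangle_ineq4[of "ip v (kop K x)" "ip (kop (kadj K) v) x"] by (simp add: mult_ac)
  qed
  have "cmod (d u) \<le> \<epsilon>" if e: "0 < \<epsilon>" for \<epsilon>
  proof -
    define c where "c = 2 * C * l2norm v + 1"
    have c: "0 < c" using C by (simp add: c_def add_nonneg_pos)
    obtain F where F: "finite F" "l2norm (\<lambda>n. u n - trunc F u n) < \<epsilon> / c"
      using trunc_tail_small[OF u, of "\<epsilon> / c"] e c by auto
    have w: "(\<lambda>n. u n - trunc F u n) \<in> ell2" using ell2_diff[OF u trunc_ell2[OF u]] .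
    have "d (\<lambda>n. u n - trunc F u n) = d u - d (trunc F u)"
      unfolding d_def kop_diff[OF K u trunc_ell2[OF u]]
      by (simp add: ip_diff_right v u trunc_ell2 kop_bounded(1)[OF K] kop_bounded(1)[OF K'])
    then have "cmod (d u) \<le> 2 * C * l2norm v * l2norm (\<lambda>n. u n - trunc F u n)"
      using bd[OF w] fin[OF F(1)] by simp
    also have "\<dots> \<le> c * l2norm (\<lambda>n. u n - trunc F u n)"
      by (intro mult_right_mono) (simp_all add: c_def)
    also have "\<dots> \<le> c * (\<epsilon> / c)" using F(2) c by (intro mult_left_mono) auto
    finally show ?thesis using c by simp
  qed
  then have "d u = 0" by (metis field_le_epsilon add_0 norm_le_zero_iff)
  then show ?thesis by (simp add: d_def)
qed

text \<open>Absolute convergence of the double sum may fail, so the summations are not exchanged directly: the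
second operator is moved to the row of the first one by \<open>kop_adjoint\<close>.\<close>

lemma kop_kop:
  assumes K: "kbound C K" and L: "kbound D L" and u: "u \<in> ell2"
    and M: "\<And>p q. ((\<lambda>r. K p r * L r q) has_sum M p q) UNIV"
  shows "kop K (kop L u) = kop M u"
proof
  fix p
  let ?k = "\<lambda>q. cnj (K p q)"
  have k: "?k \<in> ell2" using kbound_row[OF K] by (simp add: ell2_cnj)
  have "kop K (kop L u) p = ip (kop (kadj L) ?k) u"
    by (subst kop_eq_ip) (rule kop_adjoint[OF L k u])
  moreover have "kop (kadj L) ?k q = cnj (M p q)" for q
  proof -
    have "((\<lambda>r. cnj (K p r * L r q)) has_sum cnj (M p q)) UNIV" using M by (simp only: has_sum_cnj_iff)
    then show ?thesis unfolding kop_def kadj_def by (simp add: infsumI mult.commute)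
  qed
  then have "kop (kadj L) ?k = (\<lambda>q. cnj (M p q))" by (rule ext)
  ultimately show "kop K (kop L u) p = kop M u p" by (simp only: kop_eq_ip[of M])
qed

lemma kop_delta: "kop (\<lambda>p q. if p = q then 1 else 0) u = u"
proof
  fix p
  have "((\<lambda>q. (if p = q then 1 else 0) * u q) has_sum u p) UNIV"
    by (rule has_sum_finite_neutralI[of "{p}"]) auto
  then show "kop (\<lambda>p q. if p = q then 1 else 0) u p = u p" unfolding kop_def by (rule infsumI)
qed

lemma kop_kernel_lincomb:
  assumes "kbound C K" "kbound D L" "u \<in> ell2"
  shows "kop (\<lambda>p q. a * K p q + b * L p q) u = (\<lambda>p. a * kop K u p + b * kop L u p)"
proof
  fix p
  have "((\<lambda>q. a * (K p q * u q) + b * (L p q * u q)) has_sum a * kop K u p + b * kop L u p) UNIV"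
    by (intro has_sum_add has_sum_cmult_right has_sum_kop kbound_row[OF assms(1)] kbound_row[OF assms(2)] assms(3))
  also have "(\<lambda>q. a * (K p q * u q) + b * (L p q * u q)) = (\<lambda>q. (a * K p q + b * L p q) * u q)"
    by (simp add: algebra_simps)
  finally show "kop (\<lambda>p q. a * K p q + b * L p q) u p = a * kop K u p + b * kop L u p"
    by (subst kop_def) (rule infsumI)
qed

text \<open>Truncating both vectors leaves finitely many entries of the kernels; the uniform bound controls the tails.\<close>

lemma kop_weak_null:
  assumes K: "\<And>k::nat. kbound C (K k)" and lim: "\<And>p q. (\<lambda>k. K k p q) \<longlonglongrightarrow> 0"
    and v: "v \<in> ell2" and u: "u \<in> ell2"
  shows "(\<lambda>k. ip v (kop (K k) u)) \<longlonglongrightarrow> 0"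
proof (rule LIMSEQ_I)
  fix r :: real assume r: "0 < r"
  have C: "0 \<le> C" using K[of 0] by (simp add: kbound_nonneg)
  define c where "c = C * (l2norm v + l2norm u) + 1"
  have c: "0 < c" using C by (simp add: c_def add_nonneg_pos)
  obtain F where F: "finite F" "l2norm (\<lambda>n. v n - trunc F v n) < r / (4 * c)"
    using trunc_tail_small[OF v, of "r / (4 * c)"] r c by auto
  obtain G where G: "finite G" "l2norm (\<lambda>n. u n - trunc G u n) < r / (4 * c)"
    using trunc_tail_small[OF u, of "r / (4 * c)"] r c by auto
  let ?v = "trunc F v" and ?u = "trunc G u"
  let ?dv = "\<lambda>n. v n - ?v n" and ?du = "\<lambda>n. u n - ?u n"
  have e: "?v \<in> ell2" "?u \<in> ell2" "?dv \<in> ell2" "?du \<in> ell2"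
    using u v by (auto intro: trunc_ell2 ell2_diff)
  have u_le: "l2norm ?v \<le> l2norm v"
    by (rule ell2_bound(2)[OF _ l2norm_nonneg])
       (rule order_trans[OF sum_mono sum_le_l2norm[OF v]], auto simp: trunc_def)
  have fin: "ip ?v (kop (K k) ?u) = (\<Sum>p\<in>F. \<Sum>q\<in>G. cnj (v p) * u q * K k p q)" for k
  proof -
    have "((\<lambda>p. cnj (?v p) * kop (K k) ?u p) has_sum (\<Sum>p\<in>F. cnj (?v p) * kop (K k) ?u p)) UNIV"
      by (rule has_sum_finite_neutralI[OF F(1)]) (auto simp: trunc_def)
    then show ?thesis unfolding ip_def kop_trunc[OF G(1)]
      by (simp add: infsumI trunc_def sum_distrib_left mult_ac cong: sum.cong)
  qed
  have "(\<lambda>k. ip ?v (kop (K k) ?u)) \<longlonglongrightarrow> (\<Sum>p\<in>F. \<Sum>q\<in>G. cnj (v p) * u q * 0)"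
    unfolding fin by (intro tendsto_sum tendsto_mult tendsto_const lim)
  then obtain N where N: "\<And>k. N \<le> k \<Longrightarrow> cmod (ip ?v (kop (K k) ?u)) < r / 2"
    using r LIMSEQ_D[of _ 0 "r / 2"] by fastforce
  have "norm (ip v (kop (K k) u) - 0) < r" if "N \<le> k" for k
  proof -
    note B = kop_bounded[OF K[of k]]
    have eq: "ip v (kop (K k) u) = ip ?dv (kop (K k) u) + ip ?v (kop (K k) ?du) + ip ?v (kop (K k) ?u)"
      by (simp add: kop_diff[OF K] ip_diff_left ip_diff_right u v e B)
    have split: "cmod (ip v (kop (K k) u))
        \<le> cmod (ip ?dv (kop (K k) u)) + cmod (ip ?v (kop (K k) ?du)) + cmod (ip ?v (kop (K k) ?u))"
      using norm_triangle_ineq[of "ip ?dv (kop (K k) u) + ip ?v (kop (K k) ?du)" "ip ?v (kop (K k) ?u)"]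
        norm_triangle_ineq[of "ip ?dv (kop (K k) u)" "ip ?v (kop (K k) ?du)"] unfolding eq by linarith
    have "cmod (ip ?dv (kop (K k) u)) \<le> l2norm ?dv * l2norm (kop (K k) u)"
      by (rule ell2_Cauchy_Schwarz[OF e(3) B(1)[OF u]])
    also have "\<dots> \<le> (r / (4 * c)) * (C * l2norm u)"
      by (rule mult_mono[OF less_imp_le[OF F(2)] B(2)[OF u]]) (use r c in simp_all)
    finally have t1: "cmod (ip ?dv (kop (K k) u)) \<le> (r / (4 * c)) * (C * l2norm u)" .
    have "l2norm (kop (K k) ?du) \<le> C * l2norm ?du" by (rule B(2)[OF e(4)])
    also have "\<dots> \<le> C * (r / (4 * c))" by (rule mult_left_mono[OF less_imp_le[OF G(2)] C])
    finally have w: "l2norm (kop (K k) ?du) \<le> C * (r / (4 * c))" .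
    have "cmod (ip ?v (kop (K k) ?du)) \<le> l2norm ?v * l2norm (kop (K k) ?du)"
      by (rule ell2_Cauchy_Schwarz[OF e(1) B(1)[OF e(4)]])
    also have "\<dots> \<le> l2norm v * (C * (r / (4 * c)))"
      by (rule mult_mono[OF u_le w]) simp_all
    finally have t2: "cmod (ip ?v (kop (K k) ?du)) \<le> l2norm v * (C * (r / (4 * c)))" .
    have c1: "c - 1 = C * (l2norm v + l2norm u)" by (simp add: c_def)
    have "(r / (4 * c)) * (C * l2norm u) + l2norm v * (C * (r / (4 * c))) = (r / (4 * c)) * (c - 1)"
      unfolding c1 by (simp only: distrib_left mult_ac add.commute)
    also have "\<dots> \<le> (r / (4 * c)) * c" using r c by (intro mult_left_mono) auto
    also have "\<dots> = r / 4" using c by simp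
    finally have "cmod (ip v (kop (K k) u)) \<le> r / 4 + cmod (ip ?v (kop (K k) ?u))"
      using split t1 t2 by linarith
    then show ?thesis using N[OF that] r by simp
  qed
  then show "\<exists>N. \<forall>k\<ge>N. norm (ip v (kop (K k) u) - 0) < r" by blast
qed

lemma kbound_limit:
  assumes K: "\<And>k::nat. kbound C (K k)" and lim: "\<And>p q. (\<lambda>k. K k p q) \<longlonglongrightarrow> L p q"
  shows "kbound C L"
proof -
  have "cmod (kform F G v L u)
          \<le> C * (sqsum F v + sqsum G u) / 2"
    if "finite F" "finite G" for F G u v
  proof (rule LIMSEQ_le_const2)
    show "(\<lambda>k. cmod (\<Sum>p\<in>F. \<Sum>q\<in>G. cnj (v p) * K k p q * u q)) \<longlonglongrightarrow> cmod (kform F G v L u)"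
      by (intro tendsto_norm tendsto_sum tendsto_mult tendsto_const lim)
  qed (use kboundD[OF K that] in blast)
  then show ?thesis using kbound_nonneg[OF K] by (simp only: kbound_def) blast
qed

lemma kbound_diff:
  assumes "kbound C K" "kbound D L" shows "kbound (C + D) (\<lambda>p q. K p q - L p q)"
proof -
  have "cmod (\<Sum>p\<in>F. \<Sum>q\<in>G. cnj (v p) * (K p q - L p q) * u q)
          \<le> (C + D) * (sqsum F v + sqsum G u) / 2"
    if "finite F" "finite G" for F G u v
  proof -
    have "(\<Sum>p\<in>F. \<Sum>q\<in>G. cnj (v p) * (K p q - L p q) * u q)
        = kform F G v K u - kform F G v L u"
      by (simp add: algebra_simps sum_subtractf)
    then have "cmod (\<Sum>p\<in>F. \<Sum>q\<in>G. cnj (v p) * (K p q - L p q) * u q)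
        \<le> cmod (kform F G v K u) + cmod (kform F G v L u)"
      by (simp only: norm_triangle_ineq4)
    also have "\<dots> \<le> C * (sqsum F v + sqsum G u) / 2
        + D * (sqsum F v + sqsum G u) / 2"
      by (intro add_mono kboundD that assms)
    also have "\<dots> = (C + D) * (sqsum F v + sqsum G u) / 2"
      by (simp only: distrib_right add_divide_distrib)
    finally show ?thesis .
  qed
  then show ?thesis using kbound_nonneg[OF assms(1)] kbound_nonneg[OF assms(2)] by (simp only: kbound_def) simp
qed

lemma kop_weak_limit:
  assumes K: "\<And>k::nat. kbound C (K k)" and lim: "\<And>p q. (\<lambda>k. K k p q) \<longlonglongrightarrow> L p q"
    and v: "v \<in> ell2" and u: "u \<in> ell2"
  shows "(\<lambda>k. ip v (kop (K k) u)) \<longlonglongrightarrow> ip v (kop L u)"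
proof -
  have L: "kbound C L" using K lim by (rule kbound_limit)
  have D: "kbound (C + C) (\<lambda>p q. K k p q - L p q)" for k using K L by (rule kbound_diff)
  have "(\<lambda>k. ip v (kop (\<lambda>p q. K k p q - L p q) u)) \<longlonglongrightarrow> 0"
    by (rule kop_weak_null[OF D _ v u]) (use lim in \<open>simp add: LIM_zero_iff\<close>)
  moreover have "ip v (kop (\<lambda>p q. K k p q - L p q) u) = ip v (kop (K k) u) - ip v (kop L u)" for k
    using kop_kernel_lincomb[OF K[of k] L u, of 1 "-1"] ip_diff_right[OF v kop_bounded(1)[OF K[of k] u] kop_bounded(1)[OF L u]]
    by simp
  ultimately show ?thesis by (simp add: LIM_zero_iff)
qed

lemma ip_trunc_singleton: "ip (trunc {p} (\<lambda>_. 1)) w = w p"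
proof -
  have "((\<lambda>n. cnj (trunc {p} (\<lambda>_. 1) n) * w n) has_sum w p) UNIV"
    by (rule has_sum_finite_neutralI[of "{p}"]) (auto simp: trunc_def)
  then show ?thesis unfolding ip_def by (rule infsumI)
qed

lemma kop_pointwise_limit:
  assumes "\<And>k::nat. kbound C (K k)" "\<And>p q. (\<lambda>k. K k p q) \<longlonglongrightarrow> L p q" "u \<in> ell2"
  shows "(\<lambda>k. kop (K k) u p) \<longlonglongrightarrow> kop L u p"
  using kop_weak_limit[OF assms(1,2) trunc_finite_ell2[of "{p}" "\<lambda>_. 1"] assms(3)]
  by (simp add: ip_trunc_singleton)

section \<open>Unitary kernels and orthonormal bases\<close>

lemma has_sum_sum:
  fixes f :: "'i \<Rightarrow> 'a \<Rightarrow> 'b::topological_comm_monoid_add"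
  assumes "finite I" "\<And>i. i \<in> I \<Longrightarrow> (f i has_sum s i) A"
  shows "((\<lambda>x. \<Sum>i\<in>I. f i x) has_sum (\<Sum>i\<in>I. s i)) A"
  using assms by (induction I rule: finite_induct) (auto intro: has_sum_add)

text \<open>Over infinite index sets orthonormal columns do not entail orthonormal rows; both are required.\<close>

definition unitary_kernel :: "('i \<Rightarrow> 'j \<Rightarrow> complex) \<Rightarrow> bool" where
  "unitary_kernel K \<longleftrightarrow>
     (\<forall>p p'. ((\<lambda>q. K p q * cnj (K p' q)) has_sum (if p = p' then 1 else 0)) UNIV) \<and>
     (\<forall>q q'. ((\<lambda>p. cnj (K p q) * K p q') has_sum (if q = q' then 1 else 0)) UNIV)"

lemma unitary_kernel_kadj: "unitary_kernel K \<Longrightarrow> unitary_kernel (kadj K)"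
  unfolding unitary_kernel_def kadj_def complex_cnj_cnj by blast

text \<open>By orthonormality of the columns the image of a finite combination of them has the same norm as its coefficients.\<close>

lemma kbound_unitary:
  assumes "unitary_kernel K" shows "kbound 1 K"
proof -
  have "cmod (kform F G v K u)
       \<le> (sqsum F v + sqsum G u) / 2" if F: "finite F" and G: "finite G" for F G u v
  proof -
    define w where "w p = (\<Sum>q\<in>G. K p q * u q)" for p
    have "((\<lambda>p. \<Sum>q\<in>G. \<Sum>q'\<in>G. cnj (u q) * u q' * (cnj (K p q) * K p q')) has_sum
        (\<Sum>q\<in>G. \<Sum>q'\<in>G. cnj (u q) * u q' * (if q = q' then 1 else 0))) UNIV"
      using assms G unfolding unitary_kernel_def by (intro has_sum_sum has_sum_cmult_right) auto
    moreover have "(\<Sum>q\<in>G. \<Sum>q'\<in>G. cnj (u q) * u q' * (cnj (K p q) * K p q')) = complex_of_real ((cmod (w p))\<^sup>2)" for p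
      by (simp add: complex_norm_square w_def sum_product mult_ac del: of_real_power)
        (subst sum.swap, rule refl)
    moreover have "(\<Sum>q\<in>G. \<Sum>q'\<in>G. cnj (u q) * u q' * (if q = q' then 1 else 0)) = complex_of_real (sqsum G u)"
    proof -
      have "(\<Sum>q\<in>G. \<Sum>q'\<in>G. cnj (u q) * u q' * (if q = q' then 1 else 0)) = (\<Sum>q\<in>G. \<Sum>q'\<in>G. if q = q' then u q * cnj (u q) else 0)"
        by (intro sum.cong refl) auto
      also have "\<dots> = (\<Sum>q\<in>G. u q * cnj (u q))" using G by simp
      finally show ?thesis by (simp add: complex_norm_square del: of_real_power)
    qed
    ultimately have "((\<lambda>p. (cmod (w p))\<^sup>2) has_sum sqsum G u) UNIV"
      by (simp only: has_sum_of_real_iff)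
    then have w: "sqsum F w \<le> sqsum G u"
      by (rule finite_sum_le_has_sum) (use F in auto)
    have "kform F G v K u = (\<Sum>p\<in>F. cnj (v p) * w p)"
      by (simp add: w_def sum_distrib_left mult.assoc)
    then have "cmod (kform F G v K u) \<le> (\<Sum>p\<in>F. cmod (cnj (v p) * w p))"
      by (simp only: norm_sum)
    also have "\<dots> \<le> (\<Sum>p\<in>F. ((cmod (v p))\<^sup>2 + (cmod (w p))\<^sup>2) / 2)"
    proof (rule sum_mono)
      fix p show "cmod (cnj (v p) * w p) \<le> ((cmod (v p))\<^sup>2 + (cmod (w p))\<^sup>2) / 2"
        using sum_squares_bound[of "cmod (v p)" "cmod (w p)"] by (simp add: norm_mult)
    qed
    also have "\<dots> = (sqsum F v + sqsum F w) / 2"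
      by (simp only: sum.distrib flip: sum_divide_distrib)
    also have "\<dots> \<le> (sqsum F v + sqsum G u) / 2"
      using w by simp
    finally show ?thesis .
  qed
  then show ?thesis by (simp only: kbound_def) simp
qed

lemma unitary_kernel_inverse:
  assumes "unitary_kernel K" "u \<in> ell2" shows "kop (kadj K) (kop K u) = u"
proof -
  have "kop (kadj K) (kop K u) = kop (\<lambda>p q. if p = q then 1 else 0) u"
    by (rule kop_kop[OF kbound_unitary[OF unitary_kernel_kadj] kbound_unitary])
       (use assms in \<open>auto simp: unitary_kernel_def kadj_def\<close>)
  then show ?thesis by (simp add: kop_delta)
qed

lemma unitary_kernel_inverse':
  assumes "unitary_kernel K" "u \<in> ell2" shows "kop K (kop (kadj K) u) = u"
  using unitary_kernel_inverse[OF unitary_kernel_kadj[OF assms(1)] assms(2)] by simp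

lemma unitary_kernel_ip:
  assumes "unitary_kernel K" "u \<in> ell2" "v \<in> ell2" shows "ip (kop K u) (kop K v) = ip u v"
  using kop_adjoint[OF kbound_unitary[OF assms(1)] kop_bounded(1)[OF kbound_unitary[OF assms(1)] assms(2)] assms(3)]
  by (simp only: unitary_kernel_inverse[OF assms(1,2)])

lemma unitary_kernel_ell2: "unitary_kernel K \<Longrightarrow> u \<in> ell2 \<Longrightarrow> kop K u \<in> ell2"
  using kop_bounded(1) kbound_unitary by blast

lemma unitary_kernel_l2norm:
  assumes "unitary_kernel K" "u \<in> ell2" shows "l2norm (kop K u) = l2norm u"
proof -
  have "(l2norm (kop K u))\<^sup>2 = (l2norm u)\<^sup>2"
    using unitary_kernel_ip[OF assms assms(2)] unfolding ip_self of_real_eq_iff .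
  then show ?thesis by (simp add: power2_eq_iff_nonneg)
qed

lemma ip_unitary_columns:
  assumes "unitary_kernel K" shows "ip (\<lambda>p. K p q) (\<lambda>p. K p q') = (if q = q' then 1 else 0)"
  using assms unfolding ip_def unitary_kernel_def by (intro infsumI) blast

text \<open>The coefficients of \<open>u\<close> are the entries of its image under the adjoint. Truncating them to a finite set approximates
\<open>u\<close>, because the kernel is isometric.\<close>

lemma unitary_columns_orthonormal_basis:
  fixes K :: "'i \<Rightarrow> 'j \<Rightarrow> complex"
  assumes K: "unitary_kernel K"
  shows "inj (\<lambda>q p. K p q)" "orthonormal_basis (range (\<lambda>q p. K p q))"
proof -
  let ?\<psi> = "\<lambda>q p. K p q"
  show inj: "inj ?\<psi>"
  proof (rule injI)
    fix q q' assume "?\<psi> q = ?\<psi> q'"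
    then have "ip (?\<psi> q) (?\<psi> q') = ip (?\<psi> q) (?\<psi> q)" by simp
    then show "q = q'" using ip_unitary_columns[OF K] by (metis zero_neq_one)
  qed
  note bK = kbound_unitary[OF K]
  have dense: "\<exists>F c. finite F \<and> F \<subseteq> range ?\<psi> \<and> l2norm (\<lambda>n. u n - (\<Sum>b\<in>F. c b * b n)) < \<epsilon>"
    if u: "u \<in> ell2" and e: "0 < \<epsilon>" for u \<epsilon>
  proof -
    define v where "v = kop (kadj K) u"
    have v: "v \<in> ell2" unfolding v_def by (rule unitary_kernel_ell2[OF unitary_kernel_kadj[OF K] u])
    obtain F where F: "finite F" "l2norm (\<lambda>n. v n - trunc F v n) < \<epsilon>" using trunc_tail_small[OF v e] .
    let ?c = "\<lambda>b. v (inv ?\<psi> b)"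
    have "(\<lambda>n. u n - (\<Sum>b\<in>?\<psi> ` F. ?c b * b n)) = (\<lambda>n. kop K v n - kop K (trunc F v) n)"
    proof
      fix n
      have "(\<Sum>b\<in>?\<psi> ` F. ?c b * b n) = (\<Sum>q\<in>F. v q * K n q)"
        using inj_on_subset[OF inj] by (subst sum.reindex) (simp_all add: inv_f_f[OF inj])
      moreover have "kop K v = u" unfolding v_def by (rule unitary_kernel_inverse'[OF K u])
      ultimately show "u n - (\<Sum>b\<in>?\<psi> ` F. ?c b * b n) = kop K v n - kop K (trunc F v) n"
        by (simp add: kop_trunc[OF F(1)])
    qed
    also have "\<dots> = kop K (\<lambda>n. v n - trunc F v n)"
      by (rule kop_diff[OF bK v trunc_ell2[OF v], symmetric])
    finally have "l2norm (\<lambda>n. u n - (\<Sum>b\<in>?\<psi> ` F. ?c b * b n)) < \<epsilon>"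
      using F(2) unitary_kernel_l2norm[OF K ell2_diff[OF v trunc_ell2[OF v]]] by simp
    then show ?thesis using F(1) by (intro exI[of _ "?\<psi> ` F"] exI[of _ ?c]) auto
  qed
  show "orthonormal_basis (range ?\<psi>)"
    unfolding orthonormal_basis_def
  proof (intro conjI ballI allI impI)
    show "range ?\<psi> \<subseteq> ell2" using kbound_column[OF bK] by auto
    show "ip u v = (if u = v then 1 else 0)" if "u \<in> range ?\<psi>" "v \<in> range ?\<psi>" for u v
      using that ip_unitary_columns[OF K] inj by (auto simp: inj_eq)
  qed (rule dense)
qed

section \<open>A Bessel sequence with orthonormal translates\<close>

definition bessel_series :: "real \<Rightarrow> nat \<Rightarrow> real" where
  "bessel_series z n = (\<Sum>k. z ^ k / (fact k * fact (n + k)))"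

lemma bessel_term_bound: "\<bar>z ^ k / (fact k * fact (n + k))\<bar> \<le> (\<bar>z\<bar> ^ k / fact k) / fact n" for z :: real
proof -
  have "(fact n :: real) \<le> fact (n + k)" by (rule fact_mono) simp
  then show ?thesis
    by (simp add: abs_mult power_abs) (intro divide_left_mono mult_left_mono, auto)
qed

lemma exp_series_sums: "(\<lambda>k. x ^ k / fact k) sums exp x" for x :: real
  using exp_converges[of x] by (simp add: divide_inverse mult.commute)

lemma bessel_summable: "summable (\<lambda>k. z ^ k / (fact k * fact (n + k)))" for z :: real
proof (rule summable_comparison_test')
  show "summable (\<lambda>k. (\<bar>z\<bar> ^ k / fact k) / fact n)"
    using exp_series_sums sums_summable summable_divide by blast
qed (simp only: real_norm_def bessel_term_bound)

lemma bessel_series_bound: "\<bar>bessel_series z n\<bar> \<le> exp \<bar>z\<bar> / fact n"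
proof -
  have s: "(\<lambda>k. (\<bar>z\<bar> ^ k / fact k) / fact n) sums (exp \<bar>z\<bar> / fact n)"
    using exp_series_sums by (rule sums_divide)
  have "\<bar>bessel_series z n\<bar> \<le> (\<Sum>k. (\<bar>z\<bar> ^ k / fact k) / fact n)"
    unfolding bessel_series_def real_norm_def[symmetric]
    by (rule norm_suminf_le) (simp_all only: real_norm_def bessel_term_bound sums_summable[OF s])
  then show ?thesis using sums_unique[OF s] by simp
qed

text \<open>The terms of the first two series combine to \<open>k z\<^sup>k / (k! (m + 1 + k)!)\<close>, which is \<open>z\<close> times the
preceding term of the third series.\<close>

lemma bessel_series_recurrence:
  "bessel_series z m = real (Suc m) * bessel_series z (Suc m) + z * bessel_series z (Suc (Suc m))"
proof -
  define a where "a m k = z ^ k / (fact k * fact (m + k))" for m k :: nat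
  have sa: "a m sums bessel_series z m" for m
    unfolding a_def bessel_series_def using bessel_summable by (rule summable_sums)
  define c where "c k = a m k - real (Suc m) * a (Suc m) k" for k
  have c0: "c 0 = 0" by (simp add: c_def a_def)
  have cS: "c (Suc k) = z * a (Suc (Suc m)) k" for k
  proof -
    define q :: real where "q = fact (m + Suc k)"
    have q: "q > 0" by (simp add: q_def)
    have 1: "(fact (Suc m + Suc k) :: real) = (real m + real k + 2) * q" by (simp add: q_def algebra_simps)
    have 2: "(fact (Suc (Suc m) + k) :: real) = (real m + real k + 2) * q" by (simp add: q_def algebra_simps)
    have 3: "(fact (Suc k) :: real) = (real k + 1) * fact k" by (simp add: algebra_simps)
    have 4: "(real m + real k + 2) > 0" by simp
    show ?thesis unfolding c_def a_def 1 2 3 q_def[symmetric]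
      using q 4 by (simp add: divide_simps) (simp add: algebra_simps)
  qed
  have "(\<lambda>k. c (Suc k)) sums (z * bessel_series z (Suc (Suc m)))"
    unfolding cS using sa by (rule sums_mult)
  then have "c sums (z * bessel_series z (Suc (Suc m)))" by (simp add: sums_Suc_iff c0)
  moreover have "c sums (bessel_series z m - real (Suc m) * bessel_series z (Suc m))"
    unfolding c_def by (intro sums_diff sums_mult sa)
  ultimately have "z * bessel_series z (Suc (Suc m)) = bessel_series z m - real (Suc m) * bessel_series z (Suc m)"
    by (rule sums_unique2)
  then show ?thesis by linarith
qed

text \<open>Multiplied by \<open>n!\<close>, the series tends to its first term \<open>1\<close> as \<open>n\<close> grows.\<close>

lemma bessel_series_eventually_nonzero: "\<exists>n. bessel_series z n \<noteq> 0"
proof -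
  obtain n where n: "exp \<bar>z\<bar> < real n" using reals_Archimedean2 by blast
  define a where "a k = fact n * (z ^ k / (fact k * fact (n + k)))" for k :: nat
  have sa: "a sums (fact n * bessel_series z n)"
    unfolding a_def bessel_series_def using bessel_summable by (intro sums_mult summable_sums)
  have a0: "a 0 = 1" by (simp add: a_def)
  have ab: "\<bar>a (Suc k)\<bar> \<le> (\<bar>z\<bar> ^ Suc k / fact (Suc k)) / real (Suc n)" for k
  proof -
    have f: "real (Suc n) * fact n \<le> fact (n + Suc k)"
      using fact_mono[of "Suc n" "n + Suc k", where 'a=real] by simp
    have "\<bar>a (Suc k)\<bar> = (\<bar>z\<bar> ^ Suc k / fact (Suc k)) * (fact n / fact (n + Suc k))"
      unfolding a_def abs_mult abs_divide power_abs by (simp only: abs_of_pos fact_gt_zero mult_pos_pos) simp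
    also have "\<dots> \<le> (\<bar>z\<bar> ^ Suc k / fact (Suc k)) * (1 / real (Suc n))"
    proof (rule mult_left_mono)
      show "fact n / fact (n + Suc k) \<le> 1 / real (Suc n)"
        using f by (simp add: divide_simps mult.commute)
    qed simp
    finally show ?thesis by simp
  qed
  have tail: "(\<lambda>k. a (Suc k)) sums (fact n * bessel_series z n - 1)"
    using sa a0 by (simp add: sums_Suc_iff)
  have "(\<lambda>k. \<bar>z\<bar> ^ Suc k / fact (Suc k)) sums (exp \<bar>z\<bar> - 1)"
    using exp_series_sums[of "\<bar>z\<bar>"] by (subst sums_Suc_iff) simp
  then have maj: "(\<lambda>k. (\<bar>z\<bar> ^ Suc k / fact (Suc k)) / real (Suc n)) sums ((exp \<bar>z\<bar> - 1) / real (Suc n))"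
    by (rule sums_divide)
  have "\<bar>fact n * bessel_series z n - 1\<bar> \<le> (exp \<bar>z\<bar> - 1) / real (Suc n)"
    using norm_suminf_le[of "\<lambda>k. a (Suc k)", OF _ sums_summable[OF maj]] ab
    unfolding sums_unique[OF tail] sums_unique[OF maj] real_norm_def by blast
  also have "\<dots> < 1" using n by simp
  finally have "bessel_series z n \<noteq> 0" by auto
  then show ?thesis by blast
qed

text \<open>The Bessel function \<open>J_m(2 y)\<close>, with negative orders defined through \<open>J_{-m} = (-1)\<^sup>m J_m\<close>.\<close>

definition bessel_J :: "real \<Rightarrow> int \<Rightarrow> real" where
  "bessel_J y m = (if m < 0 then (- 1) ^ nat (- m) else 1)
                    * (y ^ nat \<bar>m\<bar> * bessel_series (- y\<^sup>2) (nat \<bar>m\<bar>))"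

lemma bessel_J_uminus: "bessel_J y (- m) = (- 1) ^ nat \<bar>m\<bar> * bessel_J y m"
proof (cases m "0::int" rule: linorder_cases)
  case less
  have "((- 1::real) ^ nat (- m)) * (- 1) ^ nat (- m) = 1" by (simp flip: power_mult_distrib)
  then show ?thesis using less by (simp add: bessel_J_def flip: mult.assoc)
qed (simp_all add: bessel_J_def)

lemma bessel_J_recurrence: "y * (bessel_J y (m - 1) + bessel_J y (m + 1)) = real_of_int m * bessel_J y m"
proof -
  have pos: "y * (bessel_J y (m - 1) + bessel_J y (m + 1)) = real_of_int m * bessel_J y m" if "m > 0" for m
  proof -
    define k where "k = nat (m - 1)"
    have m: "m = int (Suc k)" using that by (simp add: k_def)
    have "nat \<bar>m - 1\<bar> = k" "nat \<bar>m\<bar> = Suc k" "nat \<bar>m + 1\<bar> = Suc (Suc k)" "\<not> m < 0" "\<not> m - 1 < 0" "\<not> m + 1 < 0"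
      using m by simp_all
    moreover define A B D where "A = bessel_series (- y\<^sup>2) k" and "B = bessel_series (- y\<^sup>2) (Suc k)"
      and "D = bessel_series (- y\<^sup>2) (Suc (Suc k))"
    moreover have "A = real (Suc k) * B + - y\<^sup>2 * D"
      unfolding A_def B_def D_def by (rule bessel_series_recurrence)
    moreover have "real_of_int m = real (Suc k)" using m by simp
    ultimately show ?thesis
      unfolding bessel_J_def by (simp add: algebra_simps power2_eq_square)
  qed
  show ?thesis
  proof (cases m "0::int" rule: linorder_cases)
    case less
    define k where "k = nat (- m - 1)"
    have m: "m = - int (Suc k)" using less by (simp add: k_def)
    have nat2: "nat (2 + int k) = Suc (Suc k)" by linarith
    have "y * (bessel_J y (- m - 1) + bessel_J y (- m + 1)) = real_of_int (- m) * bessel_J y (- m)"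
      using pos[of "- m"] less by simp
    moreover have "bessel_J y (m - 1) = (- 1) ^ k * bessel_J y (- m + 1)"
      using bessel_J_uminus[of y "- m + 1"] m nat2 by simp
    moreover have "bessel_J y (m + 1) = (- 1) ^ k * bessel_J y (- m - 1)"
      using bessel_J_uminus[of y "- m - 1"] m by simp
    moreover have "nat \<bar>- m\<bar> = Suc k" using m by simp
    then have "bessel_J y m = - ((- 1) ^ k * bessel_J y (- m))"
      using bessel_J_uminus[of y "- m"] by simp
    ultimately show ?thesis
      by (smt (verit, ccfv_threshold) distrib_left mult.left_commute mult_minus_left mult_minus_right of_int_minus)
  next
    case equal
    then show ?thesis using bessel_J_uminus[of y 1] by simp
  qed (rule pos)
qed

lemma power_div_fact_le_exp: "0 \<le> x \<Longrightarrow> x ^ n / fact n \<le> exp x" for x :: real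
  using sum_le_suminf[OF sums_summable[OF exp_series_sums[of x]], of "{n}"] sums_unique[OF exp_series_sums[of x]]
  by simp

text \<open>The leading factor \<open>\<bar>y\<bar>\<^sup>k / k!\<close> is at most \<open>exp (\<bar>y\<bar> e\<^sup>a) e\<^sup>-\<^sup>a\<^sup>k\<close>, by comparison with one term of the
exponential series at \<open>\<bar>y\<bar> e\<^sup>a\<close>.\<close>

lemma bessel_J_decay:
  "\<bar>bessel_J y m\<bar> \<le> exp (y\<^sup>2 + \<bar>y\<bar> * exp a) * exp (- a * \<bar>real_of_int m\<bar>)"
proof -
  define k where "k = nat \<bar>m\<bar>"
  have k: "\<bar>real_of_int m\<bar> = real k" by (simp add: k_def)
  have "\<bar>bessel_J y m\<bar> = \<bar>y\<bar> ^ k * \<bar>bessel_series (- y\<^sup>2) k\<bar>"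
    by (simp add: bessel_J_def k_def abs_mult power_abs)
  also have "\<dots> \<le> \<bar>y\<bar> ^ k * (exp (y\<^sup>2) / fact k)"
    using bessel_series_bound[of "- y\<^sup>2" k] by (intro mult_left_mono) auto
  also have "\<dots> = exp (y\<^sup>2) * ((\<bar>y\<bar> * exp a) ^ k / fact k) * exp (- a * real k)"
    by (simp add: power_mult_distrib exp_of_nat_mult[symmetric] mult.commute field_simps exp_minus)
  also have "\<dots> \<le> exp (y\<^sup>2) * exp (\<bar>y\<bar> * exp a) * exp (- a * real k)"
    using power_div_fact_le_exp[of "\<bar>y\<bar> * exp a" k] by (intro mult_right_mono mult_left_mono) auto
  finally show ?thesis by (simp add: k exp_add)
qed

lemma summable_on_exp_abs_int:
  assumes "0 < a"
  shows "(\<lambda>m::int. exp (- a * \<bar>real_of_int m\<bar>)) summable_on UNIV"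
proof -
  let ?f = "\<lambda>m::int. exp (- a * \<bar>real_of_int m\<bar>)"
  let ?neg = "\<lambda>n::nat. - int n - 1"
  have g: "(\<lambda>n::nat. c * exp (- a) ^ n) summable_on UNIV" for c
    using assms
    by (intro summable_on_cmult_right norm_summable_imp_summable_on) (auto simp: summable_geometric norm_power)
  have "?f summable_on range int"
    using g[of 1] by (subst summable_on_reindex) (auto simp: inj_on_def o_def exp_of_nat_mult[symmetric] mult.commute)
  moreover have "?f summable_on range ?neg"
  proof -
    have "?f (?neg n) = exp (- a) * exp (- a) ^ n" for n
      by (simp add: exp_of_nat_mult[symmetric] exp_add[symmetric] algebra_simps)
    then show ?thesis using g[of "exp (- a)"] by (subst summable_on_reindex) (auto simp: inj_on_def o_def)
  qed
  moreover have "range int \<inter> range ?neg = {}" by auto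
  moreover have "range int \<union> range ?neg = UNIV"
  proof -
    have "m \<in> range int \<union> range ?neg" for m
      by (cases "m \<ge> 0") (auto intro: range_eqI[of _ _ "nat m"] range_eqI[of _ _ "nat (- m - 1)"])
    then show ?thesis by blast
  qed
  ultimately show ?thesis using summable_on_Un_disjoint by metis
qed

lemma bessel_J_ell2: "(\<lambda>k. complex_of_real (bessel_J y (k - i))) \<in> ell2"
proof -
  define C where "C = exp (y\<^sup>2 + \<bar>y\<bar> * exp 1)"
  have "(\<lambda>m. C\<^sup>2 * exp (- 2 * \<bar>real_of_int m\<bar>)) summable_on UNIV"
    by (intro summable_on_cmult_right summable_on_exp_abs_int) simp
  moreover have "(bessel_J y m)\<^sup>2 \<le> C\<^sup>2 * exp (- 2 * \<bar>real_of_int m\<bar>)" for m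
  proof -
    have "(bessel_J y m)\<^sup>2 \<le> (C * exp (- 1 * \<bar>real_of_int m\<bar>))\<^sup>2"
      using bessel_J_decay[of y m 1] by (intro power2_le_iff_abs_le[THEN iffD2]) (auto simp: C_def)
    then show ?thesis by (simp add: power_mult_distrib flip: exp_double)
  qed
  ultimately have "(\<lambda>m. (bessel_J y m)\<^sup>2) summable_on UNIV"
    by (rule summable_on_comparison_test) auto
  then have "(\<lambda>k. (bessel_J y (k - i))\<^sup>2) summable_on UNIV"
    by (subst summable_on_reindex_bij_betw[where g = "\<lambda>k. k - i" and f = "\<lambda>m. (bessel_J y m)\<^sup>2"])
       (auto intro!: bij_betwI[where g = "\<lambda>k. k + i"])
  then show ?thesis by (simp add: ell2_def)
qed

definition bessel_corr :: "real \<Rightarrow> int \<Rightarrow> int \<Rightarrow> real" where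
  "bessel_corr y i j = (\<Sum>\<^sub>\<infinity>k. bessel_J y (k - i) * bessel_J y (k - j))"

lemma has_sum_bessel_corr: "((\<lambda>k. bessel_J y (k - i) * bessel_J y (k - j)) has_sum bessel_corr y i j) UNIV"
  using has_sum_Re[OF has_sum_ip[OF bessel_J_ell2[of y i] bessel_J_ell2[of y j]]]
  unfolding bessel_corr_def by (simp add: has_sum_iff)

lemma bessel_corr_shift: "bessel_corr y (i + l) (j + l) = bessel_corr y i j"
proof -
  have "((\<lambda>k. bessel_J y (k - i) * bessel_J y (k - j)) has_sum bessel_corr y (i + l) (j + l)) UNIV"
    using has_sum_bessel_corr[of y "i + l" "j + l"]
    by (subst (asm) has_sum_reindex_bij_betw[where g = "\<lambda>k. k + l" and A = UNIV and B = UNIV, symmetric])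
       (auto intro!: bij_betwI[where g = "\<lambda>k. k - l"])
  then show ?thesis using has_sum_bessel_corr has_sum_unique by blast
qed

text \<open>Eigenvectors of a symmetric operator for distinct eigenvalues are orthogonal. Concretely,
\<open>j - i = (k - i) - (k - j)\<close>, both factors are absorbed by the recurrence, and the resulting sums agree since the
correlations depend on \<open>i - j\<close> alone.\<close>

lemma bessel_corr_eq_0:
  assumes "i \<noteq> j" shows "bessel_corr y i j = 0"
proof -
  let ?B = "bessel_J y"
  have 1: "((\<lambda>k. real_of_int (k - i) * (?B (k - i) * ?B (k - j))) has_sum
          y * (bessel_corr y (i + 1) j + bessel_corr y (i - 1) j)) UNIV" for i j
  proof -
    have "((\<lambda>k. y * (?B (k - (i + 1)) * ?B (k - j) + ?B (k - (i - 1)) * ?B (k - j))) has_sum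
          y * (bessel_corr y (i + 1) j + bessel_corr y (i - 1) j)) UNIV"
      by (intro has_sum_cmult_right has_sum_add has_sum_bessel_corr)
    moreover have "y * (?B (k - (i + 1)) * ?B (k - j) + ?B (k - (i - 1)) * ?B (k - j))
        = real_of_int (k - i) * (?B (k - i) * ?B (k - j))" for k
      unfolding mult.assoc[symmetric] bessel_J_recurrence[of y "k - i", symmetric] by (simp add: algebra_simps)
    ultimately show ?thesis by (simp only:)
  qed
  have "bessel_corr y (j + 1) i = bessel_corr y (i - 1) j" "bessel_corr y (j - 1) i = bessel_corr y (i + 1) j"
    using bessel_corr_shift[of y j 1 "i - 1"] bessel_corr_shift[of y "j - 1" 1 i]
    by (simp_all add: bessel_corr_def mult.commute)
  then have eq: "y * (bessel_corr y (i + 1) j + bessel_corr y (i - 1) j)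
      + - (y * (bessel_corr y (j + 1) i + bessel_corr y (j - 1) i)) = 0" by simp
  have "((\<lambda>k. real_of_int (k - i) * (?B (k - i) * ?B (k - j)) + - (real_of_int (k - j) * (?B (k - j) * ?B (k - i)))) has_sum 0) UNIV"
    unfolding eq[symmetric] by (intro has_sum_add has_sum_uminusI 1)
  moreover have "real_of_int (k - i) * (?B (k - i) * ?B (k - j)) + - (real_of_int (k - j) * (?B (k - j) * ?B (k - i)))
     = real_of_int (j - i) * (?B (k - i) * ?B (k - j))" for k by (simp add: algebra_simps)
  ultimately have "((\<lambda>k. real_of_int (j - i) * (?B (k - i) * ?B (k - j))) has_sum 0) UNIV"
    by (simp only:)
  moreover have "((\<lambda>k. real_of_int (j - i) * (?B (k - i) * ?B (k - j))) has_sum real_of_int (j - i) * bessel_corr y i j) UNIV"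
    by (intro has_sum_cmult_right has_sum_bessel_corr)
  ultimately have "real_of_int (j - i) * bessel_corr y i j = 0" using has_sum_unique by blast
  then show ?thesis using assms by simp
qed

lemma bessel_corr_diag_pos: "0 < bessel_corr y 0 0"
proof -
  have "\<exists>k. bessel_J y k \<noteq> 0"
  proof (cases "y = 0")
    case True
    have "bessel_J 0 0 = 1"
      using powser_zero[of "\<lambda>k. 1 / (fact k * fact k) :: real"] by (simp add: bessel_J_def bessel_series_def)
    then show ?thesis using True by (intro exI[of _ 0]) simp
  next
    case False
    obtain n where "bessel_series (- y\<^sup>2) n \<noteq> 0" using bessel_series_eventually_nonzero by blast
    then show ?thesis using False by (intro exI[of _ "int n"]) (simp add: bessel_J_def)
  qed
  then obtain k where k: "bessel_J y k \<noteq> 0" by blast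
  have "(\<Sum>k\<in>{k}. bessel_J y (k - 0) * bessel_J y (k - 0)) \<le> bessel_corr y 0 0"
    by (rule finite_sum_le_has_sum[OF has_sum_bessel_corr]) auto
  moreover have "0 < bessel_J y k * bessel_J y k" using k by (metis not_square_less_zero linorder_neqE_linordered_idom mult_eq_0_iff)
  ultimately show ?thesis by simp
qed

text \<open>By Neumann's addition theorem the norm that is divided out here equals \<open>1\<close>.\<close>

definition bessel :: "real \<Rightarrow> int \<Rightarrow> real" where
  "bessel y m = bessel_J y m / sqrt (bessel_corr y 0 0)"

lemma bessel_recurrence: "y * (bessel y (m - 1) + bessel y (m + 1)) = real_of_int m * bessel y m"
  using bessel_J_recurrence[of y m] by (simp add: bessel_def flip: add_divide_distrib)

lemma bessel_orthonormal: "((\<lambda>k. bessel y (k - i) * bessel y (k - j)) has_sum (if i = j then 1 else 0)) UNIV"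
proof -
  have "((\<lambda>k. bessel_J y (k - i) * bessel_J y (k - j) / bessel_corr y 0 0) has_sum bessel_corr y i j / bessel_corr y 0 0) UNIV"
    by (intro has_sum_divide_const has_sum_bessel_corr)
  moreover have "bessel_corr y i j / bessel_corr y 0 0 = (if i = j then 1 else 0)"
    using bessel_corr_eq_0[of i j y] bessel_corr_shift[of y 0 i 0] bessel_corr_diag_pos[of y] by auto
  ultimately show ?thesis using bessel_corr_diag_pos[of y] by (simp add: bessel_def)
qed

text \<open>The reflection \<open>k \<mapsto> i + j - k\<close> turns rows of the Toeplitz matrix into columns.\<close>

lemma bessel_orthonormal_transpose:
  "((\<lambda>k. bessel y (i - k) * bessel y (j - k)) has_sum (if i = j then 1 else 0)) UNIV"
proof -
  have "((\<lambda>k. bessel y ((i + j - k) - j) * bessel y ((i + j - k) - i)) has_sum (if i = j then 1 else 0)) UNIV"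
    using bessel_orthonormal[of y j i]
    by (subst has_sum_reindex_bij_betw[where g = "\<lambda>k. i + j - k" and B = UNIV and f = "\<lambda>k. bessel y (k - j) * bessel y (k - i)"])
       (auto intro!: bij_betwI[where g = "\<lambda>k. i + j - k"])
  then show ?thesis by simp
qed

lemma bessel_decay: "\<exists>C>0. \<forall>m. \<bar>bessel y m\<bar> \<le> C * exp (- a * \<bar>real_of_int m\<bar>)"
proof (intro exI conjI allI)
  let ?C = "exp (y\<^sup>2 + \<bar>y\<bar> * exp a) / sqrt (bessel_corr y 0 0)"
  show "0 < ?C" using bessel_corr_diag_pos[of y] by simp
  show "\<bar>bessel y m\<bar> \<le> ?C * exp (- a * \<bar>real_of_int m\<bar>)" for m
    using divide_right_mono[OF bessel_J_decay[of y m a], of "sqrt (bessel_corr y 0 0)"] bessel_corr_diag_pos[of y]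
    by (simp add: bessel_def abs_divide)
qed

section \<open>Wannier-Stark states of the lattice operator\<close>

lemma has_sum_Times_real:
  fixes f :: "'a \<Rightarrow> real" and g :: "'b \<Rightarrow> real"
  assumes f: "(f has_sum a) UNIV" and g: "(g has_sum b) UNIV"
  shows "((\<lambda>(x, y). f x * g y) has_sum a * b) UNIV"
proof -
  have af: "(\<lambda>x. \<bar>f x\<bar>) summable_on UNIV" and ag: "(\<lambda>x. \<bar>g x\<bar>) summable_on UNIV"
    using f g summable_on_iff_abs_summable_on_real has_sum_imp_summable by fastforce+
  have "(\<lambda>z. \<bar>f (fst z)\<bar> * \<bar>g (snd z)\<bar>) summable_on (UNIV \<times> UNIV)"
  proof (rule summable_on_SigmaI[where g = "\<lambda>x. \<bar>f x\<bar> * (\<Sum>\<^sub>\<infinity>y. \<bar>g y\<bar>)"])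
    show "((\<lambda>y. \<bar>f (fst (x, y))\<bar> * \<bar>g (snd (x, y))\<bar>) has_sum \<bar>f x\<bar> * (\<Sum>\<^sub>\<infinity>y. \<bar>g y\<bar>)) UNIV" for x
      using ag by (simp add: has_sum_cmult_right)
    show "(\<lambda>x. \<bar>f x\<bar> * (\<Sum>\<^sub>\<infinity>y. \<bar>g y\<bar>)) summable_on UNIV"
      using af by (rule summable_on_cmult_left)
  qed auto
  then have "(\<lambda>z. norm (f (fst z) * g (snd z))) summable_on (UNIV \<times> UNIV)"
    by (simp add: abs_mult)
  then have s: "(\<lambda>z. f (fst z) * g (snd z)) summable_on (UNIV \<times> UNIV)"
    by (rule abs_summable_summable)
  have "((\<lambda>z. f (fst z) * g (snd z)) has_sum a * b) (UNIV \<times> UNIV)"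
  proof (rule has_sum_SigmaI[OF _ _ s])
    show "((\<lambda>y. f (fst (x, y)) * g (snd (x, y))) has_sum f x * b) UNIV" for x
      using g by (simp add: has_sum_cmult_right)
    show "((\<lambda>x. f x * b) has_sum a * b) UNIV" using f by (rule has_sum_cmult_left)
  qed
  then show ?thesis by (simp add: case_prod_unfold)
qed

text \<open>If a component of \<open>\<omega>\<close> vanishes, the corresponding parameter is \<open>-1/0 = 0\<close>. Orthonormality persists, while
hopping in that direction then shifts the label \<open>n\<close>.\<close>

definition wannier_stark :: "real \<times> real \<Rightarrow> lattice \<Rightarrow> lattice \<Rightarrow> complex" where
  "wannier_stark \<omega> n m = complex_of_real
     (bessel (- 1 / fst \<omega>) (fst m - fst n) * bessel (- 1 / snd \<omega>) (snd m - snd n))"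

lemma cnj_wannier_stark [simp]: "cnj (wannier_stark \<omega> n m) = wannier_stark \<omega> n m"
  by (simp add: wannier_stark_def)

lemma unitary_wannier_stark: "unitary_kernel (wannier_stark \<omega>)"
proof -
  have 1: "((\<lambda>m. wannier_stark \<omega> n m * wannier_stark \<omega> n' m) has_sum (if n = n' then 1 else 0)) UNIV" for n n'
  proof -
    have "((\<lambda>m. complex_of_real (case m of (x, y) \<Rightarrow>
        (bessel (- 1 / fst \<omega>) (x - fst n) * bessel (- 1 / fst \<omega>) (x - fst n')) *
        (bessel (- 1 / snd \<omega>) (y - snd n) * bessel (- 1 / snd \<omega>) (y - snd n'))))
      has_sum complex_of_real ((if fst n = fst n' then 1 else 0) * (if snd n = snd n' then 1 else 0))) UNIV"
      by (intro has_sum_of_real has_sum_Times_real bessel_orthonormal)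
    moreover have "complex_of_real ((if fst n = fst n' then 1 else 0) * (if snd n = snd n' then 1 else 0)) = (if n = n' then 1 else 0)"
      by (simp add: prod_eq_iff)
    ultimately show ?thesis
      by (simp only:) (simp add: wannier_stark_def case_prod_unfold mult_ac)
  qed
  have 2: "((\<lambda>n. wannier_stark \<omega> n m * wannier_stark \<omega> n m') has_sum (if m = m' then 1 else 0)) UNIV" for m m'
  proof -
    have "((\<lambda>m0. complex_of_real (case m0 of (x, y) \<Rightarrow>
        (bessel (- 1 / fst \<omega>) (fst m - x) * bessel (- 1 / fst \<omega>) (fst m' - x)) *
        (bessel (- 1 / snd \<omega>) (snd m - y) * bessel (- 1 / snd \<omega>) (snd m' - y))))
      has_sum complex_of_real ((if fst m = fst m' then 1 else 0) * (if snd m = snd m' then 1 else 0))) UNIV"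
      by (intro has_sum_of_real has_sum_Times_real bessel_orthonormal_transpose)
    moreover have "complex_of_real ((if fst m = fst m' then 1 else 0) * (if snd m = snd m' then 1 else 0)) = (if m = m' then 1 else 0)"
      by (simp add: prod_eq_iff)
    ultimately show ?thesis
      by (simp only:) (simp add: wannier_stark_def case_prod_unfold mult_ac)
  qed
  show ?thesis using 1 2 by (simp add: unitary_kernel_def)
qed

lemma wannier_stark_ell2: "wannier_stark \<omega> n \<in> ell2"
  using kbound_row[OF kbound_unitary[OF unitary_wannier_stark]] .

lemma wannier_stark_basis: "inj (wannier_stark \<omega>)" "orthonormal_basis (range (wannier_stark \<omega>))"
  using unitary_columns_orthonormal_basis[OF unitary_kernel_kadj[OF unitary_wannier_stark[of \<omega>]]]
  by (simp_all add: kadj_def)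

lemma wannier_stark_decay:
  "\<exists>C>0. \<forall>n m. cmod (wannier_stark \<omega> n m) \<le> C * exp (- a * real_of_int (l1norm (m - n)))"
proof -
  obtain C where C: "C > 0" "\<And>m. \<bar>bessel (- 1 / fst \<omega>) m\<bar> \<le> C * exp (- a * \<bar>real_of_int m\<bar>)"
    using bessel_decay by blast
  obtain D where D: "D > 0" "\<And>m. \<bar>bessel (- 1 / snd \<omega>) m\<bar> \<le> D * exp (- a * \<bar>real_of_int m\<bar>)"
    using bessel_decay by blast
  have "cmod (wannier_stark \<omega> n m) \<le> (C * D) * exp (- a * real_of_int (l1norm (m - n)))" for n m
  proof -
    have "cmod (wannier_stark \<omega> n m) \<le> (C * exp (- a * \<bar>real_of_int (fst m - fst n)\<bar>)) * (D * exp (- a * \<bar>real_of_int (snd m - snd n)\<bar>))"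
      unfolding wannier_stark_def norm_of_real abs_mult
      by (rule mult_mono[OF C(2) D(2)]) (use C D in auto)
    also have "\<dots> = (C * D) * exp (- a * real_of_int (l1norm (m - n)))"
      by (simp add: l1norm_def exp_add[symmetric] algebra_simps)
    finally show ?thesis .
  qed
  then show ?thesis using C(1) D(1) by (intro exI[of _ "C * D"]) auto
qed

lemma hopping_eq:
  "hopping u (a, b) = u (a + 1, b) + u (a - 1, b) + u (a, b + 1) + u (a, b - 1)"
  unfolding hopping_def neighbours by simp

lemma bessel_stark: 
  assumes "w \<noteq> 0"
  shows "bessel (- 1 / w) (k + 1) + bessel (- 1 / w) (k - 1) = - (w * real_of_int k * bessel (- 1 / w) k)"
  using bessel_recurrence[of "- 1 / w" k] assms by (simp add: field_simps)

lemma H_op_wannier_stark_expand: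
  fixes \<omega> :: "real \<times> real"
  defines "f \<equiv> bessel (- 1 / fst \<omega>)" and "g \<equiv> bessel (- 1 / snd \<omega>)"
  shows "H_op \<omega> (wannier_stark \<omega> (c, d)) (a, b) = complex_of_real
    ((f (a - c + 1) + f (a - c - 1)) * g (b - d) + f (a - c) * (g (b - d + 1) + g (b - d - 1))
     + dot \<omega> (a, b) * (f (a - c) * g (b - d)))"
proof -
  have "a + 1 - c = a - c + 1" "a - 1 - c = a - c - 1" "b + 1 - d = b - d + 1" "b - 1 - d = b - d - 1" by simp_all
  then show ?thesis
    unfolding H_op_def potential_def hopping_eq wannier_stark_def fst_conv snd_conv f_def g_def
    by (simp only: of_real_add of_real_mult distrib_left distrib_right add_ac)
qed

lemma H_op_wannier_stark:
  assumes "fst \<omega> \<noteq> 0" "snd \<omega> \<noteq> 0"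
  shows "H_op \<omega> (wannier_stark \<omega> n) = (\<lambda>m. complex_of_real (dot \<omega> n) * wannier_stark \<omega> n m)"
proof
  fix m :: lattice
  obtain a b where m: "m = (a, b)" by (cases m)
  obtain c d where n: "n = (c, d)" by (cases n)
  show "H_op \<omega> (wannier_stark \<omega> n) m = complex_of_real (dot \<omega> n) * wannier_stark \<omega> n m"
    unfolding m n H_op_wannier_stark_expand bessel_stark[OF assms(1)] bessel_stark[OF assms(2)]
      wannier_stark_def of_real_mult[symmetric] of_real_eq_iff
    by (simp add: dot_def algebra_simps)
qed

lemma ell2_reindex:
  assumes "bij g"
  shows "(\<lambda>n. u (g n)) \<in> ell2 \<longleftrightarrow> u \<in> ell2"
  unfolding ell2_def mem_Collect_eq
  using assms summable_on_reindex_bij_betw[of g UNIV UNIV "\<lambda>n. (cmod (u n))\<^sup>2"] by simp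

lemma ip_reindex:
  assumes "bij g"
  shows "ip (\<lambda>n. u (g n)) (\<lambda>n. v (g n)) = ip u v"
  unfolding ip_def
  using assms infsum_reindex_bij_betw[of g UNIV UNIV "\<lambda>n. cnj (u n) * v n"] by simp

lemma bij_shift: "bij (\<lambda>n :: lattice. (fst n + a, snd n + b))"
  by (rule o_bij[of "\<lambda>n. (fst n - a, snd n - b)"]) auto

lemma ell2_shift: "u \<in> ell2 \<Longrightarrow> (\<lambda>n :: lattice. u (fst n + a, snd n + b)) \<in> ell2"
  using ell2_reindex[OF bij_shift, of u a b] by simp

lemma ip_shift:
  "ip (\<lambda>n :: lattice. u (fst n + a, snd n + b)) v = ip u (\<lambda>n. v (fst n - a, snd n - b))"
  using ip_reindex[OF bij_shift[of a b], of u "\<lambda>n. v (fst n - a, snd n - b)"] by simp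

lemma hopping_eq': "hopping u n = u (fst n + 1, snd n + 0) + u (fst n + - 1, snd n + 0) + u (fst n + 0, snd n + 1) + u (fst n + 0, snd n + - 1)"
  using hopping_eq[of u "fst n" "snd n"] by simp

lemma hopping_ell2: "u \<in> ell2 \<Longrightarrow> hopping u \<in> ell2"
  unfolding hopping_eq'[abs_def] by (intro ell2_add ell2_shift)

lemma ip_hopping:
  assumes "u \<in> ell2" "v \<in> ell2"
  shows "ip (hopping u) v = ip u (hopping v)"
  unfolding hopping_eq'[abs_def]
  by (simp only: ip_add_left ip_add_right ell2_add ell2_shift assms ip_shift) (simp add: algebra_simps)

lemma ip_potential: "ip (potential \<omega> u) v = ip u (potential \<omega> v)"
  by (simp add: ip_def potential_def mult_ac)

lemma H_domD: "u \<in> H_dom \<omega> \<Longrightarrow> u \<in> ell2" "u \<in> H_dom \<omega> \<Longrightarrow> potential \<omega> u \<in> ell2"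
  by (simp_all add: H_dom_def)

lemma H_op_ell2: "u \<in> H_dom \<omega> \<Longrightarrow> H_op \<omega> u \<in> ell2"
  unfolding H_op_def by (intro ell2_add hopping_ell2 H_domD)

text \<open>The hopping part is bounded, so the domain is the maximal one.\<close>

lemma H_dom_iff: "u \<in> H_dom \<omega> \<longleftrightarrow> u \<in> ell2 \<and> H_op \<omega> u \<in> ell2"
proof
  assume "u \<in> ell2 \<and> H_op \<omega> u \<in> ell2"
  then have "(\<lambda>n. H_op \<omega> u n - hopping u n) \<in> ell2" by (intro ell2_diff hopping_ell2) auto
  moreover have "(\<lambda>n. H_op \<omega> u n - hopping u n) = potential \<omega> u" by (simp add: H_op_def)
  ultimately show "u \<in> H_dom \<omega>" using \<open>u \<in> ell2 \<and> _\<close> by (simp add: H_dom_def)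
qed (simp add: H_domD H_op_ell2)

lemma H_op_symmetric:
  assumes "u \<in> H_dom \<omega>" "v \<in> H_dom \<omega>"
  shows "ip (H_op \<omega> u) v = ip u (H_op \<omega> v)"
  unfolding H_op_def
  by (simp add: ip_add_left ip_add_right hopping_ell2 H_domD[OF assms(1)] H_domD[OF assms(2)]
      ip_hopping ip_potential)

lemma wannier_stark_eigenspace:
  assumes "fst \<omega> \<noteq> 0" "snd \<omega> \<noteq> 0"
  shows "wannier_stark \<omega> n \<in> eigenspace (H_dom \<omega>) (H_op \<omega>) (complex_of_real (dot \<omega> n))"
  unfolding eigenspace_def mem_Collect_eq H_dom_iff H_op_wannier_stark[OF assms]
  using wannier_stark_ell2 ell2_scale by blast

lemma ip_wannier_stark: "ip (wannier_stark \<omega> n) (wannier_stark \<omega> n') = (if n = n' then 1 else 0)"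
  using ip_unitary_columns[OF unitary_kernel_kadj[OF unitary_wannier_stark[of \<omega>]], of n n'] by (simp add: kadj_def)

lemma wannier_stark_eigenvector:
  assumes "fst \<omega> \<noteq> 0" "snd \<omega> \<noteq> 0"
  shows "eigenvector (H_dom \<omega>) (H_op \<omega>) (wannier_stark \<omega> n)"
proof -
  have "wannier_stark \<omega> n \<noteq> (\<lambda>n. 0)"
  proof
    assume "wannier_stark \<omega> n = (\<lambda>n. 0)"
    then show False using ip_wannier_stark[of \<omega> n n] by (simp add: ip_def)
  qed
  then show ?thesis using wannier_stark_eigenspace[OF assms] unfolding eigenvector_def by blast
qed

text \<open>The finite set in the definition of \<^const>\<open>finite_dimensional\<close> may contain functions outside \<^const>\<open>ell2\<close>, so
the dimension count takes place in the vector space of all functions.\<close>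

lemma infinite_orthonormal_not_finite_dimensional:
  fixes S :: "('i \<Rightarrow> complex) set"
  assumes S: "infinite S" "S \<subseteq> V" "S \<subseteq> ell2"
    and orth: "\<And>u v. u \<in> S \<Longrightarrow> v \<in> S \<Longrightarrow> ip u v = (if u = v then 1 else 0)"
  shows "\<not> finite_dimensional V"
proof
  assume "finite_dimensional V"
  then obtain F where F: "finite F" "\<And>u. u \<in> V \<Longrightarrow> \<exists>c. u = (\<lambda>n. \<Sum>b\<in>F. c b * b n)"
    unfolding finite_dimensional_def by blast
  interpret vs: vector_space "\<lambda>(c::complex) (f::'i \<Rightarrow> complex) n. c * f n"
    by unfold_locales (auto simp: fun_eq_iff algebra_simps)
  have sum_eq: "(\<Sum>b\<in>T. (\<lambda>n. c b * b n)) = (\<lambda>n. \<Sum>b\<in>T. c b * b n)" for T :: "('i \<Rightarrow> complex) set" and c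
    by (induction T rule: infinite_finite_induct) (auto simp: fun_eq_iff)
  have "vs.independent S"
    unfolding vs.independent_explicit_module
  proof (intro allI impI)
    fix T c v assume T: "finite T" "T \<subseteq> S" "(\<Sum>v\<in>T. (\<lambda>n. c v * v n)) = 0" "v \<in> T"
    have "ip v (\<lambda>n. \<Sum>b\<in>T. c b * b n) = (\<Sum>b\<in>T. c b * ip v b)"
      by (rule ip_sum_right) (use T S in auto)
    also have "\<dots> = (\<Sum>b\<in>T. if v = b then c b else 0)"
    proof (rule sum.cong)
      fix x assume "x \<in> T"
      then have "v \<in> S" "x \<in> S" using T by blast+
      then show "c x * ip v x = (if v = x then c x else 0)" using orth[of v x] by simp
    qed simp
    also have "\<dots> = c v" using T by simp
    finally have "ip v (\<lambda>n. \<Sum>b\<in>T. c b * b n) = c v" .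
    moreover have "(\<lambda>n. \<Sum>b\<in>T. c b * b n) = (\<lambda>n. 0)" using T(3) by (simp add: sum_eq zero_fun_def)
    ultimately show "c v = 0" by (simp add: ip_def)
  qed
  moreover have "S \<subseteq> vs.span F"
  proof
    fix u assume "u \<in> S"
    then obtain c where "u = (\<lambda>n. \<Sum>b\<in>F. c b * b n)" using F(2) S(2) by blast
    then have "u = (\<Sum>b\<in>F. (\<lambda>n. c b * b n))" by (simp add: sum_eq)
    also have "\<dots> \<in> vs.span F" by (intro vs.span_sum vs.span_scale vs.span_base)
    finally show "u \<in> vs.span F" .
  qed
  ultimately show False using vs.independent_span_bound[OF F(1)] S(1) by blast
qed

text \<open>An eigenvector for any other number would be orthogonal to all Wannier-Stark states, by symmetry of the operator,
and these form a basis.\<close>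

lemma eigenvalue_is_dot:
  assumes "fst \<omega> \<noteq> 0" "snd \<omega> \<noteq> 0" and u: "u \<in> eigenspace (H_dom \<omega>) (H_op \<omega>) z" "u \<noteq> (\<lambda>n. 0)"
  shows "\<exists>n. z = complex_of_real (dot \<omega> n)"
proof (rule ccontr)
  assume no: "\<nexists>n. z = complex_of_real (dot \<omega> n)"
  have uD: "u \<in> H_dom \<omega>" and uH: "H_op \<omega> u = (\<lambda>n. z * u n)" using u by (auto simp: eigenspace_def)
  have "ip (wannier_stark \<omega> n) u = 0" for n
  proof -
    have wD: "wannier_stark \<omega> n \<in> H_dom \<omega>"
      using wannier_stark_eigenspace[OF assms(1,2), of n] by (simp add: eigenspace_def)
    have "complex_of_real (dot \<omega> n) * ip (wannier_stark \<omega> n) u = z * ip (wannier_stark \<omega> n) u"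
      using H_op_symmetric[OF wD uD] uD
      unfolding uH H_op_wannier_stark[OF assms(1,2)]
      by (simp add: ip_scale_left ip_scale_right wannier_stark_ell2 H_domD)
    then show ?thesis using no by (metis mult_right_cancel)
  qed
  then have "kop (wannier_stark \<omega>) u = (\<lambda>n. 0)"
    by (simp add: kop_eq_ip fun_eq_iff)
  then have "u = kop (kadj (wannier_stark \<omega>)) (\<lambda>n. 0)"
    using unitary_kernel_inverse[OF unitary_wannier_stark[of \<omega>] H_domD(1)[OF uD]] by simp
  then show False using u(2) by (simp add: kop_def)
qed

lemma H_op_zero: "(\<lambda>n. 0) \<in> eigenspace (H_dom \<omega>) (H_op \<omega>) z"
  by (auto simp: eigenspace_def H_dom_def H_op_def potential_def hopping_def)

text \<open>Translating the label by multiples of \<open>l\<close> leaves the eigenvalue unchanged, so every eigenspace is zero or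
infinite-dimensional.\<close>

lemma rational_direction_purely_essential:
  assumes l: "l \<noteq> (0, 0)" "dot \<omega> l = 0" and "fst \<omega> \<noteq> 0" "snd \<omega> \<noteq> 0"
  shows "purely_essential (H_dom \<omega>) (H_op \<omega>)"
proof -
  have "\<not> finite_dimensional (eigenspace (H_dom \<omega>) (H_op \<omega>) z)"
    if ne: "eigenspace (H_dom \<omega>) (H_op \<omega>) z \<noteq> {\<lambda>n. 0}" for z
  proof -
    obtain u where "u \<in> eigenspace (H_dom \<omega>) (H_op \<omega>) z" "u \<noteq> (\<lambda>n. 0)"
      using ne H_op_zero by blast
    then obtain n where z: "z = complex_of_real (dot \<omega> n)" using eigenvalue_is_dot assms by blast
    define g where "g k = (fst n + int k * fst l, snd n + int k * snd l)" for k
    have g: "inj g" using l(1) by (auto simp: g_def inj_def prod_eq_iff)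
    have dg: "dot \<omega> (g k) = dot \<omega> n" for k
    proof -
      have "dot \<omega> (g k) = dot \<omega> n + real k * dot \<omega> l" by (simp add: dot_def g_def algebra_simps)
      then show ?thesis using l(2) by simp
    qed
    let ?S = "range (\<lambda>k. wannier_stark \<omega> (g k))"
    have inj: "inj (\<lambda>k. wannier_stark \<omega> (g k))"
      using inj_compose[OF wannier_stark_basis(1) g] by (simp add: o_def)
    show ?thesis
    proof (rule infinite_orthonormal_not_finite_dimensional[of ?S])
      show "infinite ?S" using inj range_inj_infinite by blast
      show "?S \<subseteq> eigenspace (H_dom \<omega>) (H_op \<omega>) z"
        using wannier_stark_eigenspace[OF assms(3,4)] dg z by (metis image_subsetI)
      show "?S \<subseteq> ell2" by (auto intro: wannier_stark_ell2)
      show "ip u v = (if u = v then 1 else 0)" if uv: "u \<in> ?S" "v \<in> ?S" for u v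
      proof -
        obtain k k' where "u = wannier_stark \<omega> (g k)" "v = wannier_stark \<omega> (g k')" using uv by blast
        then show ?thesis by (simp only: ip_wannier_stark inj_eq[OF wannier_stark_basis(1)])
      qed
    qed
  qed
  then have "discrete_spectrum (H_dom \<omega>) (H_op \<omega>) = {}" by (auto simp: discrete_spectrum_def)
  then show ?thesis by (simp add: purely_essential_def essential_spectrum_def)
qed

lemma localised_eigenbasis:
  assumes "fst \<omega> \<noteq> 0" "snd \<omega> \<noteq> 0"
  shows "purely_point (H_dom \<omega>) (H_op \<omega>)"
    "\<exists>C>0. \<exists>\<psi> :: lattice \<Rightarrow> lattice \<Rightarrow> complex.
               inj \<psi> \<and> orthonormal_basis (range \<psi>) \<and>
               (\<forall>n. eigenvector (H_dom \<omega>) (H_op \<omega>) (\<psi> n)) \<and>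
               (\<forall>n m. cmod (\<psi> n m) \<le> C * exp (- a * real_of_int (l1norm (m - n))))"
proof -
  show "purely_point (H_dom \<omega>) (H_op \<omega>)"
    unfolding purely_point_def
    using wannier_stark_basis(2)[of \<omega>] wannier_stark_eigenvector[OF assms] by (intro exI[of _ "range (wannier_stark \<omega>)"]) auto
  obtain C where "C > 0" "\<forall>n m. cmod (wannier_stark \<omega> n m) \<le> C * exp (- a * real_of_int (l1norm (m - n)))"
    using wannier_stark_decay by blast
  then show "\<exists>C>0. \<exists>\<psi> :: lattice \<Rightarrow> lattice \<Rightarrow> complex.
               inj \<psi> \<and> orthonormal_basis (range \<psi>) \<and>
               (\<forall>n. eigenvector (H_dom \<omega>) (H_op \<omega>) (\<psi> n)) \<and>
               (\<forall>n m. cmod (\<psi> n m) \<le> C * exp (- a * real_of_int (l1norm (m - n))))"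
    using wannier_stark_basis[of \<omega>] wannier_stark_eigenvector[OF assms]
    by (intro exI[of _ C] conjI exI[of _ "wannier_stark \<omega>"]) auto
qed

section \<open>Spectral measures and unitary transport\<close>

lemma pvm_form:
  assumes E: "projection_valued_measure E" and A: "A \<in> sets borel" and u: "u \<in> ell2"
  shows "E A u \<in> ell2" "ip u (E A u) = complex_of_real ((l2norm (E A u))\<^sup>2)"
proof -
  show e: "E A u \<in> ell2" using E A u by (simp add: projection_valued_measure_def)
  have "E A (E A u) = E A u" "ip (E A u) (E A u) = ip u (E A (E A u))"
    using E A u e by (simp_all add: projection_valued_measure_def)
  then show "ip u (E A u) = complex_of_real ((l2norm (E A u))\<^sup>2)" by (simp only: ip_self)
qed

lemma sets_spectral_measure [simp, measurable_cong]: "sets (spectral_measure E u) = sets borel"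
  and space_spectral_measure [simp]: "space (spectral_measure E u) = UNIV"
  unfolding spectral_measure_def
  using sets.sigma_sets_eq[of "borel :: real measure"] by (simp_all add: sets_measure_of space_measure_of)

text \<open>Pairing strong countable additivity with \<open>u\<close> gives countable additivity of \<open>A \<mapsto> \<langle>u, E(A) u\<rangle> = \<parallel>E(A) u\<parallel>\<^sup>2\<close>, so
\<^const>\<open>measure_of\<close> yields this very set function.\<close>

lemma emeasure_spectral_measure:
  assumes E: "projection_valued_measure E" and A: "A \<in> sets borel" and u: "u \<in> ell2"
  shows "emeasure (spectral_measure E u) A = ennreal ((l2norm (E A u))\<^sup>2)"
proof -
  have form: "Re (ip u (E B u)) = (l2norm (E B u))\<^sup>2" if "B \<in> sets borel" for B
    using pvm_form(2)[OF E that u] by simp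
  note e = pvm_form(1)[OF E _ u]
  have add: "(\<lambda>i. Re (ip u (E (A i) u))) sums Re (ip u (E (\<Union>i. A i) u))"
    if A: "range A \<subseteq> sets borel" "disjoint_family A" for A :: "nat \<Rightarrow> real set"
  proof -
    have m: "A i \<in> sets borel" "(\<Union>i. A i) \<in> sets borel" for i using A(1) by auto
    let ?r = "\<lambda>k n. E (\<Union>i. A i) u n - (\<Sum>i<k. E (A i) u n)"
    have lim: "(\<lambda>k. l2norm (?r k)) \<longlonglongrightarrow> 0"
      using E A u by (simp add: projection_valued_measure_def)
    have s: "(\<lambda>n. \<Sum>i<k. E (A i) u n) \<in> ell2" for k by (intro ell2_sum e m)
    have part: "(\<Sum>i<k. Re (ip u (E (A i) u))) = Re (ip u (E (\<Union>i. A i) u)) - Re (ip u (?r k))" for k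
    proof -
      have "ip u (\<lambda>n. \<Sum>i<k. 1 * E (A i) u n) = (\<Sum>i<k. 1 * ip u (E (A i) u))"
        by (rule ip_sum_right[OF u]) (intro e m)
      then have "ip u (?r k) = ip u (E (\<Union>i. A i) u) - (\<Sum>i<k. ip u (E (A i) u))"
        by (simp add: ip_diff_right[OF u e[OF m(2)] s])
      then show ?thesis by simp
    qed
    have "(\<lambda>k. Re (ip u (?r k))) \<longlonglongrightarrow> 0"
    proof (rule Lim_null_comparison)
      show "\<forall>\<^sub>F k in sequentially. norm (Re (ip u (?r k))) \<le> l2norm u * l2norm (?r k)"
      proof (intro always_eventually allI)
        fix k
        have "norm (Re (ip u (?r k))) \<le> cmod (ip u (?r k))" by (simp add: abs_Re_le_cmod)
        also have "\<dots> \<le> l2norm u * l2norm (?r k)" by (intro ell2_Cauchy_Schwarz u ell2_diff e m s)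
        finally show "norm (Re (ip u (?r k))) \<le> l2norm u * l2norm (?r k)" .
      qed
      show "(\<lambda>k. l2norm u * l2norm (?r k)) \<longlonglongrightarrow> 0" using tendsto_mult_left[OF lim, of "l2norm u"] by simp
    qed
    then show ?thesis
      unfolding sums_def part using tendsto_diff[OF tendsto_const] by fastforce
  qed
  have "(\<lambda>i::nat. Re (ip u (E {} u))) sums Re (ip u (E {} u))"
    using add[of "\<lambda>_. {}"] by (simp add: disjoint_family_on_def)
  then have empty: "Re (ip u (E {} u)) = 0"
    using summable_LIMSEQ_zero[OF sums_summable] LIMSEQ_unique[OF tendsto_const] by metis
  have "emeasure (spectral_measure E u) A = ennreal (Re (ip u (E A u)))"
  proof (rule emeasure_measure_of[OF spectral_measure_def])
    show "positive (sets (spectral_measure E u)) (\<lambda>A. ennreal (Re (ip u (E A u))))"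
      by (simp add: positive_def empty)
    show "countably_additive (sets (spectral_measure E u)) (\<lambda>A. ennreal (Re (ip u (E A u))))"
    proof (rule countably_additiveI)
      fix A :: "nat \<Rightarrow> real set"
      assume "range A \<subseteq> sets (spectral_measure E u)" "disjoint_family A"
      then show "(\<Sum>i. ennreal (Re (ip u (E (A i) u)))) = ennreal (Re (ip u (E (\<Union>i. A i) u)))"
        by (intro suminf_ennreal_eq add) (auto simp: form)
    qed
  qed (use A in auto)
  then show ?thesis using form[OF A] by simp
qed

lemma finite_measure_spectral_measure:
  assumes "projection_valued_measure E" "u \<in> ell2" shows "finite_measure (spectral_measure E u)"
  by standard (simp add: emeasure_spectral_measure[OF assms(1) _ assms(2)])

lemma measure_spectral_measure:
  assumes "projection_valued_measure E" "A \<in> sets borel" "u \<in> ell2"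
  shows "complex_of_real (measure (spectral_measure E u) A) = ip u (E A u)"
  using emeasure_spectral_measure[OF assms] pvm_form(2)[OF assms] by (simp add: measure_def)

text \<open>The spectral measure of \<open>u\<close> under the conjugated projections is literally the original spectral measure of
\<open>U u\<close>, so integrability and first moments carry over.\<close>

lemma spectral_resolution_unitary_transport:
  fixes U :: "'j \<Rightarrow> 'i \<Rightarrow> complex"
  assumes U: "unitary_kernel U" and S: "spectral_resolution D T E"
    and D: "D' = {u \<in> ell2. kop U u \<in> D}" and T: "\<And>u. u \<in> D' \<Longrightarrow> T' u \<in> ell2 \<and> kop U (T' u) = T (kop U u)"
  defines "E' \<equiv> \<lambda>A u. kop (kadj U) (E A (kop U u))"
  shows "spectral_resolution D' T' E'" 
    "\<And>u. u \<in> ell2 \<Longrightarrow> spectral_measure E' u = spectral_measure E (kop U u)"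
proof -
  note V = unitary_kernel_kadj[OF U]
  note e = unitary_kernel_ell2[OF U] and e' = unitary_kernel_ell2[OF V]
  note inv = unitary_kernel_inverse[OF U] and inv' = unitary_kernel_inverse'[OF U]
  have E: "projection_valued_measure E" using S by (simp add: spectral_resolution_def)
  note El = pvm_form(1)[OF E]
  have UE: "kop U (E' A u) = E A (kop U u)" if "A \<in> sets borel" "u \<in> ell2" for A u
    unfolding E'_def by (rule inv') (intro El e that)
  have E'l: "E' A u \<in> ell2" if "A \<in> sets borel" "u \<in> ell2" for A u
    unfolding E'_def by (intro e' El e that)
  have ipU: "ip (kop U u) (kop U v) = ip u v" if "u \<in> ell2" "v \<in> ell2" for u v
    by (rule unitary_kernel_ip[OF U that])
  have form: "ip u (E' A v) = ip (kop U u) (E A (kop U v))" if "A \<in> sets borel" "u \<in> ell2" "v \<in> ell2" for A u v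
    using ipU[OF that(2) E'l[OF that(1,3)]] by (simp add: UE that)
  have form': "ip (E' A u) v = ip (E A (kop U u)) (kop U v)" if "A \<in> sets borel" "u \<in> ell2" "v \<in> ell2" for A u v
    using ipU[OF E'l[OF that(1,2)] that(3)] by (simp add: UE that)
  show spec: "spectral_measure E' u = spectral_measure E (kop U u)" if "u \<in> ell2" for u
    unfolding spectral_measure_def
    by (rule measure_of_eq) (use form[OF _ that that] sets.sigma_sets_eq[of "borel :: real measure"] in auto)
  have "projection_valued_measure E'"
    unfolding projection_valued_measure_def
  proof (intro conjI ballI allI impI)
    fix A :: "real set" and u v :: "'i \<Rightarrow> complex" and a b :: complex
    assume A: "A \<in> sets borel" and u: "u \<in> ell2"
    show "E' A u \<in> ell2" by (rule E'l[OF A u])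
    have "E A (E A (kop U u)) = E A (kop U u)"
      using E A e[OF u] by (simp add: projection_valued_measure_def)
    then show "E' A (E' A u) = E' A u"
      using UE[OF A u] by (simp add: E'_def)
    assume v: "v \<in> ell2"
    have "E A (\<lambda>n. a * kop U u n + b * kop U v n) = (\<lambda>n. a * E A (kop U u) n + b * E A (kop U v) n)"
      using E A e[OF u] e[OF v] unfolding projection_valued_measure_def by blast
    then show "E' A (\<lambda>n. a * u n + b * v n) = (\<lambda>n. a * E' A u n + b * E' A v n)"
      unfolding E'_def kop_lincomb[OF kbound_unitary[OF U] u v]
      by (simp only: kop_lincomb[OF kbound_unitary[OF V] El[OF A e[OF u]] El[OF A e[OF v]]])
    show "ip (E' A u) v = ip u (E' A v)"
      using E A e[OF u] e[OF v] by (simp add: form form' A u v projection_valued_measure_def)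
  next
    fix u :: "'i \<Rightarrow> complex" assume u: "u \<in> ell2"
    show "E' UNIV u = u"
      using E e[OF u] inv[OF u] by (simp add: E'_def projection_valued_measure_def)
  next
    fix A :: "nat \<Rightarrow> real set" and u :: "'i \<Rightarrow> complex"
    assume A: "range A \<subseteq> sets borel" "disjoint_family A" and u: "u \<in> ell2"
    have m: "A i \<in> sets borel" "(\<Union>i. A i) \<in> sets borel" for i using A(1) by auto
    have "(\<lambda>n. E' (\<Union>i. A i) u n - (\<Sum>i<k. E' (A i) u n))
        = kop (kadj U) (\<lambda>n. E (\<Union>i. A i) (kop U u) n - (\<Sum>i<k. E (A i) (kop U u) n))" for k
    proof -
      have s: "(\<lambda>n. \<Sum>i<k. E (A i) (kop U u) n) \<in> ell2" by (intro ell2_sum El m e u)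
      have sum: "kop (kadj U) (\<lambda>n. \<Sum>i<k. E (A i) (kop U u) n) = (\<lambda>n. \<Sum>i<k. E' (A i) u n)"
      proof
        fix n
        have r: "(\<lambda>q. cnj (kadj U n q)) \<in> ell2"
          using kbound_row[OF kbound_unitary[OF V]] by (simp add: ell2_cnj)
        have "ip (\<lambda>q. cnj (kadj U n q)) (\<lambda>q. \<Sum>i<k. 1 * E (A i) (kop U u) q) = (\<Sum>i<k. 1 * ip (\<lambda>q. cnj (kadj U n q)) (E (A i) (kop U u)))"
          by (rule ip_sum_right[OF r]) (intro El m e u)
        then show "kop (kadj U) (\<lambda>n. \<Sum>i<k. E (A i) (kop U u) n) n = (\<Sum>i<k. E' (A i) u n)"
          unfolding E'_def kop_eq_ip by (simp only: mult_1)
      qed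
      show ?thesis
        unfolding kop_diff[OF kbound_unitary[OF V] El[OF m(2) e[OF u]] s] sum by (simp add: E'_def)
    qed
    moreover have "(\<lambda>n. E (\<Union>i. A i) (kop U u) n - (\<Sum>i<k. E (A i) (kop U u) n)) \<in> ell2" for k
      by (intro ell2_diff ell2_sum El m e u)
    ultimately have "l2norm (\<lambda>n. E' (\<Union>i. A i) u n - (\<Sum>i<k. E' (A i) u n))
        = l2norm (\<lambda>n. E (\<Union>i. A i) (kop U u) n - (\<Sum>i<k. E (A i) (kop U u) n))" for k
      using unitary_kernel_l2norm[OF V] by (simp only:)
    then show "(\<lambda>k. l2norm (\<lambda>n. E' (\<Union>i. A i) u n - (\<Sum>i<k. E' (A i) u n))) \<longlonglongrightarrow> 0"
      using E A e[OF u] by (simp add: projection_valued_measure_def)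
  qed
  moreover have "D' = {u \<in> ell2. integrable (spectral_measure E' u) (\<lambda>x. x\<^sup>2)}"
  proof -
    have "D = {u \<in> ell2. integrable (spectral_measure E u) (\<lambda>x. x\<^sup>2)}" using S by (simp add: spectral_resolution_def)
    then show ?thesis unfolding D using spec e by auto
  qed
  moreover have "T' u \<in> ell2 \<and> ip u (T' u) = complex_of_real (\<integral>x. x \<partial>spectral_measure E' u)" if u: "u \<in> D'" for u
  proof -
    have ue: "u \<in> ell2" and "kop U u \<in> D" using u D by auto
    then have "ip (kop U u) (T (kop U u)) = complex_of_real (\<integral>x. x \<partial>spectral_measure E (kop U u))"
      using S by (simp add: spectral_resolution_def)
    then show ?thesis using T[OF u] ipU[OF ue, of "T' u"] spec[OF ue] by simp
  qed
  ultimately show "spectral_resolution D' T' E'" by (simp add: spectral_resolution_def)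
qed

section \<open>From a functional calculus to a spectral resolution\<close>

definition bborel_on :: "real set \<Rightarrow> (real \<Rightarrow> real) \<Rightarrow> bool" where
  "bborel_on S f \<longleftrightarrow> f \<in> borel_measurable borel \<and> (\<exists>C. \<forall>x\<in>S. \<bar>f x\<bar> \<le> C)"

abbreviation bborel :: "(real \<Rightarrow> real) \<Rightarrow> bool" where "bborel \<equiv> bborel_on UNIV"

lemma bborel_measurable: "bborel_on S f \<Longrightarrow> f \<in> borel_measurable borel"
  by (simp add: bborel_on_def)

lemma bborelI:
  "f \<in> borel_measurable borel \<Longrightarrow> (\<And>x. x \<in> S \<Longrightarrow> \<bar>f x\<bar> \<le> C) \<Longrightarrow> bborel_on S f"
  unfolding bborel_on_def by blast

lemma bborelE:
  assumes "bborel_on S f"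
  obtains C where "0 \<le> C" "\<And>x. x \<in> S \<Longrightarrow> \<bar>f x\<bar> \<le> C"
proof -
  obtain C where C: "\<forall>x\<in>S. \<bar>f x\<bar> \<le> C" using assms by (auto simp: bborel_on_def)
  then have "\<forall>x\<in>S. \<bar>f x\<bar> \<le> max 0 C" by (simp add: le_max_iff_disj)
  then show ?thesis using that[of "max 0 C"] by simp
qed

lemma bborel_indicator: "A \<in> sets borel \<Longrightarrow> bborel (indicator A)"
  by (rule bborelI[where C = 1]) (auto simp: indicator_def)

lemma indicator_UN_Suc:
  assumes "disjoint_family A"
  shows "indicator (\<Union>i<Suc k. A i) = (\<lambda>x. 1 * indicator (\<Union>i<k. A i) x + 1 * indicator (A k) x :: real)"
proof -
  have "A i \<inter> A k = {}" if "i < k" for i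
    using disjoint_family_onD[OF assms, of i k] that by simp
  then have "(\<Union>i<k. A i) \<inter> A k = {}" by blast
  then show ?thesis by (auto simp: indicator_def less_Suc_eq fun_eq_iff)
qed

lemma bborel_lincomb:
  assumes "bborel_on S f" "bborel_on S g" shows "bborel_on S (\<lambda>x. a * f x + b * g x)"
proof -
  obtain C D where C: "\<And>x. x \<in> S \<Longrightarrow> \<bar>f x\<bar> \<le> C" and D: "\<And>x. x \<in> S \<Longrightarrow> \<bar>g x\<bar> \<le> D"
    using assms by (metis bborelE)
  note [measurable] = bborel_measurable[OF assms(1)] bborel_measurable[OF assms(2)]
  show ?thesis
  proof (rule bborelI)
    fix x assume x: "x \<in> S"
    have "\<bar>a * f x + b * g x\<bar> \<le> \<bar>a\<bar> * \<bar>f x\<bar> + \<bar>b\<bar> * \<bar>g x\<bar>" by (metis abs_mult abs_triangle_ineq)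
    also have "\<dots> \<le> \<bar>a\<bar> * C + \<bar>b\<bar> * D" by (intro add_mono mult_left_mono C D x) auto
    finally show "\<bar>a * f x + b * g x\<bar> \<le> \<bar>a\<bar> * C + \<bar>b\<bar> * D" .
  qed measurable
qed

lemma bborel_mult:
  assumes "bborel_on S f" "bborel_on S g" shows "bborel_on S (\<lambda>x. f x * g x)"
proof -
  obtain C D where C: "0 \<le> C" "\<And>x. x \<in> S \<Longrightarrow> \<bar>f x\<bar> \<le> C" and D: "\<And>x. x \<in> S \<Longrightarrow> \<bar>g x\<bar> \<le> D"
    using assms by (metis bborelE)
  note [measurable] = bborel_measurable[OF assms(1)] bborel_measurable[OF assms(2)]
  show ?thesis
  proof (rule bborelI)
    show "\<bar>f x * g x\<bar> \<le> C * D" if "x \<in> S" for x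
      unfolding abs_mult by (intro mult_mono C(2) D that C(1)) simp
  qed measurable
qed

lemma bborel_shift: "bborel f \<Longrightarrow> bborel (\<lambda>x. f (c + x))"
  unfolding bborel_on_def by (auto intro: measurable_compose[where g = f and N = borel])

text \<open>Bounded Borel functions are uniform limits of the step functions obtained by rounding the values
down to multiples of a small number.\<close>

lemma bborel_induct [consumes 1, case_names indicator lincomb limit]:
  assumes f: "bborel f"
    and ind: "\<And>A. A \<in> sets borel \<Longrightarrow> P (indicator A)"
    and lin: "\<And>f g a b. bborel f \<Longrightarrow> bborel g \<Longrightarrow> P f \<Longrightarrow> P g \<Longrightarrow> P (\<lambda>x. a * f x + b * g x)"
    and lim: "\<And>F f C. (\<And>i::nat. bborel (F i)) \<Longrightarrow> (\<And>i. P (F i)) \<Longrightarrow> (\<And>i x. \<bar>F i x\<bar> \<le> C) \<Longrightarrow>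
        (\<And>x. (\<lambda>i. F i x) \<longlonglongrightarrow> f x) \<Longrightarrow> bborel f \<Longrightarrow> P f"
  shows "P f"
proof -
  obtain C where C: "\<And>x. \<bar>f x\<bar> \<le> C" using f by (auto simp: bborel_on_def)
  have [measurable]: "f \<in> borel_measurable borel" using f by (simp add: bborel_on_def)
  define F where "F i x = of_int \<lfloor>real (Suc i) * f x\<rfloor> / real (Suc i)" for i :: nat and x
  have step: "bborel (\<lambda>x. \<Sum>m\<in>M. c m * indicator (A m) x) \<and> P (\<lambda>x. \<Sum>m\<in>M. c m * indicator (A m) x)"
    if "finite M" "\<And>m. A m \<in> sets borel" for M :: "int set" and c :: "int \<Rightarrow> real" and A
    using that(1)
  proof induction
    case empty
    have "(\<lambda>x. 0 * indicator UNIV x + 0 * indicator UNIV x) = (\<lambda>x::real. 0::real)" by simp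
    moreover have U: "bborel (indicator UNIV)" "P (indicator UNIV)"
      by (rule bborel_indicator ind, simp only: space_borel[symmetric] sets.top)+
    ultimately show ?case
      using lin[OF U(1) U(1) U(2) U(2), of 0 0] bborel_lincomb[OF U(1) U(1), of 0 0] by simp
  next
    case (insert m M)
    have "bborel (\<lambda>x. c m * indicator (A m) x + 1 * (\<Sum>m\<in>M. c m * indicator (A m) x))"
      "P (\<lambda>x. c m * indicator (A m) x + 1 * (\<Sum>m\<in>M. c m * indicator (A m) x))"
      by (intro lin bborel_lincomb bborel_indicator ind that(2) conjunct1[OF insert.IH] conjunct2[OF insert.IH])+
    then show ?case by (simp only: mult_1_left sum.insert[OF insert.hyps] simp_thms)
  qed
  have near: "\<bar>F i x - f x\<bar> \<le> 1 / real (Suc i)" for i x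
  proof -
    have "F i x - f x = (of_int \<lfloor>real (Suc i) * f x\<rfloor> - real (Suc i) * f x) / real (Suc i)"
      unfolding F_def by (simp add: diff_divide_distrib)
    also have "\<bar>\<dots>\<bar> \<le> 1 / real (Suc i)"
      unfolding abs_divide abs_of_nat by (intro divide_right_mono) linarith+
    finally show ?thesis .
  qed
  have F: "bborel (F i)" "P (F i)" for i
  proof -
    define N where "N = \<lceil>real (Suc i) * C\<rceil> + 1"
    define A where "A m = {x. \<lfloor>real (Suc i) * f x\<rfloor> = m}" for m
    have "F i = (\<lambda>x. \<Sum>m\<in>{-N..N}. (of_int m / real (Suc i)) * indicator (A m) x)"
    proof
      fix x
      let ?m = "\<lfloor>real (Suc i) * f x\<rfloor>"
      have "\<bar>real (Suc i) * f x\<bar> \<le> real (Suc i) * C"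
        unfolding abs_mult abs_of_nat by (intro mult_left_mono C) simp
      then have "?m \<in> {-N..N}" unfolding N_def by (auto simp del: of_nat_Suc) linarith+
      moreover have "(\<Sum>m\<in>{-N..N}. (of_int m / real (Suc i)) * indicator (A m) x)
          = (\<Sum>m\<in>{-N..N}. if m = ?m then of_int m / real (Suc i) else 0)"
        by (rule sum.cong) (auto simp: A_def)
      ultimately show "F i x = (\<Sum>m\<in>{-N..N}. (of_int m / real (Suc i)) * indicator (A m) x)"
        by (simp add: F_def del: of_nat_Suc)
    qed
    moreover have "A m \<in> sets borel" for m unfolding A_def by measurable
    ultimately show "bborel (F i)" "P (F i)" using step[of "{-N..N}" A "\<lambda>m. of_int m / real (Suc i)"] by simp_all
  qed
  show "P f"
  proof (rule lim[of F "C + 1", OF F _ _ f])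
    show "\<bar>F i x\<bar> \<le> C + 1" for i x
    proof -
      have "1 / real (Suc i) \<le> 1" by simp
      then show ?thesis using near[of i x] C[of x] by linarith
    qed
    show "(\<lambda>i. F i x) \<longlonglongrightarrow> f x" for x
    proof (rule Lim_null[THEN iffD2], rule Lim_null_comparison)
      show "\<forall>\<^sub>F i in sequentially. norm (F i x - f x) \<le> 1 / real (Suc i)" using near by simp
      show "(\<lambda>i. 1 / real (Suc i)) \<longlonglongrightarrow> 0" by (rule LIMSEQ_Suc) (rule lim_1_over_n)
    qed
  qed
qed

text \<open>A bounded Borel functional calculus \<open>f \<mapsto> f(T)\<close>, with operators represented by their kernels. Continuity
under bounded pointwise convergence is required of the entries only; the uniform bound upgrades it to weak
continuity of the operators.\<close>

locale kernel_calculus =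
  fixes K :: "(real \<Rightarrow> real) \<Rightarrow> 'i \<Rightarrow> 'i \<Rightarrow> complex"
  assumes kbound_K: "\<And>f C. bborel f \<Longrightarrow> (\<And>x. \<bar>f x\<bar> \<le> C) \<Longrightarrow> kbound C (K f)"
    and K_lincomb: "\<And>f g a b. bborel f \<Longrightarrow> bborel g \<Longrightarrow>
        K (\<lambda>x. a * f x + b * g x) = (\<lambda>p q. of_real a * K f p q + of_real b * K g p q)"
    and K_hermitian: "\<And>f. bborel f \<Longrightarrow> kadj (K f) = K f"
    and K_one: "K (\<lambda>x. 1) = (\<lambda>p q. if p = q then 1 else 0)"
    and K_mult: "\<And>f g u. bborel f \<Longrightarrow> bborel g \<Longrightarrow> u \<in> ell2 \<Longrightarrow> kop (K f) (kop (K g) u) = kop (K (\<lambda>x. f x * g x)) u"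
    and K_limit: "\<And>F f C p q. (\<And>i::nat. bborel (F i)) \<Longrightarrow> bborel f \<Longrightarrow> (\<And>i x. \<bar>F i x\<bar> \<le> C) \<Longrightarrow>
        (\<And>x. (\<lambda>i. F i x) \<longlonglongrightarrow> f x) \<Longrightarrow> (\<lambda>i. K (F i) p q) \<longlonglongrightarrow> K f p q"
begin

definition pvm :: "real set \<Rightarrow> ('i \<Rightarrow> complex) \<Rightarrow> ('i \<Rightarrow> complex)" where
  "pvm A = kop (K (indicator A))"

abbreviation \<mu> :: "('i \<Rightarrow> complex) \<Rightarrow> real measure" where
  "\<mu> \<equiv> spectral_measure pvm"

lemma kbound_ex: assumes "bborel f" obtains C where "kbound C (K f)"
  using assms kbound_K[OF assms] unfolding bborel_on_def by blast

lemma kop_K_ell2: "bborel f \<Longrightarrow> u \<in> ell2 \<Longrightarrow> kop (K f) u \<in> ell2"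
  using kbound_ex kop_bounded(1) by metis

lemma ip_K: "bborel f \<Longrightarrow> u \<in> ell2 \<Longrightarrow> v \<in> ell2 \<Longrightarrow> ip u (kop (K f) v) = ip (kop (K f) u) v"
  using kbound_ex kop_adjoint K_hermitian by metis

lemma kbound_indicator: "A \<in> sets borel \<Longrightarrow> kbound 1 (K (indicator A))"
  by (intro kbound_K bborel_indicator) (auto simp: indicator_def)

lemma kop_K_lincomb:
  assumes "bborel f" "bborel g" "u \<in> ell2"
  shows "kop (K (\<lambda>x. a * f x + b * g x)) u = (\<lambda>p. of_real a * kop (K f) u p + of_real b * kop (K g) u p)"
proof -
  obtain C where C: "kbound C (K f)" using assms(1) by (rule kbound_ex)
  obtain D where D: "kbound D (K g)" using assms(2) by (rule kbound_ex)
  show ?thesis unfolding K_lincomb[OF assms(1,2)] by (rule kop_kernel_lincomb[OF C D assms(3)])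
qed

lemma kop_K_one: "kop (K (\<lambda>x. 1)) u = u"
  unfolding K_one by (rule kop_delta)

lemma kop_K_weak_limit:
  assumes F: "\<And>i::nat. bborel (F i)" and f: "bborel f" and C: "\<And>i x. \<bar>F i x\<bar> \<le> C"
    and lim: "\<And>x. (\<lambda>i. F i x) \<longlonglongrightarrow> f x" and u: "u \<in> ell2" and v: "v \<in> ell2"
  shows "(\<lambda>i. ip v (kop (K (F i)) u)) \<longlonglongrightarrow> ip v (kop (K f) u)"
  by (rule kop_weak_limit[OF kbound_K[OF F C] K_limit[OF F f C lim] v u])

lemma kop_K_pointwise_limit:
  assumes F: "\<And>i::nat. bborel (F i)" and f: "bborel f" and C: "\<And>i x. \<bar>F i x\<bar> \<le> C"
    and lim: "\<And>x. (\<lambda>i. F i x) \<longlonglongrightarrow> f x" and u: "u \<in> ell2"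
  shows "(\<lambda>i. kop (K (F i)) u p) \<longlonglongrightarrow> kop (K f) u p"
  by (rule kop_pointwise_limit[OF kbound_K[OF F C] K_limit[OF F f C lim] u])

lemma kop_K_zero: "u \<in> ell2 \<Longrightarrow> kop (K (\<lambda>x. 0)) u = (\<lambda>p. 0)"
  using kop_K_lincomb[of "indicator UNIV" "indicator UNIV" u 0 0] bborel_indicator[of UNIV] by simp

lemma pvm_idem: "A \<in> sets borel \<Longrightarrow> u \<in> ell2 \<Longrightarrow> pvm A (pvm A u) = pvm A u"
  using K_mult[OF bborel_indicator bborel_indicator, of A A u]
  by (simp add: pvm_def indicator_inter_arith[symmetric])

text \<open>For strong countable additivity, the remainder after \<open>k\<close> sets is the projection of a set \<open>R_k\<close> decreasing to the
empty set, and \<open>\<parallel>E(R_k) u\<parallel>\<^sup>2 = \<langle>u, E(R_k) u\<rangle>\<close> tends to \<open>0\<close> by weak continuity.\<close>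

lemma projection_valued_measure_pvm: "projection_valued_measure pvm"
  unfolding projection_valued_measure_def
proof (intro conjI ballI allI impI)
  fix A :: "real set" and u v :: "'i \<Rightarrow> complex" and a b :: complex
  assume A: "A \<in> sets borel" and u: "u \<in> ell2"
  show "pvm A u \<in> ell2" unfolding pvm_def by (intro kop_K_ell2 bborel_indicator A u)
  show "pvm A (pvm A u) = pvm A u" by (rule pvm_idem[OF A u])
  assume v: "v \<in> ell2"
  show "pvm A (\<lambda>n. a * u n + b * v n) = (\<lambda>n. a * pvm A u n + b * pvm A v n)"
    unfolding pvm_def by (rule kop_lincomb[OF kbound_indicator[OF A] u v])
  show "ip (pvm A u) v = ip u (pvm A v)"
    unfolding pvm_def by (rule ip_K[OF bborel_indicator[OF A] u v, symmetric])
next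
  fix u :: "'i \<Rightarrow> complex" assume u: "u \<in> ell2"
  have "indicator UNIV = (\<lambda>x::real. 1::real)" by (simp add: fun_eq_iff)
  then show "pvm UNIV u = u" by (simp only: pvm_def kop_K_one)
next
  fix A :: "nat \<Rightarrow> real set" and u :: "'i \<Rightarrow> complex"
  assume A: "range A \<subseteq> sets borel" "disjoint_family A" and u: "u \<in> ell2"
  have m: "A i \<in> sets borel" "(\<Union>i. A i) \<in> sets borel" for i using A(1) by auto
  define R where "R k = (\<Union>i. A i) - (\<Union>i<k. A i)" for k
  have fin: "(\<Union>i<k. A i) \<in> sets borel" for k using m(1) by auto
  have Rm: "R k \<in> sets borel" for k unfolding R_def using m(2) fin by auto
  have part: "(\<lambda>n. \<Sum>i<k. pvm (A i) u n) = pvm (\<Union>i<k. A i) u" for k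
  proof (induction k)
    case 0
    have "indicator {} = (\<lambda>x::real. 0::real)" by (simp add: fun_eq_iff)
    then show ?case using kop_K_zero[OF u] by (simp add: pvm_def)
  next
    case (Suc k)
    have "pvm (\<Union>i<Suc k. A i) u = (\<lambda>n. pvm (\<Union>i<k. A i) u n + pvm (A k) u n)"
      unfolding pvm_def indicator_UN_Suc[OF A(2)]
      using kop_K_lincomb[OF bborel_indicator[OF fin] bborel_indicator[OF m(1)] u, of 1 k 1 k] by simp
    then show ?case using fun_cong[OF Suc] by simp
  qed
  have R: "(\<lambda>n. pvm (\<Union>i. A i) u n - (\<Sum>i<k. pvm (A i) u n)) = pvm (R k) u" for k
  proof -
    have "indicator (R k) = (\<lambda>x. 1 * indicator (\<Union>i. A i) x + (-1) * indicator (\<Union>i<k. A i) x :: real)"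
      unfolding R_def by (auto simp: indicator_def fun_eq_iff)
    then have "pvm (R k) u = (\<lambda>n. pvm (\<Union>i. A i) u n - pvm (\<Union>i<k. A i) u n)"
      unfolding pvm_def using kop_K_lincomb[OF bborel_indicator[OF m(2)] bborel_indicator[OF fin] u, of 1 "-1" k] by simp
    then show ?thesis using fun_cong[OF part[of k]] by simp
  qed
  have "(\<lambda>k. ip u (kop (K (indicator (R k))) u)) \<longlonglongrightarrow> ip u (kop (K (\<lambda>x. 0)) u)"
  proof (rule kop_K_weak_limit[OF bborel_indicator[OF Rm], where C = 1])
    show "bborel (\<lambda>x. 0)" by (rule bborelI[where C = 0]) auto
    show "(\<lambda>k. indicator (R k) x :: real) \<longlonglongrightarrow> 0" for x
    proof -
      have "(\<lambda>k. indicator (\<Union>i. A i) x - indicator (\<Union>i<k. A i) x :: real) \<longlonglongrightarrow> indicator (\<Union>i. A i) x - indicator (\<Union>i. A i) x"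
        by (intro tendsto_diff tendsto_const LIMSEQ_indicator_UN)
      moreover have "indicator (R k) x = (indicator (\<Union>i. A i) x - indicator (\<Union>i<k. A i) x :: real)" for k
        unfolding R_def by (auto simp: indicator_def)
      ultimately show ?thesis by simp
    qed
  qed (auto simp: indicator_def u)
  then have "(\<lambda>k. ip u (pvm (R k) u)) \<longlonglongrightarrow> 0" using kop_K_zero[OF u] by (simp add: pvm_def ip_def)
  moreover have "ip u (pvm (R k) u) = complex_of_real ((l2norm (pvm (R k) u))\<^sup>2)" for k
  proof -
    have "ip u (pvm (R k) (pvm (R k) u)) = ip (pvm (R k) u) (pvm (R k) u)"
      unfolding pvm_def by (intro ip_K kop_K_ell2 bborel_indicator Rm u)
    then show ?thesis by (simp only: pvm_idem[OF Rm u] ip_self)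
  qed
  ultimately have "(\<lambda>k. complex_of_real ((l2norm (pvm (R k) u))\<^sup>2)) \<longlonglongrightarrow> complex_of_real 0"
    by (simp only: of_real_0)
  then have "(\<lambda>k. (l2norm (pvm (R k) u))\<^sup>2) \<longlonglongrightarrow> 0"
    by (simp only: tendsto_of_real_iff)
  then have "(\<lambda>k. sqrt ((l2norm (pvm (R k) u))\<^sup>2)) \<longlonglongrightarrow> sqrt 0" by (rule tendsto_real_sqrt)
  then show "(\<lambda>k. l2norm (\<lambda>n. pvm (\<Union>i. A i) u n - (\<Sum>i<k. pvm (A i) u n))) \<longlonglongrightarrow> 0"
    by (simp add: R)
qed

text \<open>Both sides are linear in \<open>f\<close>, agree on indicators and respect bounded pointwise limits.\<close>

lemma spectral_integral:
  assumes u: "u \<in> ell2" and f: "bborel f"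
  shows "complex_of_real (\<integral>x. f x \<partial>\<mu> u) = ip u (kop (K f) u)"
  using f
proof (induction rule: bborel_induct)
  case (indicator A)
  have "pvm A u = kop (K (indicator A)) u" by (simp add: pvm_def)
  then show ?case using measure_spectral_measure[OF projection_valued_measure_pvm indicator u] indicator
    by simp
next
  case (lincomb f g a b)
  interpret finite_measure "\<mu> u"
    by (rule finite_measure_spectral_measure[OF projection_valued_measure_pvm u])
  have int: "integrable (\<mu> u) h" if h: "bborel h" for h
  proof -
    obtain C where "\<And>x. \<bar>h x\<bar> \<le> C" using h by (auto simp: bborel_on_def)
    then show ?thesis by (intro integrable_const_bound[where B = C]) (use h in \<open>auto simp: bborel_on_def\<close>)
  qed
  show ?case
    using lincomb
    by (simp add: int kop_K_lincomb[OF lincomb(1,2) u] ip_lincomb_right[OF u kop_K_ell2[OF lincomb(1) u] kop_K_ell2[OF lincomb(2) u]])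
next
  case (limit F f C)
  interpret finite_measure "\<mu> u"
    by (rule finite_measure_spectral_measure[OF projection_valued_measure_pvm u])
  have "(\<lambda>i. \<integral>x. F i x \<partial>\<mu> u) \<longlonglongrightarrow> (\<integral>x. f x \<partial>\<mu> u)"
  proof (rule integral_dominated_convergence[where w = "\<lambda>_. C"])
    have meas: "h \<in> borel_measurable (\<mu> u)" if "bborel h" for h
      using bborel_measurable[OF that] measurable_cong_sets[OF sets_spectral_measure refl] by blast
    show "f \<in> borel_measurable (\<mu> u)" "\<And>i. F i \<in> borel_measurable (\<mu> u)"
      by (intro meas limit)+
  qed (use limit in auto)
  then have "(\<lambda>i. ip u (kop (K (F i)) u)) \<longlonglongrightarrow> complex_of_real (\<integral>x. f x \<partial>\<mu> u)"
    unfolding limit.IH[symmetric] by (rule tendsto_of_real)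
  moreover have "(\<lambda>i. ip u (kop (K (F i)) u)) \<longlonglongrightarrow> ip u (kop (K f) u)"
    by (rule kop_K_weak_limit[where C = C, OF _ _ _ _ u u]) (use limit in blast)+
  ultimately show ?case by (rule LIMSEQ_unique)
qed

text \<open>Let \<open>\<chi>_N\<close> be the indicator of \<open>[-N, N]\<close>. For every \<open>u\<close>, the second moment of the spectral measure over \<open>[-N, N]\<close>
is \<open>\<parallel>(x \<chi>_N)(T) u\<parallel>\<^sup>2\<close>. If \<open>u\<close> is in the domain, this equals \<open>\<parallel>\<chi>_N(T) T u\<parallel>\<^sup>2\<close> and is bounded by \<open>\<parallel>T u\<parallel>\<^sup>2\<close>, so
the second moment is finite by monotone convergence. Conversely, a finite second moment bounds
\<open>T (\<chi>_N(T) u) = (x \<chi>_N)(T) u\<close>, which converges pointwise to \<open>T u\<close>, so that \<open>T u\<close> is square summable.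
The first moment is the limit of \<open>\<langle>u, \<chi>_N(T) T u\<rangle>\<close>.\<close>

lemma spectral_resolution_pvm:
  assumes D: "D = {u \<in> ell2. T u \<in> ell2}"
    and TK: "\<And>f u. bborel f \<Longrightarrow> bborel (\<lambda>x. x * f x) \<Longrightarrow> u \<in> ell2 \<Longrightarrow> T (kop (K f) u) = kop (K (\<lambda>x. x * f x)) u"
    and KT: "\<And>f u. bborel f \<Longrightarrow> bborel (\<lambda>x. x * f x) \<Longrightarrow> u \<in> D \<Longrightarrow> kop (K f) (T u) = kop (K (\<lambda>x. x * f x)) u"
    and T_limit: "\<And>w u p. (\<And>p. (\<lambda>i::nat. w i p) \<longlonglongrightarrow> u p) \<Longrightarrow> (\<lambda>i. T (w i) p) \<longlonglongrightarrow> T u p"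
  shows "spectral_resolution D T pvm"
proof -
  define cut :: "nat \<Rightarrow> real \<Rightarrow> real" where "cut N = indicator {- real N..real N}" for N
  have cut: "bborel (cut N)" for N unfolding cut_def by (rule bborel_indicator) simp
  have xcut: "bborel (\<lambda>x. x * cut N x)" for N
    unfolding cut_def by (rule bborelI[where C = "real N"]) (auto simp: indicator_def)
  have x2cut: "bborel (\<lambda>x. x\<^sup>2 * cut N x)" for N
  proof -
    have "(\<lambda>x. (x * cut N x) * (x * cut N x)) = (\<lambda>x. x\<^sup>2 * cut N x)"
      by (auto simp: cut_def indicator_def power2_eq_square)
    then show ?thesis using bborel_mult[OF xcut[of N] xcut[of N]] by simp
  qed
  have cut_bound: "\<bar>cut N x\<bar> \<le> 1" for N x by (simp add: cut_def indicator_def)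
  have cut_lim: "(\<lambda>N. cut N x) \<longlonglongrightarrow> 1" for x
  proof -
    obtain M :: nat where M: "\<bar>x\<bar> \<le> real M" using real_arch_simple by blast
    have "cut N x = 1" if "M \<le> N" for N
      using M that by (auto simp: cut_def indicator_def abs_le_iff)
    then have "\<forall>\<^sub>F N in sequentially. cut N x = 1" by (auto simp: eventually_sequentially)
    then show ?thesis by (rule tendsto_eventually)
  qed
  have one: "bborel (\<lambda>x. 1)" by (rule bborelI[where C = 1]) auto
  have second: "complex_of_real (\<integral>x. x\<^sup>2 * cut N x \<partial>\<mu> u) = complex_of_real ((l2norm (kop (K (\<lambda>x. x * cut N x)) u))\<^sup>2)"
    if u: "u \<in> ell2" for N u
  proof -
    have "(\<lambda>x. (x * cut N x) * (x * cut N x)) = (\<lambda>x. x\<^sup>2 * cut N x)"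
      by (auto simp: cut_def indicator_def power2_eq_square)
    then have "kop (K (\<lambda>x. x\<^sup>2 * cut N x)) u = kop (K (\<lambda>x. x * cut N x)) (kop (K (\<lambda>x. x * cut N x)) u)"
      using K_mult[OF xcut xcut u, of N N] by simp
    then show ?thesis
      unfolding spectral_integral[OF u x2cut]
      by (simp only: ip_K[OF xcut u kop_K_ell2[OF xcut u]] ip_self)
  qed
  have meas: "(\<lambda>x. x\<^sup>2) \<in> borel_measurable (\<mu> u)" for u by measurable
  have cutm [measurable]: "cut N \<in> borel_measurable borel" for N using cut by (rule bborel_measurable)
  have in_D: "integrable (\<mu> u) (\<lambda>x. x\<^sup>2)" if u: "u \<in> D" for u
  proof -
    have ue: "u \<in> ell2" and Tu: "T u \<in> ell2" using u D by auto
    interpret finite_measure "\<mu> u"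
      by (rule finite_measure_spectral_measure[OF projection_valued_measure_pvm ue])
    have b: "(\<integral>\<^sup>+x. ennreal (x\<^sup>2 * cut N x) \<partial>\<mu> u) \<le> ennreal ((l2norm (T u))\<^sup>2)" for N
    proof -
      have "integrable (\<mu> u) (\<lambda>x. x\<^sup>2 * cut N x)"
        by (rule integrable_const_bound[where B = "(real N)\<^sup>2"])
           (auto simp: cut_def indicator_def abs_le_square_iff[symmetric] abs_le_iff)
      then have "(\<integral>\<^sup>+x. ennreal (x\<^sup>2 * cut N x) \<partial>\<mu> u) = ennreal (\<integral>x. x\<^sup>2 * cut N x \<partial>\<mu> u)"
        by (rule nn_integral_eq_integral) (simp add: cut_def)
      also have "(\<integral>x. x\<^sup>2 * cut N x \<partial>\<mu> u) = (l2norm (kop (K (cut N)) (T u)))\<^sup>2"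
        using second[OF ue] KT[OF cut xcut u, of N] unfolding of_real_eq_iff by simp
      also have "\<dots> \<le> (l2norm (T u))\<^sup>2"
        using kop_bounded(2)[OF kbound_K[OF cut cut_bound] Tu, of N] by (intro power_mono) auto
      finally show ?thesis by (simp add: ennreal_leI)
    qed
    have "(\<lambda>N. \<integral>\<^sup>+x. ennreal (x\<^sup>2 * cut N x) \<partial>\<mu> u) \<longlonglongrightarrow> (\<integral>\<^sup>+x. ennreal (x\<^sup>2) \<partial>\<mu> u)"
    proof (rule nn_integral_LIMSEQ)
      show "incseq (\<lambda>N x. ennreal (x\<^sup>2 * cut N x))"
        by (auto simp: incseq_def le_fun_def cut_def indicator_def intro!: ennreal_leI)
      show "(\<lambda>N. ennreal (x\<^sup>2 * cut N x)) \<longlonglongrightarrow> ennreal (x\<^sup>2)" for x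
        using tendsto_mult_left[OF cut_lim, of "x\<^sup>2" x] by (intro tendsto_ennrealI) simp
    qed simp
    then have "(\<integral>\<^sup>+x. ennreal (x\<^sup>2) \<partial>\<mu> u) \<le> ennreal ((l2norm (T u))\<^sup>2)"
      by (rule LIMSEQ_le_const2) (use b in blast)
    also have "\<dots> < \<infinity>" by simp
    finally show ?thesis by (intro integrableI_bounded meas) simp
  qed
  have of_D: "u \<in> D" if ue: "u \<in> ell2" and int: "integrable (\<mu> u) (\<lambda>x. x\<^sup>2)" for u
  proof -
    define c where "c = (\<integral>x. x\<^sup>2 \<partial>\<mu> u)"
    have b: "l2norm (kop (K (\<lambda>x. x * cut N x)) u) \<le> sqrt c" for N
    proof (rule real_le_rsqrt)
      have "(l2norm (kop (K (\<lambda>x. x * cut N x)) u))\<^sup>2 = (\<integral>x. x\<^sup>2 * cut N x \<partial>\<mu> u)"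
        using second[OF ue] unfolding of_real_eq_iff by simp
      also have "\<dots> \<le> c" unfolding c_def
      proof (rule integral_mono[OF _ int])
        show "integrable (\<mu> u) (\<lambda>x. x\<^sup>2 * cut N x)"
          by (rule Bochner_Integration.integrable_bound[OF int]) (auto simp: cut_def indicator_def)
      qed (simp add: cut_def indicator_def)
      finally show "(l2norm (kop (K (\<lambda>x. x * cut N x)) u))\<^sup>2 \<le> c" .
    qed
    have "(\<lambda>N. T (kop (K (cut N)) u) p) \<longlonglongrightarrow> T u p" for p
      using kop_K_pointwise_limit[OF cut one cut_bound cut_lim ue] unfolding kop_K_one by (rule T_limit)
    then have "T u \<in> ell2"
      unfolding TK[OF cut xcut ue] by (intro l2norm_le_of_pointwise_limit(1)[OF kop_K_ell2[OF xcut ue] b])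
    then show ?thesis using ue D by simp
  qed
  have first: "T u \<in> ell2 \<and> ip u (T u) = complex_of_real (\<integral>x. x \<partial>\<mu> u)" if u: "u \<in> D" for u
  proof -
    have ue: "u \<in> ell2" and Tu: "T u \<in> ell2" using u D by auto
    interpret finite_measure "\<mu> u"
      by (rule finite_measure_spectral_measure[OF projection_valued_measure_pvm ue])
    have int: "integrable (\<mu> u) (\<lambda>x. 1 + x\<^sup>2)" using in_D[OF u] by simp
    have le: "\<bar>x\<bar> \<le> 1 + x\<^sup>2" for x :: real
    proof -
      have "2 * \<bar>x\<bar> \<le> 1 + x\<^sup>2" using sum_squares_bound[of 1 "\<bar>x\<bar>"] by simp
      then show ?thesis using abs_ge_zero[of x] by linarith
    qed
    have "(\<lambda>N. \<integral>x. x * cut N x \<partial>\<mu> u) \<longlonglongrightarrow> (\<integral>x. x \<partial>\<mu> u)"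
    proof (rule integral_dominated_convergence[OF _ _ int])
      show "AE x in \<mu> u. (\<lambda>N. x * cut N x) \<longlonglongrightarrow> x"
        using tendsto_mult_left[OF cut_lim] by (intro AE_I2) fastforce
      show "AE x in \<mu> u. norm (x * cut N x) \<le> 1 + x\<^sup>2" for N
        using le by (intro AE_I2) (auto simp: cut_def indicator_def intro: add_nonneg_nonneg)
    qed measurable
    then have "(\<lambda>N. ip u (kop (K (cut N)) (T u))) \<longlonglongrightarrow> complex_of_real (\<integral>x. x \<partial>\<mu> u)"
      unfolding KT[OF cut xcut u] spectral_integral[OF ue xcut, symmetric] by (rule tendsto_of_real)
    moreover have "(\<lambda>N. ip u (kop (K (cut N)) (T u))) \<longlonglongrightarrow> ip u (T u)"
      using kop_K_weak_limit[OF cut one cut_bound cut_lim Tu ue] unfolding kop_K_one .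
    ultimately show ?thesis using Tu LIMSEQ_unique by blast
  qed
  show ?thesis
    unfolding spectral_resolution_def using projection_valued_measure_pvm first in_D of_D D by blast
qed

end

section \<open>Toeplitz functional calculus of the one-dimensional hopping operator\<close>

text \<open>Normalised Lebesgue measure on \<open>[-\<pi>, \<pi>]\<close>, as a measure on the whole line.\<close>

definition circle :: "real measure" where
  "circle = density lborel (\<lambda>t. ennreal (indicator {- pi..pi} t / (2 * pi)))"

lemma sets_circle [simp, measurable_cong]: "sets circle = sets borel" and space_circle [simp]: "space circle = UNIV"
  by (simp_all add: circle_def)

lemma finite_measure_circle: "finite_measure circle"
proof
  have "emeasure circle (space circle) = (\<integral>\<^sup>+ t. ennreal (1 / (2 * pi)) * indicator {- pi..pi} t \<partial>lborel)"
    unfolding circle_def by (simp add: emeasure_density) (rule nn_integral_cong, auto simp: indicator_def)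
  also have "\<dots> = ennreal (1 / (2 * pi)) * emeasure lborel {- pi..pi}"
    by (rule nn_integral_cmult_indicator) simp
  also have "\<dots> < \<infinity>" by (simp add: ennreal_mult_less_top)
  finally show "emeasure circle (space circle) \<noteq> \<infinity>" by simp
qed

interpretation circle: finite_measure circle by (rule finite_measure_circle)

lemma integral_circle:
  fixes f :: "real \<Rightarrow> complex"
  assumes "f \<in> borel_measurable borel"
  shows "integral\<^sup>L circle f = (1 / (2 * pi)) *\<^sub>R (\<integral>t. indicator {- pi..pi} t *\<^sub>R f t \<partial>lborel)"
  unfolding circle_def
  by (subst integral_density) (use assms in \<open>auto simp flip: integral_scaleR_right\<close>)

lemma integral_cis_circle: "(\<integral>t. cis (of_int n * t) \<partial>circle) = (if n = 0 then 1 else 0)"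
proof (cases "n = 0")
  case True
  have "(\<integral>t. indicator {- pi..pi} t *\<^sub>R (1::complex) \<partial>lborel) = complex_of_real (2 * pi)"
    by (simp add: scaleR_conv_of_real)
  moreover have "(\<integral>t. (1::complex) \<partial>circle) = (1 / (2 * pi)) *\<^sub>R (\<integral>t. indicator {- pi..pi} t *\<^sub>R 1 \<partial>lborel)"
    by (rule integral_circle) simp
  ultimately have "(\<integral>t. (1::complex) \<partial>circle) = 1" by (simp only:) (simp add: scaleR_conv_of_real)
  then show ?thesis using True by simp
next
  case False
  define F where "F t = cis (of_int n * t) / (\<i> * of_int n)" for t
  have "(\<integral>t. indicator {- pi..pi} t *\<^sub>R cis (of_int n * t) \<partial>lborel) = F pi - F (- pi)"
  proof (rule integral_FTC_Icc)
    fix t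
    have "((\<lambda>t. exp (\<i> * of_int n * complex_of_real t) / (\<i> * of_int n)) has_vector_derivative exp (\<i> * of_int n * complex_of_real t)) (at t within {- pi..pi})"
      by (rule has_vector_derivative_real_field) (use False in \<open>auto intro!: derivative_eq_intros\<close>)
    then show "(F has_vector_derivative cis (of_int n * t)) (at t within {- pi..pi})"
      unfolding F_def cis_conv_exp by (simp add: mult_ac)
  qed (auto intro!: continuous_intros)
  also have "\<dots> = 0"
  proof -
    have "cis (of_int n * pi) = cis (- (of_int n * pi)) * cis (2 * pi * of_int n)"
      unfolding cis_mult by (rule arg_cong[of _ _ cis]) simp
    moreover have "cis (2 * pi * of_int n) = 1" by (rule cis_multiple_2pi) simp
    ultimately show ?thesis by (simp add: F_def)
  qed
  finally have "(\<integral>t. indicator {- pi..pi} t *\<^sub>R cis (of_int n * t) \<partial>lborel) = 0" .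
  moreover have "(\<lambda>t. cis (of_int n * t)) \<in> borel_measurable borel"
    by (intro borel_measurable_continuous_onI continuous_intros)
  ultimately show ?thesis using False by (simp only: integral_circle) simp
qed

lemma measurable_cis_mult [measurable]: "(\<lambda>t. cis (c * t)) \<in> borel_measurable borel"
  by (intro borel_measurable_continuous_onI continuous_intros)

definition two_cos :: "real \<Rightarrow> real" where "two_cos t = 2 * cos t"

lemma two_cos_range: "two_cos t \<in> {-2..2}"
  using cos_le_one[of t] cos_ge_minus_one[of t] unfolding two_cos_def atLeastAtMost_iff by linarith

lemma two_cos_measurable [measurable]: "two_cos \<in> borel_measurable borel"
  unfolding two_cos_def[abs_def] by measurable

abbreviation bounded_symbol :: "(real \<Rightarrow> real) \<Rightarrow> bool" where "bounded_symbol \<equiv> bborel_on {-2..2}"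

text \<open>The Fourier coefficients of \<open>f(2 cos t)\<close>.\<close>

definition symbol_coeff :: "(real \<Rightarrow> real) \<Rightarrow> int \<Rightarrow> complex" where
  "symbol_coeff f n = (\<integral>t. complex_of_real (f (two_cos t)) * cis (of_int n * t) \<partial>circle)"

text \<open>The kernel of \<open>f(S + S\<inverse>)\<close>, where \<open>S\<close> is the shift on \<open>\<ell>\<^sup>2(\<int>)\<close>.\<close>

definition toeplitz :: "(real \<Rightarrow> real) \<Rightarrow> int \<Rightarrow> int \<Rightarrow> complex" where
  "toeplitz f p q = symbol_coeff f (p - q)"

lemma bborel_bounded_symbol: "bborel f \<Longrightarrow> bounded_symbol f"
  by (auto simp: bborel_on_def)

lemma bounded_symbol_continuous:
  assumes "continuous_on UNIV f" shows "bounded_symbol f"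
proof -
  have "compact (f ` {-2..2})"
    by (intro compact_continuous_image continuous_on_subset[OF assms]) auto
  then obtain C where "\<And>x. x \<in> {-2..2} \<Longrightarrow> norm (f x) \<le> C"
    using compact_imp_bounded bounded_iff by (metis imageI)
  then show ?thesis
    by (intro bborelI[where C = C] borel_measurable_continuous_onI assms) auto
qed

lemma circle_integrable:
  fixes h :: "real \<Rightarrow> complex"
  assumes "h \<in> borel_measurable borel" "\<And>t. cmod (h t) \<le> C"
  shows "integrable circle h"
  by (rule circle.integrable_const_bound[where B = C]) (use assms in auto)

lemma symbol_integrable:
  assumes f: "bounded_symbol f" and h: "h \<in> borel_measurable borel" "\<And>t. cmod (h t) \<le> D"
  shows "integrable circle (\<lambda>t. complex_of_real (f (two_cos t)) * h t)"
proof -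
  obtain C where C: "0 \<le> C" "\<And>x. x \<in> {-2..2} \<Longrightarrow> \<bar>f x\<bar> \<le> C" using bborelE[OF f] by blast
  have [measurable]: "f \<in> borel_measurable borel" "h \<in> borel_measurable borel"
    by (rule bborel_measurable[OF f] h)+
  show ?thesis
  proof (rule circle_integrable)
    show "cmod (complex_of_real (f (two_cos t)) * h t) \<le> C * D" for t
      unfolding norm_mult norm_of_real by (rule mult_mono) (use C h(2) two_cos_range in auto)
  qed measurable
qed

lemma symbol_coeff_integrable:
  "bounded_symbol f \<Longrightarrow> integrable circle (\<lambda>t. complex_of_real (f (two_cos t)) * cis (of_int n * t))"
  by (rule symbol_integrable[where D = 1]) auto

lemma cnj_symbol_coeff: "cnj (symbol_coeff f n) = symbol_coeff f (- n)"
  unfolding symbol_coeff_def Bochner_Integration.integral_cnj[symmetric]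
  by (simp add: cis_cnj del: Bochner_Integration.integral_cnj)

lemma symbol_coeff_lincomb:
  assumes "bounded_symbol f" "bounded_symbol g"
  shows "symbol_coeff (\<lambda>x. a * f x + b * g x) n = of_real a * symbol_coeff f n + of_real b * symbol_coeff g n"
proof -
  have "symbol_coeff (\<lambda>x. a * f x + b * g x) n = (\<integral>t. of_real a * (complex_of_real (f (two_cos t)) * cis (of_int n * t))
      + of_real b * (complex_of_real (g (two_cos t)) * cis (of_int n * t)) \<partial>circle)"
    unfolding symbol_coeff_def by (rule Bochner_Integration.integral_cong) (simp_all add: algebra_simps)
  also have "\<dots> = of_real a * symbol_coeff f n + of_real b * symbol_coeff g n"
    unfolding symbol_coeff_def
    by (subst Bochner_Integration.integral_add)
       (simp_all add: symbol_coeff_integrable assms)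
  finally show ?thesis .
qed

lemma symbol_coeff_1: "symbol_coeff (\<lambda>x. 1) n = (if n = 0 then 1 else 0)"
  by (simp add: symbol_coeff_def integral_cis_circle)

text \<open>This is \<open>2 cos t = e\<^sup>i\<^sup>t + e\<^sup>-\<^sup>i\<^sup>t\<close>.\<close>

lemma symbol_coeff_mult_id:
  assumes "bounded_symbol f"
  shows "symbol_coeff (\<lambda>x. x * f x) n = symbol_coeff f (n + 1) + symbol_coeff f (n - 1)"
proof -
  have cis: "complex_of_real (two_cos t) * cis (of_int n * t) = cis (of_int (n + 1) * t) + cis (of_int (n - 1) * t)" for t
  proof -
    have "complex_of_real (two_cos t) = cis t + cis (- t)" by (simp add: two_cos_def complex_eq_iff)
    then show ?thesis by (simp add: distrib_right cis_mult algebra_simps)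
  qed
  have "symbol_coeff (\<lambda>x. x * f x) n = (\<integral>t. complex_of_real (f (two_cos t)) * cis (of_int (n + 1) * t)
      + complex_of_real (f (two_cos t)) * cis (of_int (n - 1) * t) \<partial>circle)"
    unfolding symbol_coeff_def distrib_left[symmetric] cis[symmetric]
    by (rule Bochner_Integration.integral_cong) (simp_all add: mult_ac)
  also have "\<dots> = symbol_coeff f (n + 1) + symbol_coeff f (n - 1)"
    unfolding symbol_coeff_def
    by (rule Bochner_Integration.integral_add) (rule symbol_coeff_integrable[OF assms])+
  finally show ?thesis .
qed

lemma symbol_coeff_limit:
  assumes F: "\<And>i::nat. bounded_symbol (F i)" and f: "bounded_symbol f"
    and C: "\<And>i x. x \<in> {-2..2} \<Longrightarrow> \<bar>F i x\<bar> \<le> C" and lim: "\<And>x. x \<in> {-2..2} \<Longrightarrow> (\<lambda>i. F i x) \<longlonglongrightarrow> f x"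
  shows "(\<lambda>i. symbol_coeff (F i) n) \<longlonglongrightarrow> symbol_coeff f n"
  unfolding symbol_coeff_def
proof (rule integral_dominated_convergence[where w = "\<lambda>_. C"])
  have [measurable]: "f \<in> borel_measurable borel" "\<And>i. F i \<in> borel_measurable borel"
    by (rule bborel_measurable[OF f] bborel_measurable[OF F])+
  show "(\<lambda>t. complex_of_real (f (two_cos t)) * cis (of_int n * t)) \<in> borel_measurable circle"
    "\<And>i. (\<lambda>t. complex_of_real (F i (two_cos t)) * cis (of_int n * t)) \<in> borel_measurable circle"
    by measurable
  show "AE t in circle. (\<lambda>i. complex_of_real (F i (two_cos t)) * cis (of_int n * t)) \<longlonglongrightarrow> complex_of_real (f (two_cos t)) * cis (of_int n * t)"
    by (intro AE_I2 tendsto_mult tendsto_of_real tendsto_const lim two_cos_range)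
  show "\<And>i. AE t in circle. cmod (complex_of_real (F i (two_cos t)) * cis (of_int n * t)) \<le> C"
    by (intro AE_I2) (simp add: norm_mult C[OF two_cos_range])
qed simp

text \<open>Parseval's identity for trigonometric polynomials, which only uses orthonormality of the characters.\<close>

lemma trig_poly_parseval:
  assumes "finite G"
  shows "(\<integral>t. complex_of_real ((cmod (\<Sum>q\<in>G. u q * cis (- (of_int q * t))))\<^sup>2) \<partial>circle) = complex_of_real (sqsum G u)"
proof -
  have int: "integrable circle (\<lambda>t. c * cis (of_int n * t))" for c n
    by (rule circle_integrable[where C = "cmod c"]) (auto simp: norm_mult)
  have "complex_of_real ((cmod (\<Sum>q\<in>G. u q * cis (- (of_int q * t))))\<^sup>2)
      = (\<Sum>q\<in>G. \<Sum>q'\<in>G. (u q * cnj (u q')) * cis (of_int (q' - q) * t))" for t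
  proof -
    have "complex_of_real ((cmod (\<Sum>q\<in>G. u q * cis (- (of_int q * t))))\<^sup>2)
      = (\<Sum>q\<in>G. \<Sum>q'\<in>G. (u q * cis (- (of_int q * t))) * (cnj (u q') * cis (of_int q' * t)))"
      by (simp add: complex_norm_square sum_product cis_cnj del: of_real_power)
    moreover have "(u q * cis (- (of_int q * t))) * (cnj (u q') * cis (of_int q' * t)) = (u q * cnj (u q')) * cis (of_int (q' - q) * t)" for q q'
    proof -
      have "cis (- (of_int q * t)) * cis (of_int q' * t) = cis (of_int (q' - q) * t)"
        by (simp add: cis_mult algebra_simps)
      then show ?thesis by (metis (no_types, lifting) mult.assoc mult.left_commute)
    qed
    ultimately show ?thesis by (simp only:)
  qed
  then have "(\<integral>t. complex_of_real ((cmod (\<Sum>q\<in>G. u q * cis (- (of_int q * t))))\<^sup>2) \<partial>circle)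
      = (\<Sum>q\<in>G. \<Sum>q'\<in>G. (u q * cnj (u q')) * (\<integral>t. cis (of_int (q' - q) * t) \<partial>circle))"
    by (simp add: Bochner_Integration.integral_sum int del: of_int_diff)
  also have "\<dots> = (\<Sum>q\<in>G. \<Sum>q'\<in>G. if q' = q then u q * cnj (u q) else 0)"
    unfolding integral_cis_circle by (intro sum.cong refl) auto
  also have "\<dots> = (\<Sum>q\<in>G. u q * cnj (u q))" using assms by simp
  finally show ?thesis by (simp add: complex_norm_square del: of_real_power)
qed

text \<open>For finitely supported \<open>u\<close> and \<open>v\<close> with Fourier sums \<open>U\<close> and \<open>V\<close>, the sesquilinear form of the kernel is the integral of
\<open>f(2 cos t) V\<^sup>* U\<close>, which is at most \<open>C\<close> times the mean of the squared norms of \<open>U\<close> and \<open>V\<close>.\<close>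

lemma kbound_toeplitz:
  assumes f: "bounded_symbol f" and C: "\<And>x. x \<in> {-2..2} \<Longrightarrow> \<bar>f x\<bar> \<le> C"
  shows "kbound C (toeplitz f)"
proof -
  have C0: "0 \<le> C" using C[of 0] by auto
  have "cmod (kform F G v (toeplitz f) u)
       \<le> C * (sqsum F v + sqsum G u) / 2" if F: "finite F" and G: "finite G" for F G u v
  proof -
    define V where "V t = (\<Sum>p\<in>F. v p * cis (- (of_int p * t)))" for t
    define U where "U t = (\<Sum>q\<in>G. u q * cis (- (of_int q * t)))" for t
    have m: "U \<in> borel_measurable borel" "V \<in> borel_measurable borel"
      unfolding U_def[abs_def] V_def[abs_def] by (intro borel_measurable_continuous_onI continuous_intros)+
    have mVU: "(\<lambda>t. cnj (V t) * U t) \<in> borel_measurable borel"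
      unfolding U_def[abs_def] V_def[abs_def] by (intro borel_measurable_continuous_onI continuous_intros)
    note [measurable] = m
    have bU: "cmod (U t) \<le> (\<Sum>q\<in>G. cmod (u q))" for t
      unfolding U_def by (rule order_trans[OF norm_sum]) (simp add: norm_mult)
    have bV: "cmod (V t) \<le> (\<Sum>q\<in>F. cmod (v q))" for t
      unfolding V_def by (rule order_trans[OF norm_sum]) (simp add: norm_mult)
    have int: "integrable circle (\<lambda>t. c * (complex_of_real (f (two_cos t)) * cis (of_int n * t)))" for c n
      using symbol_coeff_integrable[OF f] by simp
    have "complex_of_real (f (two_cos t)) * (cnj (V t) * U t)
        = (\<Sum>p\<in>F. \<Sum>q\<in>G. (cnj (v p) * u q) * (complex_of_real (f (two_cos t)) * cis (of_int (p - q) * t)))" for t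
    proof -
      have "cnj (V t) * U t = (\<Sum>p\<in>F. \<Sum>q\<in>G. (cnj (v p) * cis (of_int p * t)) * (u q * cis (- (of_int q * t))))"
        by (simp add: U_def V_def sum_product cis_cnj)
      moreover have "(cnj (v p) * cis (of_int p * t)) * (u q * cis (- (of_int q * t))) = cnj (v p) * u q * cis (of_int (p - q) * t)" for p q
      proof -
        have "cis (of_int p * t) * cis (- (of_int q * t)) = cis (of_int (p - q) * t)"
          by (simp add: cis_mult algebra_simps)
        then show ?thesis by (metis (no_types, lifting) mult.assoc mult.left_commute)
      qed
      ultimately have "cnj (V t) * U t = (\<Sum>p\<in>F. \<Sum>q\<in>G. cnj (v p) * u q * cis (of_int (p - q) * t))"
        by (simp only:)
      then show ?thesis by (simp add: sum_distrib_left mult_ac)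
    qed
    then have "(\<integral>t. complex_of_real (f (two_cos t)) * (cnj (V t) * U t) \<partial>circle)
        = (\<Sum>p\<in>F. \<Sum>q\<in>G. (cnj (v p) * u q) * symbol_coeff f (p - q))"
      using int unfolding symbol_coeff_def
      by (simp add: Bochner_Integration.integral_sum symbol_coeff_integrable[OF f] del: of_int_diff)
    then have eq: "kform F G v (toeplitz f) u = (\<integral>t. complex_of_real (f (two_cos t)) * (cnj (V t) * U t) \<partial>circle)"
      by (simp add: toeplitz_def mult_ac)
    have iU: "integrable circle (\<lambda>t. (cmod (U t))\<^sup>2)" and iV: "integrable circle (\<lambda>t. (cmod (V t))\<^sup>2)"
      by (rule circle.integrable_const_bound[where B = "(\<Sum>q\<in>G. cmod (u q))\<^sup>2"],
          use bU in \<open>auto intro!: power_mono\<close>)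
         (rule circle.integrable_const_bound[where B = "(\<Sum>q\<in>F. cmod (v q))\<^sup>2"],
          use bV in \<open>auto intro!: power_mono\<close>)
    have "cmod (kform F G v (toeplitz f) u) \<le> (\<integral>t. C / 2 * ((cmod (V t))\<^sup>2 + (cmod (U t))\<^sup>2) \<partial>circle)"
      unfolding eq
    proof (rule order_trans[OF integral_norm_bound], rule integral_mono)
      show "integrable circle (\<lambda>t. C / 2 * ((cmod (V t))\<^sup>2 + (cmod (U t))\<^sup>2))" using iU iV by simp
      show "integrable circle (\<lambda>t. cmod (complex_of_real (f (two_cos t)) * (cnj (V t) * U t)))"
      proof (rule integrable_norm, rule symbol_integrable[OF f mVU])
        show "cmod (cnj (V t) * U t) \<le> (\<Sum>q\<in>F. cmod (v q)) * (\<Sum>q\<in>G. cmod (u q))" for t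
          unfolding norm_mult complex_mod_cnj by (rule mult_mono[OF bV bU]) (auto intro: sum_nonneg)
      qed
      fix t
      have "cmod (V t) * cmod (U t) \<le> ((cmod (V t))\<^sup>2 + (cmod (U t))\<^sup>2) / 2"
        using sum_squares_bound[of "cmod (V t)" "cmod (U t)"] by simp
      then have "\<bar>f (two_cos t)\<bar> * (cmod (V t) * cmod (U t)) \<le> C * (((cmod (V t))\<^sup>2 + (cmod (U t))\<^sup>2) / 2)"
        by (intro mult_mono C[OF two_cos_range] C0) auto
      then show "cmod (complex_of_real (f (two_cos t)) * (cnj (V t) * U t)) \<le> C / 2 * ((cmod (V t))\<^sup>2 + (cmod (U t))\<^sup>2)"
        by (simp add: norm_mult)
    qed
    also have "\<dots> = C / 2 * ((\<integral>t. (cmod (V t))\<^sup>2 \<partial>circle) + (\<integral>t. (cmod (U t))\<^sup>2 \<partial>circle))"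
      using iU iV by simp
    also have "(\<integral>t. (cmod (V t))\<^sup>2 \<partial>circle) = sqsum F v"
      using trig_poly_parseval[OF F, of v] unfolding V_def[symmetric] integral_complex_of_real of_real_eq_iff .
    also have "(\<integral>t. (cmod (U t))\<^sup>2 \<partial>circle) = sqsum G u"
      using trig_poly_parseval[OF G, of u] unfolding U_def[symmetric] integral_complex_of_real of_real_eq_iff .
    finally show ?thesis by simp
  qed
  then show ?thesis using C0 by (simp only: kbound_def) blast
qed

lemma kbound_toeplitz_ex:
  assumes "bounded_symbol f" obtains C where "kbound C (toeplitz f)"
proof -
  obtain C where "\<And>x. x \<in> {-2..2} \<Longrightarrow> \<bar>f x\<bar> \<le> C" using bborelE[OF assms] by blast
  then show ?thesis using kbound_toeplitz[OF assms] that by blast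
qed

lemma symbol_coeff_ell2:
  assumes "bounded_symbol f" shows "symbol_coeff f \<in> ell2"
proof -
  obtain C where "kbound C (toeplitz f)" using assms by (rule kbound_toeplitz_ex)
  then have "(\<lambda>p. toeplitz f p 0) \<in> ell2" by (rule kbound_column)
  then show ?thesis by (simp add: toeplitz_def)
qed

text \<open>The product law \<open>f(\<Delta>) g(\<Delta>) = (f g)(\<Delta>)\<close> for all \<open>g\<close>, tested on the column of index \<open>0\<close>, which determines a Toeplitz
kernel. Quantifying over \<open>g\<close> lets \<open>f\<close> run through an induction.\<close>

definition functional_law :: "(real \<Rightarrow> real) \<Rightarrow> bool" where
  "functional_law f \<longleftrightarrow> bounded_symbol f \<and>
     (\<forall>g. bounded_symbol g \<longrightarrow> kop (toeplitz f) (symbol_coeff g) = symbol_coeff (\<lambda>x. f x * g x))"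

lemma functional_law_1: "functional_law (\<lambda>x. 1)"
proof -
  have "toeplitz (\<lambda>x. 1) = (\<lambda>p q. if p = q then 1 else 0)"
    by (simp add: toeplitz_def symbol_coeff_1 fun_eq_iff)
  then show ?thesis
    by (simp add: functional_law_def kop_delta bounded_symbol_continuous)
qed

lemma functional_law_lincomb:
  assumes "functional_law f" "functional_law g"
  shows "functional_law (\<lambda>x. a * f x + b * g x)"
proof -
  have f: "bounded_symbol f" and g: "bounded_symbol g" using assms by (simp_all add: functional_law_def)
  obtain C where C: "kbound C (toeplitz f)" using f by (rule kbound_toeplitz_ex)
  obtain D where D: "kbound D (toeplitz g)" using g by (rule kbound_toeplitz_ex)
  have "kop (toeplitz (\<lambda>x. a * f x + b * g x)) (symbol_coeff h) = symbol_coeff (\<lambda>x. (a * f x + b * g x) * h x)"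
    if h: "bounded_symbol h" for h
  proof -
    have "toeplitz (\<lambda>x. a * f x + b * g x) = (\<lambda>p q. of_real a * toeplitz f p q + of_real b * toeplitz g p q)"
      by (simp add: toeplitz_def symbol_coeff_lincomb[OF f g] fun_eq_iff)
    then have "kop (toeplitz (\<lambda>x. a * f x + b * g x)) (symbol_coeff h)
        = (\<lambda>p. of_real a * symbol_coeff (\<lambda>x. f x * h x) p + of_real b * symbol_coeff (\<lambda>x. g x * h x) p)"
      using assms h by (simp add: kop_kernel_lincomb[OF C D symbol_coeff_ell2[OF h]] functional_law_def)
    also have "\<dots> = symbol_coeff (\<lambda>x. a * (f x * h x) + b * (g x * h x))"
      by (simp add: symbol_coeff_lincomb[OF bborel_mult[OF f h] bborel_mult[OF g h]] fun_eq_iff)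
    finally show ?thesis by (simp add: algebra_simps)
  qed
  then show ?thesis by (simp add: functional_law_def bborel_lincomb[OF f g])
qed

lemma bounded_symbol_id: "bounded_symbol (\<lambda>x. x)"
  by (intro bounded_symbol_continuous continuous_intros)

lemma functional_law_mult_id:
  assumes "functional_law f"
  shows "functional_law (\<lambda>x. x * f x)"
proof -
  have f: "bounded_symbol f" using assms by (simp add: functional_law_def)
  have xf: "bounded_symbol (\<lambda>x. x * f x)" using bborel_mult[OF bounded_symbol_id f] .
  obtain C where C: "kbound C (toeplitz f)" using f by (rule kbound_toeplitz_ex)
  have "kop (toeplitz (\<lambda>x. x * f x)) (symbol_coeff g) p = symbol_coeff (\<lambda>x. (x * f x) * g x) p"
    if g: "bounded_symbol g" for g p
  proof -
    have fg: "bounded_symbol (\<lambda>x. f x * g x)" using f g by (rule bborel_mult)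
    have t: "toeplitz (\<lambda>x. x * f x) p q = toeplitz f (p + 1) q + toeplitz f (p - 1) q" for q
      by (simp add: toeplitz_def symbol_coeff_mult_id[OF f] algebra_simps)
    have "((\<lambda>q. toeplitz f (p + 1) q * symbol_coeff g q + toeplitz f (p - 1) q * symbol_coeff g q) has_sum
        kop (toeplitz f) (symbol_coeff g) (p + 1) + kop (toeplitz f) (symbol_coeff g) (p - 1)) UNIV"
      by (intro has_sum_add has_sum_kop kbound_row[OF C] symbol_coeff_ell2[OF g])
    then have "((\<lambda>q. toeplitz (\<lambda>x. x * f x) p q * symbol_coeff g q) has_sum
        symbol_coeff (\<lambda>x. f x * g x) (p + 1) + symbol_coeff (\<lambda>x. f x * g x) (p - 1)) UNIV"
      using assms g unfolding t by (simp add: functional_law_def distrib_right)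
    then have "kop (toeplitz (\<lambda>x. x * f x)) (symbol_coeff g) p
        = symbol_coeff (\<lambda>x. f x * g x) (p + 1) + symbol_coeff (\<lambda>x. f x * g x) (p - 1)"
      unfolding kop_def by (rule infsumI)
    also have "\<dots> = symbol_coeff (\<lambda>x. x * (f x * g x)) p" by (rule symbol_coeff_mult_id[OF fg, symmetric])
    finally show ?thesis by (simp add: mult.assoc)
  qed
  then show ?thesis using xf by (simp add: functional_law_def fun_eq_iff)
qed

text \<open>Convergent Fourier coefficients and a uniform bound make the operators converge, so both sides pass to
the limit.\<close>

lemma functional_law_limit:
  assumes F: "\<And>i::nat. functional_law (F i)" and f: "bounded_symbol f"
    and C: "\<And>i x. x \<in> {-2..2} \<Longrightarrow> \<bar>F i x\<bar> \<le> C" and lim: "\<And>x. x \<in> {-2..2} \<Longrightarrow> (\<lambda>i. F i x) \<longlonglongrightarrow> f x"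
  shows "functional_law f"
proof -
  have Fb: "bounded_symbol (F i)" for i using F by (simp add: functional_law_def)
  have K: "kbound C (toeplitz (F i))" for i using kbound_toeplitz[OF Fb C] .
  have L: "(\<lambda>i. toeplitz (F i) p q) \<longlonglongrightarrow> toeplitz f p q" for p q
    unfolding toeplitz_def by (rule symbol_coeff_limit[OF Fb f C lim])
  have "kop (toeplitz f) (symbol_coeff g) p = symbol_coeff (\<lambda>x. f x * g x) p" if g: "bounded_symbol g" for g p
  proof -
    obtain D where D: "0 \<le> D" "\<And>x. x \<in> {-2..2} \<Longrightarrow> \<bar>g x\<bar> \<le> D" using bborelE[OF g] by blast
    have "(\<lambda>i. kop (toeplitz (F i)) (symbol_coeff g) p) \<longlonglongrightarrow> kop (toeplitz f) (symbol_coeff g) p"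
      by (rule kop_pointwise_limit[OF K L symbol_coeff_ell2[OF g]])
    moreover have "(\<lambda>i. symbol_coeff (\<lambda>x. F i x * g x) p) \<longlonglongrightarrow> symbol_coeff (\<lambda>x. f x * g x) p"
    proof (rule symbol_coeff_limit[where C = "C * D"])
      show "bounded_symbol (\<lambda>x. F i x * g x)" for i by (rule bborel_mult[OF Fb g])
      show "bounded_symbol (\<lambda>x. f x * g x)" by (rule bborel_mult[OF f g])
      show "\<bar>F i x * g x\<bar> \<le> C * D" if "x \<in> {-2..2}" for i x
        unfolding abs_mult using C[OF that] D(2)[OF that]
        by (intro mult_mono) (auto intro: order_trans[OF abs_ge_zero])
      show "(\<lambda>i. F i x * g x) \<longlonglongrightarrow> f x * g x" if "x \<in> {-2..2}" for x
        by (intro tendsto_mult tendsto_const lim that)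
    qed
    moreover have "kop (toeplitz (F i)) (symbol_coeff g) p = symbol_coeff (\<lambda>x. F i x * g x) p" for i
      using F[of i] g by (simp add: functional_law_def)
    ultimately show ?thesis using LIMSEQ_unique by (simp only:) blast
  qed
  then show ?thesis using f by (simp add: functional_law_def fun_eq_iff)
qed

lemma functional_law_polynomial: "functional_law (\<lambda>x. \<Sum>i\<le>n. a i * x ^ i)"
proof -
  have mono: "functional_law (\<lambda>x. x ^ i)" for i :: nat
    by (induction i) (use functional_law_1 functional_law_mult_id in auto)
  show ?thesis
  proof (induction n)
    case 0
    show ?case using functional_law_lincomb[OF functional_law_1 functional_law_1, of "a 0" 0] by simp
  next
    case (Suc n)
    show ?case using functional_law_lincomb[OF Suc mono, of 1 "a (Suc n)" "Suc n"] by simp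
  qed
qed

lemma functional_law_continuous:
  assumes "continuous_on UNIV f" shows "functional_law f"
proof -
  have "\<exists>g. functional_law g \<and> (\<forall>x\<in>{-2..2}. \<bar>f x - g x\<bar> < 1 / real (Suc i))" for i
  proof -
    obtain g where g: "real_polynomial_function g" "\<And>x. x \<in> {-2..2} \<Longrightarrow> \<bar>f x - g x\<bar> < 1 / real (Suc i)"
      using Stone_Weierstrass_real_polynomial_function[of "{-2..2}" f "1 / real (Suc i)"] continuous_on_subset[OF assms]
      by (metis compact_Icc subset_UNIV zero_less_divide_1_iff of_nat_0_less_iff zero_less_Suc)
    \<comment> \<open>Polynomials are covered since the product law is inherited from \<open>f\<close> by \<open>x f(x)\<close>.\<close>
    obtain a n where "g = (\<lambda>x. \<Sum>i\<le>n. a i * x ^ i)" using g(1) real_polynomial_function_iff_sum by blast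
    then show ?thesis using g(2) functional_law_polynomial by blast
  qed
  then obtain F where F: "\<And>i. functional_law (F i)" "\<And>i x. x \<in> {-2..2} \<Longrightarrow> \<bar>f x - F i x\<bar> < 1 / real (Suc i)"
    by metis
  have f: "bounded_symbol f" using assms by (rule bounded_symbol_continuous)
  obtain C where C: "\<And>x. x \<in> {-2..2} \<Longrightarrow> \<bar>f x\<bar> \<le> C" using bborelE[OF f] by blast
  show ?thesis
  proof (rule functional_law_limit[OF F(1) f])
    show "\<bar>F i x\<bar> \<le> C + 1" if "x \<in> {-2..2}" for i x
    proof -
      have "1 / real (Suc i) \<le> 1" by simp
      then show ?thesis using F(2)[OF that, of i] C[OF that] by linarith
    qed
    show "(\<lambda>i. F i x) \<longlonglongrightarrow> f x" if "x \<in> {-2..2}" for x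
    proof (rule Lim_null[THEN iffD2], rule Lim_null_comparison)
      show "\<forall>\<^sub>F i in sequentially. norm (F i x - f x) \<le> 1 / real (Suc i)"
        using F(2)[OF that] by (intro always_eventually allI) (simp add: abs_minus_commute less_imp_le)
      show "(\<lambda>i. 1 / real (Suc i)) \<longlonglongrightarrow> 0" by (rule LIMSEQ_Suc) (rule lim_1_over_n)
    qed
  qed
qed

lemma functional_law_atMost: "functional_law (indicator {..a})"
proof (rule functional_law_limit[where C = 1])
  \<comment> \<open>Continuous ramps of slope \<open>-i\<close> to the right of \<open>a\<close>.\<close>
  let ?F = "\<lambda>i x. max 0 (min 1 (1 - real i * (x - a)))"
  show "functional_law (?F i)" for i
    by (intro functional_law_continuous continuous_intros)
  show "bounded_symbol (indicator {..a})"
    by (intro bborel_bounded_symbol bborel_indicator) simp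
  show "\<bar>?F i x\<bar> \<le> 1" for i x by auto
  show "(\<lambda>i. ?F i x) \<longlonglongrightarrow> indicator {..a} x" for x
  proof (cases "x \<le> a")
    case True
    then have "?F i x = 1" for i
      by (simp add: mult_nonneg_nonpos min_def max_def)
    then show ?thesis using True by simp
  next
    case False
    then obtain N where N: "1 < real N * (x - a)" using ex_less_of_nat_mult[of "x - a" 1] by auto
    have "?F i x = 0" if "N \<le> i" for i
    proof -
      have "real N * (x - a) \<le> real i * (x - a)" using that False by (intro mult_right_mono) auto
      then show ?thesis using N by auto
    qed
    then have "\<forall>\<^sub>F i in sequentially. ?F i x = indicator {..a} x"
      using False by (auto simp: eventually_sequentially)
    then show ?thesis by (rule tendsto_eventually)
  qed
qed

lemma functional_law_indicator:
  assumes "A \<in> sets borel" shows "functional_law (indicator A)"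
proof -
  have st: "Int_stable (range (\<lambda>a. {..a::real}))" by (auto simp: Int_stable_def)
  have cl: "range (\<lambda>a. {..a::real}) \<subseteq> Pow UNIV" by simp
  have "A \<in> sigma_sets UNIV (range (\<lambda>a. {..a::real}))"
    using assms by (simp add: borel_eq_atMost)
  from st cl this show ?thesis
  proof (induction rule: sigma_sets_induct_disjoint)
    case (basic A)
    then show ?case using functional_law_atMost by auto
  next
    case empty
    show ?case
      using functional_law_lincomb[OF functional_law_1 functional_law_1, of 0 0] by simp
  next
    case (compl A)
    then have "functional_law (\<lambda>x. 1 * 1 + (-1) * indicator A x)" by (intro functional_law_lincomb functional_law_1)
    moreover have "(\<lambda>x. 1 * 1 + (-1) * indicator A x) = (indicator (UNIV - A) :: real \<Rightarrow> real)"
      by (auto simp: indicator_def)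
    ultimately show ?case by simp
  next
    case (union A)
    note A = union
    have m: "A i \<in> sets borel" for i using A(2) by (auto simp: borel_eq_atMost)
    have fin: "functional_law (indicator (\<Union>i<k. A i))" for k
    proof (induction k)
      case 0
      show ?case using functional_law_lincomb[OF functional_law_1 functional_law_1, of 0 0] by simp
    next
      case (Suc k)
      have "functional_law (\<lambda>x. 1 * indicator (\<Union>i<k. A i) x + 1 * indicator (A k) x)"
        by (intro functional_law_lincomb Suc A(3))
      then show ?case by (simp only: indicator_UN_Suc[OF A(1)])
    qed
    show ?case
    proof (rule functional_law_limit[OF fin, where C = 1])
      show "bounded_symbol (indicator (\<Union>i. A i))"
        by (intro bborel_bounded_symbol bborel_indicator sets.countable_UN') (auto intro: m)
      show "\<bar>indicator (\<Union>i<k. A i) x\<bar> \<le> (1::real)" for k x by (simp add: indicator_def)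
      show "(\<lambda>k. indicator (\<Union>i<k. A i) x :: real) \<longlonglongrightarrow> indicator (\<Union>i. A i) x" for x
        by (rule LIMSEQ_indicator_UN)
    qed
  qed
qed

text \<open>This is where completeness of the characters enters, in the form of the theorem of Weierstrass: for
\<open>g = f\<close> the product law contains Parseval's identity for \<open>f(2 cos t)\<close>.\<close>

lemma functional_law_bborel: "bborel f \<Longrightarrow> functional_law f"
proof (induction rule: bborel_induct)
  case (indicator A) then show ?case by (rule functional_law_indicator)
next
  case (lincomb f g a b) then show ?case by (intro functional_law_lincomb)
next
  case (limit F f C) then show ?case by (intro functional_law_limit[of F f C] bborel_bounded_symbol) auto
qed

section \<open>The strip operator\<close>

text \<open>The kernel of \<open>f\<close> of the strip operator: on the \<open>j\<close>-th line the operator is the translate by \<open>w j\<close> of the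
one-dimensional hopping operator.\<close>

definition strip_kernel :: "real \<Rightarrow> (real \<Rightarrow> real) \<Rightarrow> lattice \<Rightarrow> lattice \<Rightarrow> complex" where
  "strip_kernel w f p q = (if fst p = fst q
     then toeplitz (\<lambda>x. f (w * of_int (fst p) + x)) (snd p) (snd q) else 0)"

text \<open>The summands \<open>+ 0\<close> and \<open>+ - 1\<close> give the shifts the form used in \<open>ell2_shift\<close> and \<open>ip_shift\<close>.\<close>

definition strip_op :: "real \<Rightarrow> (lattice \<Rightarrow> complex) \<Rightarrow> (lattice \<Rightarrow> complex)" where
  "strip_op w u = (\<lambda>p. complex_of_real (w * of_int (fst p)) * u p
     + (u (fst p + 0, snd p + 1) + u (fst p + 0, snd p + - 1)))"

lemma sum_Sigma_fibres:
  assumes "finite J" "\<And>j. finite (F j)"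
  shows "(\<Sum>p\<in>Sigma J F. h p) = (\<Sum>j\<in>J. \<Sum>n\<in>F j. h (j, n))"
  using sum.Sigma[of J F "\<lambda>j n. h (j, n)"] assms by simp

text \<open>The additive bounds of the blocks add up, because each coordinate lies in one block.\<close>

lemma kbound_block_diagonal:
  fixes K :: "'a \<Rightarrow> 'b \<Rightarrow> 'c \<Rightarrow> complex"
  assumes C: "0 \<le> C" and K: "\<And>j. kbound C (K j)"
  shows "kbound C (\<lambda>p q. if fst p = fst q then K (fst p) (snd p) (snd q) else 0)"
proof -
  have "cmod (\<Sum>p\<in>F. \<Sum>q\<in>G. cnj (v p) * (if fst p = fst q then K (fst p) (snd p) (snd q) else 0) * u q)
       \<le> C * (sqsum F v + sqsum G u) / 2"
    if F: "finite F" and G: "finite G" for F G v u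
  proof -
    define J where "J = fst ` F \<union> fst ` G"
    define F' where "F' j = {n. (j, n) \<in> F}" for j
    define G' where "G' j = {n. (j, n) \<in> G}" for j
    have J: "finite J" using F G by (simp add: J_def)
    have F': "finite (F' j)" for j
      using finite_subset[of "F' j" "snd ` F"] F by (force simp: F'_def)
    have G': "finite (G' j)" for j
      using finite_subset[of "G' j" "snd ` G"] G by (force simp: G'_def)
    have FS: "F = Sigma J F'" and GS: "G = Sigma J G'" by (force simp: J_def F'_def G'_def)+
    have sF: "(\<Sum>p\<in>F. h p) = (\<Sum>j\<in>J. \<Sum>n\<in>F' j. h (j, n))" for h :: "_ \<Rightarrow> complex"
      by (subst FS) (rule sum_Sigma_fibres[OF J F'])
    have sG: "(\<Sum>p\<in>G. h p) = (\<Sum>j\<in>J. \<Sum>n\<in>G' j. h (j, n))" for h :: "_ \<Rightarrow> complex"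
      by (subst GS) (rule sum_Sigma_fibres[OF J G'])
    have sF': "(\<Sum>p\<in>F. h p) = (\<Sum>j\<in>J. \<Sum>n\<in>F' j. h (j, n))" for h :: "_ \<Rightarrow> real"
      by (subst FS) (rule sum_Sigma_fibres[OF J F'])
    have sG': "(\<Sum>p\<in>G. h p) = (\<Sum>j\<in>J. \<Sum>n\<in>G' j. h (j, n))" for h :: "_ \<Rightarrow> real"
      by (subst GS) (rule sum_Sigma_fibres[OF J G'])
    have "(\<Sum>p\<in>F. \<Sum>q\<in>G. cnj (v p) * (if fst p = fst q then K (fst p) (snd p) (snd q) else 0) * u q)
        = (\<Sum>j\<in>J. \<Sum>n\<in>F' j. \<Sum>i\<in>J. \<Sum>m\<in>G' i. if i = j then cnj (v (j, n)) * K j n m * u (j, m) else 0)"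
      unfolding sF sG by (intro sum.cong refl) auto
    also have "\<dots> = (\<Sum>j\<in>J. \<Sum>n\<in>F' j. \<Sum>i\<in>J. if i = j then \<Sum>m\<in>G' j. cnj (v (j, n)) * K j n m * u (j, m) else 0)"
      by (intro sum.cong refl) auto
    also have "\<dots> = (\<Sum>j\<in>J. \<Sum>n\<in>F' j. \<Sum>m\<in>G' j. cnj (v (j, n)) * K j n m * u (j, m))"
      using J by (intro sum.cong refl) simp
    finally have "cmod (\<Sum>p\<in>F. \<Sum>q\<in>G. cnj (v p) * (if fst p = fst q then K (fst p) (snd p) (snd q) else 0) * u q)
        \<le> (\<Sum>j\<in>J. cmod (\<Sum>n\<in>F' j. \<Sum>m\<in>G' j. cnj (v (j, n)) * K j n m * u (j, m)))"
      by (simp only: norm_sum)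
    also have "\<dots> \<le> (\<Sum>j\<in>J. C * ((\<Sum>n\<in>F' j. (cmod (v (j, n)))\<^sup>2) + (\<Sum>m\<in>G' j. (cmod (u (j, m)))\<^sup>2)) / 2)"
      by (rule sum_mono) (rule kboundD[OF K F' G'])
    also have "\<dots> = C * (sqsum F v + sqsum G u) / 2"
      unfolding sF' sG' by (simp only: sum.distrib sum_distrib_left[symmetric] sum_divide_distrib[symmetric])
    finally show ?thesis .
  qed
  then show ?thesis using C by (simp only: kbound_def) blast
qed

lemma bborel_shift_symbol: "bborel f \<Longrightarrow> bounded_symbol (\<lambda>x. f (c + x))"
  by (intro bborel_bounded_symbol bborel_shift)

text \<open>Translation by \<open>m\<close> carries the product law from the column of index \<open>0\<close> to every column.\<close>

lemma toeplitz_product: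
  assumes f: "bborel f" and g: "bborel g"
  shows "((\<lambda>r. toeplitz f n r * toeplitz g r m) has_sum toeplitz (\<lambda>x. f x * g x) n m) UNIV"
proof -
  note fs = bborel_bounded_symbol[OF f] and gs = bborel_bounded_symbol[OF g]
  obtain C where C: "kbound C (toeplitz f)" using fs by (rule kbound_toeplitz_ex)
  have "((\<lambda>r. toeplitz f (n - m) r * symbol_coeff g r) has_sum symbol_coeff (\<lambda>x. f x * g x) (n - m)) UNIV"
    using has_sum_kop[where K = "toeplitz f" and p = "n - m", OF kbound_row[OF C] symbol_coeff_ell2[OF gs]] functional_law_bborel[OF f] gs
    by (simp add: functional_law_def)
  then have "((\<lambda>r. toeplitz f (n - m) (r - m) * symbol_coeff g (r - m)) has_sum symbol_coeff (\<lambda>x. f x * g x) (n - m)) UNIV"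
    by (subst has_sum_reindex_bij_betw[where g = "\<lambda>r. r - m" and B = UNIV and f = "\<lambda>r. toeplitz f (n - m) r * symbol_coeff g r"])
       (auto intro!: bij_betwI[where g = "\<lambda>r. r + m"])
  then show ?thesis by (simp add: toeplitz_def)
qed

lemma kbound_strip_kernel:
  assumes "bborel f" "\<And>x. \<bar>f x\<bar> \<le> C" shows "kbound C (strip_kernel w f)"
proof -
  have "0 \<le> C" using assms(2)[of 0] by linarith
  then show ?thesis
    unfolding strip_kernel_def[abs_def]
    by (intro kbound_block_diagonal kbound_toeplitz bborel_shift_symbol assms)
qed

interpretation strip: kernel_calculus "strip_kernel w" for w
proof
  show "kbound C (strip_kernel w f)" if "bborel f" "\<And>x. \<bar>f x\<bar> \<le> C" for f C
    by (rule kbound_strip_kernel[OF that])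
next
  fix f g :: "real \<Rightarrow> real" and a b assume f: "bborel f" and g: "bborel g"
  show "strip_kernel w (\<lambda>x. a * f x + b * g x) = (\<lambda>p q. of_real a * strip_kernel w f p q + of_real b * strip_kernel w g p q)"
    by (simp add: strip_kernel_def toeplitz_def fun_eq_iff
        symbol_coeff_lincomb[OF bborel_shift_symbol[OF f] bborel_shift_symbol[OF g]])
next
  fix f :: "real \<Rightarrow> real"
  show "kadj (strip_kernel w f) = strip_kernel w f"
    by (auto simp: kadj_def strip_kernel_def toeplitz_def cnj_symbol_coeff fun_eq_iff)
next
  show "strip_kernel w (\<lambda>x. 1) = (\<lambda>p q. if p = q then 1 else 0)"
    by (auto simp: strip_kernel_def toeplitz_def symbol_coeff_1 fun_eq_iff prod_eq_iff)
next
  fix f g :: "real \<Rightarrow> real" and u :: "lattice \<Rightarrow> complex"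
  assume f: "bborel f" and g: "bborel g" and u: "u \<in> ell2"
  obtain C where C: "kbound C (strip_kernel w f)" using f kbound_strip_kernel bborelE[OF f] by (metis UNIV_I)
  obtain D where D: "kbound D (strip_kernel w g)" using g kbound_strip_kernel bborelE[OF g] by (metis UNIV_I)
  show "kop (strip_kernel w f) (kop (strip_kernel w g) u) = kop (strip_kernel w (\<lambda>x. f x * g x)) u"
  proof (rule kop_kop[OF C D u])
    fix p q :: lattice
    obtain j n where p: "p = (j, n)" by (cases p)
    let ?h = "\<lambda>r. strip_kernel w f p r * strip_kernel w g r q"
    show "(?h has_sum strip_kernel w (\<lambda>x. f x * g x) p q) UNIV"
    proof (cases "fst q = j")
      case False
      then have "?h r = 0" for r by (simp add: strip_kernel_def p)
      moreover have "strip_kernel w (\<lambda>x. f x * g x) p q = 0" using False by (simp add: strip_kernel_def p)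
      ultimately show ?thesis by (simp only: has_sum_0)
    next
      case True
      have "((\<lambda>m. ?h (j, m)) has_sum strip_kernel w (\<lambda>x. f x * g x) p q) UNIV"
        using toeplitz_product[OF bborel_shift[OF f] bborel_shift[OF g], of "w * of_int j" n "w * of_int j" "snd q"] True
        by (simp add: strip_kernel_def p)
      then have "(?h has_sum strip_kernel w (\<lambda>x. f x * g x) p q) (range (Pair j))"
        by (subst has_sum_reindex) (auto simp: inj_on_def o_def)
      then show ?thesis
        by (rule has_sum_cong_neutral[THEN iffD1, rotated -1]) (auto simp: strip_kernel_def p)
    qed
  qed
next
  fix F :: "nat \<Rightarrow> real \<Rightarrow> real" and f C and p q :: lattice
  assume F: "\<And>i. bborel (F i)" and f: "bborel f" and C: "\<And>i x. \<bar>F i x\<bar> \<le> C" and lim: "\<And>x. (\<lambda>i. F i x) \<longlonglongrightarrow> f x"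
  show "(\<lambda>i. strip_kernel w (F i) p q) \<longlonglongrightarrow> strip_kernel w f p q"
  proof (cases "fst p = fst q")
    case True
    have "(\<lambda>i. symbol_coeff (\<lambda>x. F i (w * of_int (fst p) + x)) (snd p - snd q)) \<longlonglongrightarrow>
        symbol_coeff (\<lambda>x. f (w * of_int (fst p) + x)) (snd p - snd q)"
      by (rule symbol_coeff_limit[OF bborel_shift_symbol[OF F] bborel_shift_symbol[OF f] C lim])
    then show ?thesis using True by (simp add: strip_kernel_def toeplitz_def)
  qed (simp add: strip_kernel_def)
qed

lemma strip_kernel_mult_id:
  assumes f: "bborel f"
  shows "strip_kernel w (\<lambda>x. x * f x) p q = strip_op w (\<lambda>p. strip_kernel w f p q) p"
proof (cases "fst p = fst q")
  case True
  let ?c = "w * of_int (fst p)"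
  let ?f = "\<lambda>x. f (?c + x)"
  have fs: "bounded_symbol ?f" by (rule bborel_shift_symbol[OF f])
  have "(\<lambda>x. (?c + x) * f (?c + x)) = (\<lambda>x. ?c * ?f x + 1 * (x * ?f x))" by (simp add: algebra_simps)
  then have "symbol_coeff (\<lambda>x. (?c + x) * f (?c + x)) n = of_real ?c * symbol_coeff ?f n + (symbol_coeff ?f (n + 1) + symbol_coeff ?f (n - 1))" for n
    using symbol_coeff_lincomb[OF fs bborel_mult[OF bounded_symbol_id fs], of ?c 1 n]
    by (simp add: symbol_coeff_mult_id[OF fs])
  then show ?thesis using True by (simp add: strip_kernel_def strip_op_def toeplitz_def algebra_simps)
qed (simp add: strip_kernel_def strip_op_def)

lemma strip_hop_ell2: "u \<in> ell2 \<Longrightarrow> (\<lambda>p :: lattice. u (fst p + 0, snd p + 1) + u (fst p + 0, snd p + - 1)) \<in> ell2"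
  by (intro ell2_add ell2_shift)

text \<open>Both vectors lie in the maximal domain, so that the diagonal part can be split off as a square summable
sequence.\<close>

lemma strip_op_symmetric:
  assumes u: "u \<in> ell2" "strip_op w u \<in> ell2" and v: "v \<in> ell2" "strip_op w v \<in> ell2"
  shows "ip (strip_op w u) v = ip u (strip_op w v)"
proof -
  define d where "d u = (\<lambda>p :: lattice. complex_of_real (w * of_int (fst p)) * u p)" for u
  have d: "d u \<in> ell2" if "u \<in> ell2" "strip_op w u \<in> ell2" for u
    using ell2_diff[OF that(2) strip_hop_ell2[OF that(1)]] by (simp add: strip_op_def d_def)
  have s: "strip_op w u = (\<lambda>p. d u p + (u (fst p + 0, snd p + 1) + u (fst p + 0, snd p + - 1)))" for u
    by (simp add: strip_op_def d_def)
  have "ip (d u) v = ip u (d v)" by (simp add: ip_def d_def mult_ac)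
  then show ?thesis
    unfolding s
    by (simp only: ip_add_left ip_add_right ell2_add ell2_shift u(1) v(1) d[OF u] d[OF v] ip_shift)
       (simp add: algebra_simps)
qed

lemma strip_spectral_resolution:
  "spectral_resolution {u \<in> ell2. strip_op w u \<in> ell2} (strip_op w) (strip.pvm w)"
proof (rule strip.spectral_resolution_pvm[OF refl])
  fix f :: "real \<Rightarrow> real" and u :: "lattice \<Rightarrow> complex"
  assume f: "bborel f" and xf: "bborel (\<lambda>x. x * f x)"
  obtain C where C: "kbound C (strip_kernel w f)" using f by (rule strip.kbound_ex)
  obtain D where D: "kbound D (strip_kernel w (\<lambda>x. x * f x))" using xf by (rule strip.kbound_ex)
  show "strip_op w (kop (strip_kernel w f) u) = kop (strip_kernel w (\<lambda>x. x * f x)) u" if u: "u \<in> ell2"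
  proof
    fix p
    have "((\<lambda>q. complex_of_real (w * of_int (fst p)) * (strip_kernel w f p q * u q)
        + (strip_kernel w f (fst p + 0, snd p + 1) q * u q + strip_kernel w f (fst p + 0, snd p + - 1) q * u q))
      has_sum strip_op w (kop (strip_kernel w f) u) p) UNIV"
      unfolding strip_op_def
      by (intro has_sum_add has_sum_cmult_right has_sum_kop kbound_row[OF C] u)
    then have "((\<lambda>q. strip_kernel w (\<lambda>x. x * f x) p q * u q) has_sum strip_op w (kop (strip_kernel w f) u) p) UNIV"
      unfolding strip_kernel_mult_id[OF f] by (simp add: strip_op_def algebra_simps)
    then show "strip_op w (kop (strip_kernel w f) u) p = kop (strip_kernel w (\<lambda>x. x * f x)) u p"
      unfolding kop_def[of "strip_kernel w (\<lambda>x. x * f x)"] by (simp add: infsumI)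
  qed
  show "kop (strip_kernel w f) (strip_op w u) = kop (strip_kernel w (\<lambda>x. x * f x)) u"
    if u: "u \<in> {u \<in> ell2. strip_op w u \<in> ell2}"
  proof
    fix p
    have h: "cnj (strip_kernel w g p q) = strip_kernel w g q p" if "bborel g" for g q
      using fun_cong[OF fun_cong[OF strip.K_hermitian[OF that]], of w q p] by (simp add: kadj_def)
    let ?k = "\<lambda>q. strip_kernel w f q p"
    have k: "strip_op w ?k = (\<lambda>q. strip_kernel w (\<lambda>x. x * f x) q p)"
      using strip_kernel_mult_id[OF f] by (simp add: fun_eq_iff)
    \<comment> \<open>The operator is moved from \<open>u\<close> to the row of the kernel, which lies in its domain because \<open>x f(x)\<close> is bounded.\<close>
    have "ip ?k (strip_op w u) = ip (strip_op w ?k) u"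
      by (rule strip_op_symmetric[symmetric]) (use kbound_column[OF C] kbound_column[OF D] k u in auto)
    then show "kop (strip_kernel w f) (strip_op w u) p = kop (strip_kernel w (\<lambda>x. x * f x)) u p"
      unfolding kop_eq_ip h[OF f] h[OF xf] k .
  qed
next
  fix v :: "nat \<Rightarrow> lattice \<Rightarrow> complex" and u p
  assume "\<And>p. (\<lambda>i. v i p) \<longlonglongrightarrow> u p"
  then show "(\<lambda>i. strip_op w (v i) p) \<longlonglongrightarrow> strip_op w u p"
    unfolding strip_op_def by (intro tendsto_intros)
qed

text \<open>On \<open>[-\<pi>, \<pi>]\<close> the cosine has the two inverse branches \<open>\<plusminus>arccos\<close>, which are differentiable away from \<open>\<plusminus>1\<close> and
hence map null sets to null sets.\<close>

lemma two_cos_preimage_null: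
  assumes A: "A \<in> null_sets lborel"
  shows "AE t in lborel. t \<in> {- pi..pi} \<longrightarrow> c + two_cos t \<notin> A"
proof -
  have Ab [measurable]: "A \<in> sets borel" using A by auto
  define Z where "Z = {t \<in> {- pi..pi}. c + two_cos t \<in> A}"
  define S where "S = {s \<in> {-1<..<1}. c + 2 * s \<in> A}"
  have nA: "negligible A"
    using A by (auto simp: negligible_iff_null_sets intro: null_sets_completionI)
  have "negligible ((\<lambda>a. (a - c) / 2) ` A)"
    by (rule negligible_differentiable_image_negligible[OF _ nA])
       (auto intro!: differentiable_at_imp_differentiable_on derivative_intros)
  moreover have "S \<subseteq> (\<lambda>a. (a - c) / 2) ` A"
    by (force simp: S_def intro: image_eqI[of _ _ "c + 2 * _"])
  ultimately have nS: "negligible S" by (rule negligible_subset)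
  have nacos: "negligible (arccos ` S)"
  proof (rule negligible_differentiable_image_negligible[OF _ nS])
    show "arccos differentiable_on S"
    proof (rule differentiable_at_imp_differentiable_on)
      fix x assume "x \<in> S"
      then have "(arccos has_real_derivative inverse (- sqrt (1 - x\<^sup>2))) (at x)"
        by (intro DERIV_arccos) (auto simp: S_def)
      then show "arccos differentiable at x" by (auto simp: real_differentiable_def)
    qed
  qed simp
  have nneg: "negligible (uminus ` arccos ` S)"
    by (rule negligible_differentiable_image_negligible[OF _ nacos])
       (auto intro!: differentiable_at_imp_differentiable_on derivative_intros)
  have "Z \<subseteq> arccos ` S \<union> uminus ` arccos ` S \<union> {0, pi, - pi}"
  proof
    fix t assume t: "t \<in> Z"
    then have r: "\<bar>t\<bar> \<le> pi" and a: "c + 2 * cos t \<in> A" by (auto simp: Z_def two_cos_def)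
    have cosabs: "cos \<bar>t\<bar> = cos t" by (simp add: abs_if)
    have ac: "arccos (cos t) = \<bar>t\<bar>" using arccos_cos[of "\<bar>t\<bar>"] r by (simp add: cosabs)
    show "t \<in> arccos ` S \<union> uminus ` arccos ` S \<union> {0, pi, - pi}"
    proof (cases "cos t = 1 \<or> cos t = - 1")
      case True
      then have "\<bar>t\<bar> = 0 \<or> \<bar>t\<bar> = pi" using ac by auto
      then show ?thesis by (auto simp: abs_if split: if_splits)
    next
      case False
      then have "cos t \<in> S"
        using a cos_le_one[of t] cos_ge_minus_one[of t] by (auto simp: S_def less_le)
      then have "\<bar>t\<bar> \<in> arccos ` S" using ac by (metis imageI)
      moreover have "t = \<bar>t\<bar> \<or> t = - \<bar>t\<bar>" by linarith
      ultimately show ?thesis by (metis UnCI imageI)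
    qed
  qed
  moreover have "negligible (arccos ` S \<union> uminus ` arccos ` S \<union> {0, pi, - pi})"
    using nacos nneg by (intro negligible_Un) auto
  ultimately have "negligible Z" using negligible_subset by blast
  moreover have "Z \<in> sets lborel" unfolding Z_def by measurable
  ultimately have "Z \<in> null_sets lborel"
    using null_sets_completion_iff by (simp add: negligible_iff_null_sets null_sets_completion_iff)
  then have "AE t in lborel. t \<notin> Z" by (rule AE_not_in)
  then show ?thesis by eventually_elim (auto simp: Z_def)
qed

lemma strip_absolutely_continuous:
  assumes u: "u \<in> ell2"
  shows "absolutely_continuous lborel (spectral_measure (strip.pvm w) u)"
  unfolding absolutely_continuous_def
proof
  fix A :: "real set" assume A: "A \<in> null_sets lborel"
  then have Ab: "A \<in> sets borel" by auto
  have "symbol_coeff (\<lambda>x. indicator A (c + x)) n = 0" for c n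
  proof -
    note [measurable] = Ab
    have "(\<integral>t. indicator {- pi..pi} t *\<^sub>R (complex_of_real (indicator A (c + two_cos t)) * cis (of_int n * t)) \<partial>lborel) = 0"
      by (rule integral_eq_zero_AE) (use two_cos_preimage_null[OF A, of c] in eventually_elim, auto simp: indicator_def)
    then show ?thesis unfolding symbol_coeff_def by (subst integral_circle) simp_all
  qed
  then have "strip_kernel w (indicator A) = (\<lambda>p q. 0)"
    by (simp add: strip_kernel_def toeplitz_def fun_eq_iff)
  then have "strip.pvm w A u = (\<lambda>p. 0)" by (simp add: strip.pvm_def kop_def)
  then have "emeasure (spectral_measure (strip.pvm w) u) A = 0"
    by (simp add: emeasure_spectral_measure[OF strip.projection_valued_measure_pvm Ab u])
  then show "A \<in> null_sets (spectral_measure (strip.pvm w) u)" using Ab by (intro null_setsI) simp_all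
qed

section \<open>The axis-parallel case\<close>

lemma unitary_kernel_permute:
  assumes K: "unitary_kernel K" and s: "bij s"
  shows "unitary_kernel (\<lambda>p. K (s p))"
proof -
  have "((\<lambda>p. cnj (K (s p) q) * K (s p) q') has_sum (if q = q' then 1 else 0)) UNIV" for q q'
    using K has_sum_reindex_bij_betw[OF s, of "\<lambda>p. cnj (K p q) * K p q'"]
    by (simp add: unitary_kernel_def)
  moreover have "((\<lambda>q. K (s p) q * cnj (K (s p') q)) has_sum (if p = p' then 1 else 0)) UNIV" for p p'
  proof -
    have "((\<lambda>q. K (s p) q * cnj (K (s p') q)) has_sum (if s p = s p' then 1 else 0)) UNIV"
      using K unfolding unitary_kernel_def by blast
    then show ?thesis by (simp only: inj_eq[OF bij_is_inj[OF s]])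
  qed
  ultimately show ?thesis unfolding unitary_kernel_def by blast
qed

text \<open>The hypothesis on \<open>H\<close> says that applying \<open>H\<close> to the lattice variable of \<open>U p m\<close> is the same as applying the strip operator to the
label. Read along rows it gives \<open>U H u = S U u\<close> on the domain of \<open>H\<close>; read along columns it gives
\<open>H U\<^sup>* v = U\<^sup>* S v\<close> on the domain of the strip operator \<open>S\<close>, so the domains correspond.\<close>

lemma purely_absolutely_continuous_of_conjugation:
  assumes U: "unitary_kernel U" and real: "\<And>p m. cnj (U p m) = U p m"
    and conj: "\<And>p m. H_op \<omega> (U p) m = strip_op w (\<lambda>p. U p m) p"
  shows "purely_absolutely_continuous (H_dom \<omega>) (H_op \<omega>)"
proof -
  note V = unitary_kernel_kadj[OF U]
  note e = unitary_kernel_ell2[OF U] and e' = unitary_kernel_ell2[OF V]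
  have row: "U p \<in> ell2" for p by (rule kbound_row[OF kbound_unitary[OF U]])
  have col: "(\<lambda>p. U p m) \<in> ell2" for m by (rule kbound_column[OF kbound_unitary[OF U]])
  have kopU: "kop U u p = ip (U p) u" for u p by (simp add: kop_eq_ip real)
  have kopV: "kop (kadj U) v m = ip (\<lambda>p. U p m) v" for v m by (simp add: kop_eq_ip kadj_def real)
  have H_row: "H_op \<omega> (U p) = (\<lambda>m. complex_of_real (w * of_int (fst p)) * U p m
      + (U (fst p + 0, snd p + 1) m + U (fst p + 0, snd p + - 1) m))" for p
    by (simp add: conj fun_eq_iff) (simp add: strip_op_def)
  have row_dom: "U p \<in> H_dom \<omega>" for p
    unfolding H_dom_iff H_row by (intro conjI row ell2_add ell2_scale)
  have S_col: "strip_op w (\<lambda>p. U p m) = (\<lambda>p. U p (fst m + 1, snd m + 0) + U p (fst m + - 1, snd m + 0) + U p (fst m + 0, snd m + 1) + U p (fst m + 0, snd m + - 1)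
      + complex_of_real (dot \<omega> m) * U p m)" for m
    by (simp add: conj[symmetric] fun_eq_iff) (simp add: H_op_def potential_def hopping_eq')
  have col_dom: "strip_op w (\<lambda>p. U p m) \<in> ell2" for m
    unfolding S_col by (intro col ell2_add ell2_scale)
  have inter: "kop U (H_op \<omega> u) = strip_op w (kop U u)" if u: "u \<in> H_dom \<omega>" for u
  proof
    fix p
    note ue = H_domD(1)[OF u]
    have "kop U (H_op \<omega> u) p = ip (H_op \<omega> (U p)) u"
      unfolding kopU by (rule H_op_symmetric[OF row_dom u, symmetric])
    also have "\<dots> = strip_op w (kop U u) p"
      unfolding H_row strip_op_def kopU
      by (simp only: ip_add_left ip_scale_left ell2_add ell2_scale row ue) simp
    finally show "kop U (H_op \<omega> u) p = strip_op w (kop U u) p" .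
  qed
  have dom: "H_dom \<omega> = {u \<in> ell2. kop U u \<in> {v \<in> ell2. strip_op w v \<in> ell2}}"
  proof (intro set_eqI iffI)
    fix u assume u: "u \<in> H_dom \<omega>"
    then show "u \<in> {u \<in> ell2. kop U u \<in> {v \<in> ell2. strip_op w v \<in> ell2}}"
      using e[OF H_domD(1)[OF u]] e[OF H_op_ell2[OF u]] H_domD(1)[OF u] by (simp add: inter[OF u])
  next
    fix u assume "u \<in> {u \<in> ell2. kop U u \<in> {v \<in> ell2. strip_op w v \<in> ell2}}"
    then have u: "u \<in> ell2" and Su: "strip_op w (kop U u) \<in> ell2" by auto
    note Ue = e[OF u]
    have uV: "u = (\<lambda>m. ip (\<lambda>p. U p m) (kop U u))"
      using unitary_kernel_inverse[OF U u] by (simp add: fun_eq_iff flip: kopV)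
    have "H_op \<omega> u m = kop (kadj U) (strip_op w (kop U u)) m" for m
    proof -
      have "H_op \<omega> u m = ip (strip_op w (\<lambda>p. U p m)) (kop U u)"
        unfolding S_col
        by (simp only: ip_add_left ip_scale_left ell2_add ell2_scale col Ue)
           (simp add: H_op_def potential_def hopping_eq' flip: fun_cong[OF uV])
      also have "\<dots> = ip (\<lambda>p. U p m) (strip_op w (kop U u))"
        by (rule strip_op_symmetric[OF col col_dom Ue Su])
      finally show ?thesis by (simp only: kopV)
    qed
    then have "H_op \<omega> u = kop (kadj U) (strip_op w (kop U u))" by (rule ext)
    then have "H_op \<omega> u \<in> ell2" using e'[OF Su] by simp
    then show "u \<in> H_dom \<omega>" using u by (simp add: H_dom_iff)
  qed
  note transport = spectral_resolution_unitary_transport[OF U strip_spectral_resolution dom, of "H_op \<omega>"]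
  have T: "H_op \<omega> u \<in> ell2 \<and> kop U (H_op \<omega> u) = strip_op w (kop U u)" if "u \<in> H_dom \<omega>" for u
    using H_op_ell2[OF that] inter[OF that] by blast
  show ?thesis
    unfolding purely_absolutely_continuous_def
    using transport(1)[OF T] transport(2)[OF T] strip_absolutely_continuous e by (metis (no_types, lifting))
qed

text \<open>In the first coordinate the eigenvalue equation applies. In the second one, shifting the argument of a
translate by \<open>1\<close> or \<open>-1\<close> amounts to shifting its label by \<open>-1\<close> or \<open>1\<close>.\<close>

lemma H_op_wannier_stark_horizontal:
  assumes "fst \<omega> \<noteq> 0" "snd \<omega> = 0"
  shows "H_op \<omega> (wannier_stark \<omega> p) m = strip_op (fst \<omega>) (\<lambda>p. wannier_stark \<omega> p m) p"
proof -
  obtain a b where m: "m = (a, b)" by (cases m)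
  obtain c d where p: "p = (c, d)" by (cases p)
  have "b - (d + 1) = b - d - 1" "b - (d + - 1) = b - d + 1" by simp_all
  then show ?thesis
    unfolding m p H_op_wannier_stark_expand bessel_stark[OF assms(1)] strip_op_def wannier_stark_def fst_conv snd_conv
      of_real_mult[symmetric] of_real_add[symmetric] of_real_eq_iff
    by (simp only:) (simp add: dot_def assms(2) algebra_simps)
qed

text \<open>The coordinates of the label are exchanged, so that the direction of the field comes first, as in the strip
operator.\<close>

lemma H_op_wannier_stark_vertical:
  assumes "fst \<omega> = 0" "snd \<omega> \<noteq> 0"
  shows "H_op \<omega> (wannier_stark \<omega> (prod.swap p)) m = strip_op (snd \<omega>) (\<lambda>p. wannier_stark \<omega> (prod.swap p) m) p"
proof -
  obtain a b where m: "m = (a, b)" by (cases m)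
  obtain c d where p: "p = (c, d)" by (cases p)
  have "a - (d + 1) = a - d - 1" "a - (d + - 1) = a - d + 1" by simp_all
  then show ?thesis
    unfolding m p prod.swap_def fst_conv snd_conv H_op_wannier_stark_expand bessel_stark[OF assms(2)] strip_op_def wannier_stark_def
      of_real_mult[symmetric] of_real_add[symmetric] of_real_eq_iff
    by (simp only: fst_conv snd_conv) (simp add: dot_def assms(1) algebra_simps)
qed

lemma axis_parallel_purely_absolutely_continuous:
  assumes "\<omega> \<noteq> (0, 0)" "fst \<omega> = 0 \<or> snd \<omega> = 0"
  shows "purely_absolutely_continuous (H_dom \<omega>) (H_op \<omega>)"
proof (cases "snd \<omega> = 0")
  case True
  then have "fst \<omega> \<noteq> 0" using assms(1) by (simp add: prod_eq_iff)
  show ?thesis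
    by (rule purely_absolutely_continuous_of_conjugation[OF unitary_wannier_stark cnj_wannier_stark
          H_op_wannier_stark_horizontal[OF \<open>fst \<omega> \<noteq> 0\<close> True]])
next
  case False
  then have "fst \<omega> = 0" using assms(2) by simp
  show ?thesis
    by (rule purely_absolutely_continuous_of_conjugation[OF unitary_kernel_permute[OF unitary_wannier_stark bij_swap]
          cnj_wannier_stark H_op_wannier_stark_vertical[OF \<open>fst \<omega> = 0\<close> False]])
qed

theorem theorem2p1:
  fixes \<omega> :: "real \<times> real"
  assumes "\<omega> \<noteq> (0, 0)"
  shows "(fst \<omega> = 0 \<or> snd \<omega> = 0 \<longrightarrow>
            purely_absolutely_continuous (H_dom \<omega>) (H_op \<omega>)) \<and>
         ((\<exists>l. l \<noteq> (0, 0) \<and> dot \<omega> l = 0) \<and> fst \<omega> \<noteq> 0 \<and> snd \<omega> \<noteq> 0 \<longrightarrow>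
            purely_essential (H_dom \<omega>) (H_op \<omega>)) \<and>
         ((\<forall>l. l \<noteq> (0, 0) \<longrightarrow> dot \<omega> l \<noteq> 0) \<longrightarrow>
            purely_point (H_dom \<omega>) (H_op \<omega>) \<and>
            (\<forall>a>0. \<exists>C>0. \<exists>\<psi> :: lattice \<Rightarrow> lattice \<Rightarrow> complex.
               inj \<psi> \<and> orthonormal_basis (range \<psi>) \<and>
               (\<forall>n. eigenvector (H_dom \<omega>) (H_op \<omega>) (\<psi> n)) \<and>
               (\<forall>n m. cmod (\<psi> n m) \<le> C * exp (- a * real_of_int (l1norm (m - n))))))"
proof (intro conjI impI allI)
  assume "fst \<omega> = 0 \<or> snd \<omega> = 0"
  then show "purely_absolutely_continuous (H_dom \<omega>) (H_op \<omega>)" by (rule axis_parallel_purely_absolutely_continuous[OF assms])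
next
  assume "(\<exists>l. l \<noteq> (0, 0) \<and> dot \<omega> l = 0) \<and> fst \<omega> \<noteq> 0 \<and> snd \<omega> \<noteq> 0"
  then show "purely_essential (H_dom \<omega>) (H_op \<omega>)" using rational_direction_purely_essential by blast
next
  assume irr: "\<forall>l. l \<noteq> (0, 0) \<longrightarrow> dot \<omega> l \<noteq> 0"
  have nz: "fst \<omega> \<noteq> 0" "snd \<omega> \<noteq> 0"
    using irr[rule_format, of "(1, 0)"] irr[rule_format, of "(0, 1)"] by (simp_all add: dot_def)
  show "purely_point (H_dom \<omega>) (H_op \<omega>)" by (rule localised_eigenbasis(1)[OF nz])
  show "\<exists>C>0. \<exists>\<psi> :: lattice \<Rightarrow> lattice \<Rightarrow> complex.
               inj \<psi> \<and> orthonormal_basis (range \<psi>) \<and>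
               (\<forall>n. eigenvector (H_dom \<omega>) (H_op \<omega>) (\<psi> n)) \<and>
               (\<forall>n m. cmod (\<psi> n m) \<le> C * exp (- a * real_of_int (l1norm (m - n))))" for a
    by (rule localised_eigenbasis(2)[OF nz])
qed

end
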